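(* Let $(X_\eta,S)$ be a proximal $\mathscr{B}$-free subshift. Let $\mathscr{B}'$ be the unique taut set associated to $\mathscr{B}$ (characterised in the context), with $\eta'$ the characteristic function of $\mathcal{F}_{\mathscr{B}'}$. Assume that $\tau\in\mathrm{Aut}(X_\eta,S)$. Then $X_{\eta'}=\mathrm{supp}(\nu_\eta)=\mathrm{supp}(\nu_{\eta'})$ and $\tau(X_{\eta'})=X_{\eta'}$, with $\tau|_{X_{\eta'}}=S^k|_{X_{\eta'}}$ for some $k\in\mathbb{Z}$.
   Context: $\mathscr{B}\subset\mathbb{N}=\{1,2,\dots\}$ is assumed primitive (no element of $\mathscr{B}$ divides another element of $\mathscr{B}$) and $\mathscr{B}\neq\{1\}$. For a set $\mathscr{B}$ put $\mathcal{F}_{\mathscr{B}}=\mathbb{Z}\setminus\bigcup_{b\in\mathscr{B}}b\mathbb{Z}$ and let $\eta\in\{0,1\}^{\mathbb{Z}}$ be its characteristic function. Let $S$ be the left shift on $\{0,1\}^{\mathbb{Z}}$ (product topology, product metric $d$), $(Sx)(j)=x(j+1)$. The $\mathscr{B}$-free subshift is $(X_\eta,S)$ with $X_\eta=\overline{\{S^r\eta: r\in\mathbb{Z}\}}$. It is proximal if for any $x,y\in X_\eta$ there is a sequence $(r_k)$ tending to infinity with $d(S^{r_k}x,S^{r_k}y)\to 0$. $\mathrm{Aut}(X,S)$ is the group of homeomorphisms of $X$ commuting with $S$. The logarithmic density $\delta(\mathcal{F}_{\mathscr{B}})=\lim_{N\to\infty}\frac{1}{\log N}\sum_{n\in\mathcal{F}_{\mathscr{B}}\cap\{1,\dots,N\}}\frac1n$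 exists for every $\mathscr{B}$. $\mathscr{B}$ is taut if $\delta(\mathcal{F}_{\mathscr{B}})<\delta(\mathcal{F}_{\mathscr{B}\setminus\{b\}})$ for each $b\in\mathscr{B}$. Mirsky measure: let $H$ be the closure of $\{(n \bmod b)_{b\in\mathscr{B}}: n\in\mathbb{Z}\}$ in the compact group $\prod_{b\in\mathscr{B}}\mathbb{Z}/b\mathbb{Z}$, with normalized Haar measure $m_H$, and let $\varphi:H\to\{0,1\}^{\mathbb{Z}}$ be given by $\varphi(h)(n)=1$ if and only if $h_b+n\not\equiv 0 \bmod b$ for all $b\in\mathscr{B}$. The Mirsky measure $\nu_\eta$ is the push-forward $\varphi_*m_H$; equivalently, $\int f\,d\nu_\eta=\lim_{N\to\infty}\frac1{\log N}\sum_{n=1}^N\frac1n f(S^n\eta)$ for every continuous $f$. The measure $\nu_{\eta'}$ is defined in the same way from $\mathscr{B}'$. For a subshift $X$, $\widetilde{X}$ denotes the smallest set containing $X$ that is hereditary (closed under passing to coordinatewise smaller elements of $\{0,1\}^{\mathbb{Z}}$), and $M(X,S)$ is the set of $S$-invariant Borel probability measures on $X$. It is known that for any $\mathscr{B}$ there is a unique taut set $\mathscr{B}'$ such that $\eta'\le\eta$, $X_{\eta'}\subset\widetilde{X}_\eta$, $\nu_\eta=\nu_{\eta'}$ and $M(\widetilde{X}_\eta,S)=M(\widetilde{X}_{\eta'},S)$. (The case $\mathscr{B}'=\{1\}$, $X_{\eta'}=\{0^{\mathbb{Z}}\}$, is allowed; it occurs when $\delta(\mathcal{F}_{\mathscr{B}})=0$.)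 *)

theory Defs
  imports "HOL-Probability.Probability" "HOL-Algebra.Elementary_Groups"
    "HOL-Algebra.Product_Groups"
begin

text \<open>Points of the full shift are functions \<^typ>\<open>int \<Rightarrow> nat\<close> with values in \<open>{0, 1}\<close>. The topology, the
  product metric \<^const>\<open>dist\<close>, the Borel sets and the coordinatewise order are the library instances
  for functions; \<^term>\<open>full_shift\<close> is a closed subset of this type.\<close>

definition full_shift :: "(int \<Rightarrow> nat) set" where
  "full_shift = {x. \<forall>j. x j \<in> {0, 1}}"

definition shift_by :: "int \<Rightarrow> (int \<Rightarrow> nat) \<Rightarrow> int \<Rightarrow> nat" where
  "shift_by r x = (\<lambda>j. x (j + r))"

definition proximal :: "(int \<Rightarrow> nat) set \<Rightarrow> bool" where
  "proximal X \<longleftrightarrow> (\<forall>x\<in>X. \<forall>y\<in>X. \<exists>r :: nat \<Rightarrow> int. filterlim r at_top sequentially \<and>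
     (\<lambda>k. dist (shift_by (r k) x) (shift_by (r k) y)) \<longlonglongrightarrow> 0)"

text \<open>Elements of \<open>Aut X\<close> are total functions of which only the values on \<open>X\<close> matter.\<close>

definition Aut :: "(int \<Rightarrow> nat) set \<Rightarrow> ((int \<Rightarrow> nat) \<Rightarrow> (int \<Rightarrow> nat)) set" where
  "Aut X = {\<tau>. (\<exists>\<sigma>. homeomorphism X X \<tau> \<sigma>) \<and> (\<forall>x\<in>X. \<tau> (shift_by 1 x) = shift_by 1 (\<tau> x))}"

definition hereditary :: "(int \<Rightarrow> nat) set \<Rightarrow> bool" where
  "hereditary Y \<longleftrightarrow> (\<forall>x\<in>Y. \<forall>y\<in>full_shift. y \<le> x \<longrightarrow> y \<in> Y)"

text \<open>A measure on \<open>X\<close> is rendered as a Borel measure on the ambient space giving \<open>X\<close> full mass, so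
  that measures on different subshifts can be compared. This is only meant for Borel sets \<open>X\<close>
  (closed subsets of \<^term>\<open>full_shift\<close> and their hereditary closures, which are closed again).\<close>

definition invariant_measures :: "(int \<Rightarrow> nat) set \<Rightarrow> (int \<Rightarrow> nat) measure set" where
  "invariant_measures X = {\<mu>. sets \<mu> = sets borel \<and> prob_space \<mu> \<and> emeasure \<mu> X = 1 \<and>
     distr \<mu> borel (shift_by 1) = \<mu>}"

definition supp :: "(int \<Rightarrow> nat) measure \<Rightarrow> (int \<Rightarrow> nat) set" where
  "supp \<mu> = {x. \<forall>U. open U \<and> x \<in> U \<longrightarrow> emeasure \<mu> U > 0}"

definition primitive :: "nat set \<Rightarrow> bool" where
  "primitive B \<longleftrightarrow> (\<forall>a\<in>B. \<forall>b\<in>B. a dvd b \<longrightarrow> a = b)"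

definition free_set :: "nat set \<Rightarrow> int set" where
  "free_set B = UNIV - (\<Union>b\<in>B. {int b * k | k. True})"

definition eta :: "nat set \<Rightarrow> int \<Rightarrow> nat" where
  "eta B = indicator (free_set B)"

definition X_eta :: "nat set \<Rightarrow> (int \<Rightarrow> nat) set" where
  "X_eta B = closure (range (\<lambda>r. shift_by r (eta B)))"

definition log_density :: "int set \<Rightarrow> real" where
  "log_density A = lim (\<lambda>N. (\<Sum>n | n \<in> {1..N} \<and> int n \<in> A. 1 / real n) / ln (real N))"

definition taut :: "nat set \<Rightarrow> bool" where
  "taut B \<longleftrightarrow> 0 \<notin> B \<and>
     (\<forall>b\<in>B. log_density (free_set B) < log_density (free_set (B - {b})))"

text \<open>Normalized Haar measure of a compact group with multiplication \<open>G\<close> and topology \<open>T\<close>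
  (on \<open>carrier G\<close>): the unique translation-invariant probability measure on the Borel sets of \<open>T\<close>.\<close>

definition haar_measure :: "('a, 'b) monoid_scheme \<Rightarrow> 'a topology \<Rightarrow> 'a measure" where
  "haar_measure G T = (THE m. space m = carrier G \<and>
     sets m = sigma_sets (carrier G) {U. openin T U} \<and> prob_space m \<and>
     (\<forall>g\<in>carrier G. distr m m (\<lambda>h. g \<otimes>\<^bsub>G\<^esub> h) = m))"

text \<open>The compact group \<open>\<Prod>b\<in>B. \<int>/b\<int>\<close> for \<open>0 \<notin> B\<close>: residues mod \<open>b\<close> are represented in \<open>{0..<b}\<close>, and
  families are \<^const>\<open>undefined\<close> outside \<open>B\<close>. For \<open>b = 0\<close> the library group \<^term>\<open>integer_mod_group 0\<close>
  would be \<open>\<int>\<close>.\<close>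

definition residue_product :: "nat set \<Rightarrow> (nat \<Rightarrow> int) monoid" where
  "residue_product B = product_group B integer_mod_group"

definition residue_topology :: "nat set \<Rightarrow> (nat \<Rightarrow> int) topology" where
  "residue_topology B =
     product_topology (\<lambda>b. discrete_topology (carrier (integer_mod_group b))) B"

definition H_set :: "nat set \<Rightarrow> (nat \<Rightarrow> int) set" where
  "H_set B = residue_topology B closure_of range (\<lambda>n :: int. \<lambda>b\<in>B. n mod int b)"

definition haar_H :: "nat set \<Rightarrow> (nat \<Rightarrow> int) measure" where
  "haar_H B = haar_measure ((residue_product B)\<lparr>carrier := H_set B\<rparr>)
     (subtopology (residue_topology B) (H_set B))"

definition \<phi> :: "nat set \<Rightarrow> (nat \<Rightarrow> int) \<Rightarrow> int \<Rightarrow> nat" where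
  "\<phi> B h n = (if \<forall>b\<in>B. (h b + n) mod int b \<noteq> 0 then 1 else 0)"

definition mirsky :: "nat set \<Rightarrow> (int \<Rightarrow> nat) measure" where
  "mirsky B = distr (haar_H B) borel (\<phi> B)"

text \<open>The properties characterising, for given \<open>B\<close>, the associated taut set \<open>B'\<close>.\<close>

definition taut_companion :: "nat set \<Rightarrow> nat set \<Rightarrow> bool" where
  "taut_companion B B' \<longleftrightarrow> taut B' \<and> eta B' \<le> eta B \<and>
     X_eta B' \<subseteq> hereditary hull X_eta B \<and> mirsky B = mirsky B' \<and>
     invariant_measures (hereditary hull X_eta B) = invariant_measures (hereditary hull X_eta B')"

end

theory Submission
  imports Defs "HOL-Number_Theory.Number_Theory"
begin

text \<open>The Haar measure of \<open>H\<close> is realised by a random profinite integer \<open>\<xi>\<close>, so that \<open>mirsky B\<close> is the law of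
  the pattern recording which \<open>\<xi> + n\<close> are \<open>B\<close>-free. The logarithmic density of \<open>free_set A\<close> is the
  probability that \<open>\<xi>\<close> is \<open>A\<close>-free; the lower bound is a Harris inequality for functions of \<open>gcd \<xi> L\<close> that
  decrease along divisibility. It also turns tautness into the statement that, for \<open>c\<close> in
  \<open>free_set B\<close>, the numbers \<open>b / gcd b c\<close> that are coprime to \<open>fact K\<close> are rarely hit for large \<open>K\<close>, and a
  union bound then shows that every pattern of \<open>eta B\<close> has positive Mirsky measure, even with one further
  position prescribed to be divisible by any number coprime to a suitable \<open>X\<close>. Hence \<open>X_eta B\<close> is the
  support of \<open>mirsky B\<close>.

  Proximality gives arbitrarily long intervals of zeros of \<open>eta B\<close>, hence of \<open>eta B'\<close>, so \<open>B'\<close> contains elements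
  coprime to any given number and \<open>X_eta B'\<close> is hereditary: ones can be erased one at a time. The
  equality of the sets of invariant measures then places the \<open>\<tau>\<close>-image of the Mirsky measure on
  \<open>X_eta B'\<close>, which is therefore preserved by \<open>\<tau>\<close>. After composition with a shift, \<open>\<tau>\<close> maps the sequence
  with a single one at \<open>0\<close> to a sequence with a one at \<open>0\<close>. This forces \<open>\<tau> x \<le> x\<close> on \<open>X_eta B'\<close>, since
  otherwise some image would have ones in all residue classes modulo an element of \<open>B'\<close>; the same
  holds for the inverse.\<close>

section \<open>A correlation inequality for divisibility\<close>

text \<open>Elements of a taut set need not be pairwise coprime, so divisibility of
  \<open>\<xi> + j\<close> by different \<open>b\<close> is not independent and no product formula
  is at hand. Two substitutes carry the argument: positive correlation, which survives without
  coprimality, and independence of a residue class modulo \<open>L\<close> from divisors coprime to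
  \<open>L\<close>. Blocks are therefore placed in classes where every \<open>b\<close> that can
  divide \<open>n + j\<close> leaves a quotient coprime to \<open>L\<close>. Logarithmic weights are
  natural because the ordinary density of \<open>free_set A\<close> may fail to exist, while
  \<open>1 / n\<close> is, up to a factor, the probability that a gcd with a highly divisible square
  equals \<open>n\<close>. The subset \<open>X_eta B'\<close> has no evident topological description
  that \<open>\<tau>\<close> must respect, which is why it is reached through invariant measures.
  The rigidity of \<open>\<tau>\<close> rests on one obstruction: a point of \<open>X_eta B'\<close>
  cannot have ones in all residue classes modulo an element of \<open>B'\<close>, already on a
  finite window.\<close>

definition dvd_antitone :: "(nat \<Rightarrow> real) \<Rightarrow> bool" where
  "dvd_antitone f \<longleftrightarrow> (\<forall>d e. d dvd e \<longrightarrow> f e \<le> f d)"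

definition gcd_sum :: "nat \<Rightarrow> (nat \<Rightarrow> real) \<Rightarrow> real" where
  "gcd_sum L f = (\<Sum>n<L. f (gcd n L))"

text \<open>The nonnegative products, summed over all pairs, expand to twice the difference of the
  two sides.\<close>

lemma chebyshev_double_sum:
  fixes f g :: "'a \<Rightarrow> real"
  assumes "\<And>x y. x \<in> A \<Longrightarrow> y \<in> A \<Longrightarrow> 0 \<le> (f x - f y) * (g x - g y)"
  shows "sum f A * sum g A \<le> card A * (\<Sum>x\<in>A. f x * g x)"
proof -
  have "0 \<le> (\<Sum>x\<in>A. \<Sum>y\<in>A. (f x - f y) * (g x - g y))"
    by (intro sum_nonneg assms)
  also have "\<dots> = 2 * (card A * (\<Sum>x\<in>A. f x * g x) - sum f A * sum g A)"
    by (simp add: algebra_simps sum.distrib sum_subtractf sum_distrib_left sum_distrib_right sum_product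
        sum.swap[of "\<lambda>x y. f y * g x"])
  finally show ?thesis by simp
qed

lemma bij_betw_mod_pair:
  fixes L M :: nat
  assumes "coprime L M" "L > 0" "M > 0"
  shows "bij_betw (\<lambda>n. (n mod L, n mod M)) {..<L * M} ({..<L} \<times> {..<M})"
proof -
  have inj: "inj_on (\<lambda>n. (n mod L, n mod M)) {..<L * M}"
  proof (rule inj_onI)
    fix x y assume *: "x \<in> {..<L * M}" "y \<in> {..<L * M}" "(x mod L, x mod M) = (y mod L, y mod M)"
    then have "[x = y] (mod L * M)"
      using assms(1) coprime_cong_mult_nat unfolding cong_def by blast
    then show "x = y" using * by (simp add: cong_def)
  qed
  have "(\<lambda>n. (n mod L, n mod M)) ` {..<L * M} = {..<L} \<times> {..<M}"
    by (rule card_subset_eq) (use assms inj in \<open>auto simp: card_image\<close>)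
  with inj show ?thesis by (simp add: bij_betw_def)
qed

lemma gcd_mult_coprime_right:
  fixes n L M :: nat
  assumes "coprime L M"
  shows "gcd n (L * M) = gcd n L * gcd n M"
proof (rule dvd_antisym)
  obtain b c where bc: "gcd n (L * M) = b * c" "b dvd L" "c dvd M"
    using division_decomp[of "gcd n (L * M)" L M] by auto
  then have "b dvd n" "c dvd n" by (metis dvd_mult_left gcd_dvd1, metis dvd_mult_right gcd_dvd1)
  with bc show "gcd n (L * M) dvd gcd n L * gcd n M" by (simp add: mult_dvd_mono)
next
  have "coprime (gcd n L) (gcd n M)"
    by (rule coprime_divisors[OF _ _ assms]) auto
  then show "gcd n L * gcd n M dvd gcd n (L * M)"
    by (intro gcd_greatest divides_mult mult_dvd_mono) auto
qed

text \<open>By the Chinese remainder theorem the residues modulo \<open>L\<close> and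
  \<open>M\<close> range independently, and the gcd with \<open>L * M\<close> splits
  accordingly.\<close>

lemma gcd_sum_mult:
  assumes "coprime L M" "L > 0" "M > 0"
  shows "gcd_sum (L * M) f = (\<Sum>u<L. \<Sum>v<M. f (gcd u L * gcd v M))"
proof -
  have gm: "gcd (n mod k) k = gcd n k" for n k :: nat
    by (metis gcd_red_nat gcd.commute)
  have "gcd_sum (L * M) f = (\<Sum>n<L * M. f (gcd (n mod L) L * gcd (n mod M) M))"
    unfolding gcd_sum_def gcd_mult_coprime_right[OF assms(1)] gm ..
  also have "\<dots> = (\<Sum>(u,v)\<in>{..<L} \<times> {..<M}. f (gcd u L * gcd v M))"
    using sum.reindex_bij_betw[OF bij_betw_mod_pair[OF assms], of "\<lambda>(u,v). f (gcd u L * gcd v M)"]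
    by simp
  finally show ?thesis by (simp add: sum.cartesian_product)
qed

lemma gcd_sum_mono_factor:
  assumes "dvd_antitone f"
  shows "dvd_antitone (\<lambda>d. \<Sum>v<M. f (d * gcd v M))"
  using assms unfolding dvd_antitone_def by (intro allI impI sum_mono) (simp add: mult_dvd_mono)

text \<open>For a prime power the gcds form a chain under divisibility, so \<open>f\<close> and
  \<open>g\<close> are ordered alike and Chebyshev's sum inequality applies. Otherwise
  \<open>L\<close> splits into coprime factors \<open>P\<close> and \<open>M\<close>. Summing out
  the residue modulo \<open>M\<close> keeps the functions antitone, so the induction hypothesis
  applies to the outer sums and, for each fixed \<open>u\<close>, to the inner ones.\<close>

lemma gcd_sum_harris:
  assumes "L > 0" "dvd_antitone f" "dvd_antitone g"
  shows "gcd_sum L f * gcd_sum L g \<le> L * gcd_sum L (\<lambda>d. f d * g d)"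
  using assms
proof (induction L arbitrary: f g rule: less_induct)
  case (less L)
  show ?case
  proof (cases "\<exists>p k. prime p \<and> L = p ^ k")
    case True
    then obtain p k where p: "prime p" "L = p ^ k" by blast
    have "0 \<le> (f (gcd n L) - f (gcd m L)) * (g (gcd n L) - g (gcd m L))" for n m
    proof -
      obtain i j where ij: "gcd n L = p ^ i" "gcd m L = p ^ j"
        using p by (metis divides_primepow_nat gcd_dvd2)
      consider "i \<le> j" | "j \<le> i" by linarith
      then show ?thesis
      proof cases
        case 1
        then have "p ^ i dvd p ^ j" by (rule le_imp_power_dvd)
        then show ?thesis using less.prems(2,3) unfolding ij dvd_antitone_def
          by (intro mult_nonneg_nonneg) auto
      next
        case 2
        then have "p ^ j dvd p ^ i" by (rule le_imp_power_dvd)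
        then show ?thesis using less.prems(2,3) unfolding ij dvd_antitone_def
          by (intro mult_nonpos_nonpos) auto
      qed
    qed
    from chebyshev_double_sum[where A = "{..<L}", OF this] show ?thesis by (simp add: gcd_sum_def)
  next
    case False
    \<comment> \<open>\<open>L = 1\<close> counts as the prime power \<open>2 ^ 0\<close>, so here a
      prime factor exists.\<close>
    then have "L \<noteq> 1" by (metis power_0 two_is_prime_nat)
    then obtain p where p: "prime p" "p dvd L" by (metis prime_factor_nat)
    define P where "P = p ^ multiplicity p L"
    obtain M where M: "L = P * M" "\<not> p dvd M"
      using multiplicity_decompose'[of L p] p less.prems(1) unfolding P_def
      by (metis not_prime_unit less_not_refl)
    have cop: "coprime P M" using M(2) p(1) unfolding P_def by (simp add: prime_imp_coprime)
    have "P * M > 0" using less.prems(1) unfolding M(1)[symmetric] .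
    then have pos: "P > 0" "M > 0" by auto
    have "M \<noteq> 1" using False M(1) p(1) unfolding P_def by (metis mult.right_neutral)
    with pos have "P * 1 < P * M" by (subst mult_less_cancel1) auto
    then have P: "P < L" unfolding M(1)[symmetric] by simp
    have "P \<noteq> 1" using p M by (metis mult_1)
    with pos have "1 * M < P * M" by (subst mult_less_cancel2) auto
    then have Ml: "M < L" unfolding M(1)[symmetric] by simp
    define F where "F d = (\<Sum>v<M. f (d * gcd v M))" for d
    define G where "G d = (\<Sum>v<M. g (d * gcd v M))" for d
    have anti: "dvd_antitone F" "dvd_antitone G"
      unfolding F_def G_def by (intro gcd_sum_mono_factor less.prems)+
    have anti2: "dvd_antitone (\<lambda>d. f (c * d))" "dvd_antitone (\<lambda>d. g (c * d))" for c
      using less.prems(2,3) by (auto simp: dvd_antitone_def)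
    have "gcd_sum L f * gcd_sum L g = gcd_sum P F * gcd_sum P G"
      using gcd_sum_mult[OF cop pos] by (simp add: M(1)[symmetric] gcd_sum_def F_def G_def)
    also have "\<dots> \<le> P * gcd_sum P (\<lambda>d. F d * G d)"
      by (rule less.IH[OF P pos(1) anti])
    also have "gcd_sum P (\<lambda>d. F d * G d) \<le> (\<Sum>u<P. M * (\<Sum>v<M. f (gcd u P * gcd v M) * g (gcd u P * gcd v M)))"
      unfolding gcd_sum_def F_def G_def
      by (intro sum_mono) (use less.IH[OF Ml pos(2) anti2] in \<open>simp add: gcd_sum_def\<close>)
    also have "\<dots> = M * gcd_sum L (\<lambda>d. f d * g d)"
      using gcd_sum_mult[OF cop pos, of "\<lambda>d. f d * g d"] by (simp add: M(1)[symmetric] sum_distrib_left)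
    finally have "gcd_sum L f * gcd_sum L g \<le> real (P * M) * gcd_sum L (\<lambda>d. f d * g d)"
      by (simp add: mult.assoc mult_left_mono)
    then show ?thesis unfolding M(1)[symmetric] .
  qed
qed

section \<open>Counting the free residues modulo a common multiple\<close>

lemma mem_free_set: "x \<in> free_set A \<longleftrightarrow> (\<forall>a\<in>A. \<not> int a dvd x)"
  by (auto simp: free_set_def dvd_def)

definition free_count :: "nat set \<Rightarrow> nat \<Rightarrow> nat" where
  "free_count A L = card {n. n < L \<and> int n \<in> free_set A}"

lemma free_set_gcd:
  assumes "\<forall>a\<in>A. a dvd L"
  shows "int (gcd n L) \<in> free_set A \<longleftrightarrow> int n \<in> free_set A"
  using assms by (auto simp: mem_free_set)

lemma free_count_gcd_sum:
  assumes "\<forall>a\<in>A. a dvd L"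
  shows "real (free_count A L) = gcd_sum L (\<lambda>d. indicator (free_set A) (int d))"
proof -
  have "gcd_sum L (\<lambda>d. indicator (free_set A) (int d)) = (\<Sum>n<L. indicator {n. int n \<in> free_set A} n)"
    unfolding gcd_sum_def indicator_def using free_set_gcd[OF assms] by (intro sum.cong) auto
  also have "\<dots> = card ({..<L} \<inter> {n. int n \<in> free_set A})"
    by (simp add: indicator_def sum.If_cases)
  also have "{..<L} \<inter> {n. int n \<in> free_set A} = {n. n < L \<and> int n \<in> free_set A}" by auto
  finally show ?thesis by (simp add: free_count_def)
qed

lemma dvd_antitone_free: "dvd_antitone (\<lambda>d. indicator (free_set A) (int d))"
  unfolding dvd_antitone_def mem_free_set indicator_def by (auto dest: dvd_trans)

lemma free_count_harris:
  assumes "L > 0" "\<forall>a\<in>A \<union> A'. a dvd L"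
  shows "free_count A L * free_count A' L \<le> L * free_count (A \<union> A') L"
proof -
  have "indicator (free_set (A \<union> A')) (int d) = (indicator (free_set A) (int d) * indicator (free_set A') (int d) :: real)" for d
    by (auto simp: indicator_def mem_free_set)
  then have "real (free_count A L) * free_count A' L \<le> L * free_count (A \<union> A') L"
    using gcd_sum_harris[OF assms(1) dvd_antitone_free dvd_antitone_free, of A A'] assms(2)
    by (simp add: free_count_gcd_sum)
  then show ?thesis by (metis of_nat_le_iff of_nat_mult)
qed

text \<open>The square is the point: \<open>n\<close> still divides \<open>X\<^sup>2 div n\<close>,
  so dividing by \<open>n\<close> loses no prime factor.\<close>

lemma totient_square_div:
  assumes "n dvd X" "X > 0"
  shows "n * totient (X\<^sup>2 div n) = totient (X\<^sup>2)"
proof -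
  obtain m where m: "X = n * m" using assms by blast
  then have n: "n > 0" using assms by auto
  have "X\<^sup>2 = n * (X\<^sup>2 div n)" using m by (simp add: power2_eq_square)
  moreover have "n dvd X\<^sup>2 div n" using m n by (simp add: power2_eq_square)
  then have "gcd n (X\<^sup>2 div n) = n" by simp
  ultimately show ?thesis using totient_gcd[of n "X\<^sup>2 div n"] n
    by (metis mult.commute mult.left_commute nat_mult_eq_cancel1 totient_gt_0_iff)
qed

lemma card_gcd_eq:
  fixes L n :: nat
  assumes "L > 0" "n dvd L"
  shows "card {u. u < L \<and> gcd u L = n} = totient (L div n)"
proof -
  have "bij_betw (\<lambda>u. if u = L then 0 else u) {u\<in>{0<..L}. gcd u L = n} {u. u < L \<and> gcd u L = n}"
    by (rule bij_betw_byWitness[where f' = "\<lambda>u. if u = 0 then L else u"]) (use assms in \<open>auto split: if_splits\<close>)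
  then have "card {u. u < L \<and> gcd u L = n} = card {u\<in>{0<..L}. gcd u L = n}"
    by (simp add: bij_betw_same_card)
  then show ?thesis using card_gcd_eq_totient[OF assms] by simp
qed

text \<open>Under the uniform distribution on \<open>{..<X\<^sup>2}\<close>, the events \<open>gcd u X\<^sup>2 = n\<close> with \<open>n \<le> N\<close> have
  probability proportional to \<open>1 / n\<close>, and \<open>gcd u X\<^sup>2 \<le> N\<close> is a decreasing event.\<close>

lemma free_count_harmonic:
  assumes "X > 0" "\<forall>n\<in>{1..N}. n dvd X" "\<forall>a\<in>A. a dvd X"
  shows "free_count A (X\<^sup>2) * (\<Sum>n=1..N. 1 / real n)
    \<le> X\<^sup>2 * (\<Sum>n=1..N. indicator (free_set A) (int n) / real n)"
proof -
  define L where "L = X\<^sup>2"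
  have L: "L > 0" using assms(1) by (simp add: L_def)
  have dvdL: "\<forall>n\<in>{1..N}. n dvd L" "\<forall>a\<in>A. a dvd L"
    using assms by (auto simp: L_def power2_eq_square)
  define g where "g d = (indicator {1..N} d :: real)" for d
  have g: "dvd_antitone g"
    unfolding dvd_antitone_def g_def indicator_def
    by (auto dest: dvd_imp_le)
  \<comment> \<open>Sorting \<open>u\<close> by its gcd \<open>n\<close> gives the weights
    \<open>totient (L div n)\<close>, which equal \<open>totient L / n\<close> because
    \<open>L\<close> is the square of a multiple of \<open>n\<close>.\<close>
  have weighted: "gcd_sum L (\<lambda>d. h d * g d) = totient L * (\<Sum>n=1..N. h n / real n)" for h :: "nat \<Rightarrow> real"
  proof -
    have "gcd_sum L (\<lambda>d. h d * g d) = (\<Sum>u<L. \<Sum>n=1..N. if gcd u L = n then h n else 0)"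
      unfolding gcd_sum_def g_def by (intro sum.cong) (auto simp: sum.delta' indicator_def)
    also have "\<dots> = (\<Sum>n=1..N. \<Sum>u<L. if gcd u L = n then h n else 0)"
      by (rule sum.swap)
    also have "\<dots> = (\<Sum>n=1..N. card {u. u < L \<and> gcd u L = n} * h n)"
    proof (intro sum.cong refl)
      fix n
      have "{..<L} \<inter> {u. gcd u L = n} = {u. u < L \<and> gcd u L = n}" by auto
      then show "(\<Sum>u<L. if gcd u L = n then h n else 0) = card {u. u < L \<and> gcd u L = n} * h n"
        by (simp add: sum.If_cases)
    qed
    also have "\<dots> = (\<Sum>n=1..N. totient L * (h n / real n))"
    proof (intro sum.cong refl)
      fix n assume n: "n \<in> {1..N}"
      have "real n * totient (L div n) = totient L"
        using totient_square_div[of n X] assms n unfolding L_def by (metis of_nat_mult)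
      then show "card {u. u < L \<and> gcd u L = n} * h n = totient L * (h n / real n)"
        using card_gcd_eq[OF L] dvdL n by (simp add: field_simps)
    qed
    finally show ?thesis by (simp add: sum_distrib_left)
  qed
  have "gcd_sum L (\<lambda>d. indicator (free_set A) (int d)) * gcd_sum L (\<lambda>d. 1 * g d)
      \<le> L * gcd_sum L (\<lambda>d. indicator (free_set A) (int d) * g d)"
    using gcd_sum_harris[OF L dvd_antitone_free g] by simp
  then have "totient L * (free_count A L * (\<Sum>n=1..N. 1 / real n))
      \<le> totient L * (L * (\<Sum>n=1..N. indicator (free_set A) (int n) / real n))"
    unfolding weighted using free_count_gcd_sum[OF dvdL(2)] by (simp add: mult_ac)
  then show ?thesis using L by (simp add: mult_le_cancel_left L_def)
qed

section \<open>A random profinite integer\<close>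

text \<open>For \<open>u\<close> uniform in \<open>[0, 1)\<close>, the digits \<open>\<lfloor>u * fact K\<rfloor> mod K\<close> are independent and uniform. They are the
  factorial-base digits of a Haar-random profinite integer \<open>\<xi>\<close>, and \<open>rint K u\<close> is its residue modulo
  \<open>fact K\<close>.\<close>

fun rint :: "nat \<Rightarrow> real \<Rightarrow> nat" where
  "rint 0 u = 0"
| "rint (Suc K) u = rint K u + fact K * (nat \<lfloor>u * fact (Suc K)\<rfloor> mod Suc K)"

definition unif :: "real measure" where
  "unif = uniform_measure lborel {0..<1}"

interpretation unif: prob_space unif
  unfolding unif_def by (rule prob_space_uniform_measure) auto

abbreviation Pr :: "real set \<Rightarrow> real" where
  "Pr \<equiv> measure unif"

lemma space_unif [simp]: "space unif = UNIV" and sets_unif [simp, measurable_cong]: "sets unif = sets borel"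
  by (simp_all add: unif_def)

lemma rint_measurable [measurable]: "rint K \<in> measurable borel (count_space UNIV)"
proof (induction K)
  case 0
  have "rint 0 = (\<lambda>u. 0)" by auto
  then show ?case by simp
next
  case (Suc K)
  have "(\<lambda>u::real. \<lfloor>u * fact (Suc K)\<rfloor>) \<in> measurable borel (count_space UNIV)"
    by (rule measurable_compose[OF _ measurable_real_floor]) (rule borel_measurable_times; simp)
  then have digit: "(\<lambda>u::real. nat \<lfloor>u * fact (Suc K)\<rfloor> mod Suc K) \<in> measurable borel (count_space UNIV)"
    by (rule measurable_compose) simp
  show ?case unfolding rint.simps
    by (rule measurable_compose_countable'[OF _ Suc]) (auto intro!: measurable_compose[OF digit])
qed

lemma rint_sets [measurable]: "{u. Q (rint K u)} \<in> sets borel"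
  using measurable_sets[OF rint_measurable, of "Collect Q" K] by (simp add: vimage_def)

lemma rint_less: "rint K u < fact K"
proof (induction K)
  case (Suc K)
  have "nat \<lfloor>u * fact (Suc K)\<rfloor> mod Suc K \<le> K" using less_Suc_eq_le by auto
  then have "rint (Suc K) u \<le> rint K u + fact K * K" by simp
  also have "\<dots> < fact (Suc K)" using Suc by simp
  finally show ?case .
qed simp

lemma rint_mod_fact:
  assumes "K \<le> K'"
  shows "rint K' u mod fact K = rint K u"
  using assms
proof (induction rule: dec_induct)
  case base
  then show ?case by (simp add: rint_less)
next
  case (step n)
  have "(fact K :: nat) dvd fact n" using step.hyps by (simp add: fact_dvd)
  then have "fact n * d mod fact K = 0" for d :: nat by auto
  then have "rint (Suc n) u mod fact K = rint n u mod fact K"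
    unfolding rint.simps by (metis add_0_right mod_add_right_eq)
  then show ?case using step.IH by simp
qed

text \<open>\<open>\<lfloor>u * fact K\<rfloor>\<close> and \<open>rint K u\<close> carry the same
  digits in opposite order of significance. Prescribing the residue therefore prescribes one
  interval of length \<open>1 / fact K\<close>.\<close>

lemma rint_cylinder:
  assumes "r < fact K"
  shows "\<exists>i<fact K. \<forall>u\<in>{0..<1}. rint K u = r \<longleftrightarrow> nat \<lfloor>u * fact K\<rfloor> = i"
  using assms
proof (induction K arbitrary: r)
  case 0
  then show ?case by (intro exI[of _ 0]) (auto simp: floor_eq_iff nat_eq_iff)
next
  case (Suc K)
  define r0 where "r0 = r mod fact K"
  define e where "e = r div fact K"
  have r: "r = r0 + fact K * e" "r0 < fact K" by (simp_all add: r0_def e_def)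
  have e: "e \<le> K" using Suc.prems unfolding e_def
    using less_mult_imp_div_less[of r "Suc K" "fact K"] by (simp add: less_Suc_eq_le)
  obtain i where i: "i < fact K" "\<And>u. u \<in> {0..<1} \<Longrightarrow> rint K u = r0 \<longleftrightarrow> nat \<lfloor>u * fact K\<rfloor> = i"
    using Suc.IH[OF r(2)] by blast
  have "rint (Suc K) u = r \<longleftrightarrow> nat \<lfloor>u * fact (Suc K)\<rfloor> = Suc K * i + e" if u: "u \<in> {0..<1}" for u
  proof -
    define m where "m = nat \<lfloor>u * fact (Suc K)\<rfloor>"
    define d where "d = m mod Suc K"
    have "u * fact K = u * fact (Suc K) / real (Suc K)" by (simp add: field_simps)
    then have "\<lfloor>u * fact K\<rfloor> = \<lfloor>u * fact (Suc K)\<rfloor> div int (Suc K)"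
      using floor_divide_real_eq_div[of "int (Suc K)" "u * fact (Suc K)"] by simp
    then have m: "nat \<lfloor>u * fact K\<rfloor> = m div Suc K"
      using u unfolding m_def by (simp add: nat_div_distrib del: of_nat_Suc fact_Suc)
    have "rint (Suc K) u = rint K u + fact K * d" by (simp add: m_def d_def)
    also have "\<dots> = r \<longleftrightarrow> rint K u = r0 \<and> d = e"
    proof
      assume *: "rint K u + fact K * d = r"
      then have "rint K u = r mod fact K" "d = r div fact K"
        using rint_less[of K u] by auto
      then show "rint K u = r0 \<and> d = e" by (simp add: r0_def e_def)
    qed (use r in auto)
    also have "\<dots> \<longleftrightarrow> m div Suc K = i \<and> m mod Suc K = e"
      using i(2)[OF u] m d_def by simp
    also have "\<dots> \<longleftrightarrow> m = Suc K * i + e"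
      using e by (auto simp del: mult_Suc)
    finally show ?thesis by (simp add: m_def)
  qed
  moreover have "Suc K * i + e < fact (Suc K)"
  proof -
    have "Suc K * (i + 1) \<le> Suc K * fact K" using i(1) by (intro mult_le_mono2) simp
    then show ?thesis using e by simp
  qed
  ultimately show ?case by blast
qed

lemma prob_rint:
  assumes "r < fact K"
  shows "Pr {u. rint K u = r} = 1 / fact K"
proof -
  obtain i where i: "i < fact K" "\<And>u. u \<in> {0..<1} \<Longrightarrow> rint K u = r \<longleftrightarrow> nat \<lfloor>u * fact K\<rfloor> = i"
    using rint_cylinder[OF assms] by blast
  define f :: real where "f = fact K"
  have f: "f > 0" by (simp add: f_def)
  have "real i + 1 \<le> f" using i(1) unfolding f_def
    by (metis Suc_leI of_nat_Suc of_nat_fact of_nat_le_iff add.commute)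
  have "u \<in> {0..<1} \<and> rint K u = r \<longleftrightarrow> i / f \<le> u \<and> u < (i + 1) / f" for u
  proof -
    have *: "i / f \<le> u \<and> u < (i + 1) / f \<longleftrightarrow> i \<le> u * f \<and> u * f < i + 1"
      using f by (simp add: pos_divide_le_eq pos_less_divide_eq)
    show ?thesis
    proof (cases "u \<in> {0..<1}")
      case True
      then have "0 \<le> u * f" using f by simp
      then have "nat \<lfloor>u * f\<rfloor> = i \<longleftrightarrow> \<lfloor>u * f\<rfloor> = int i" by (auto simp: nat_eq_iff2)
      also have "\<dots> \<longleftrightarrow> i \<le> u * f \<and> u * f < i + 1" by (simp add: floor_eq_iff add.commute)
      finally show ?thesis using True i(2)[OF True] * by (simp add: f_def algebra_simps)
    next
      case False
      have "0 \<le> i / f" "(i + 1) / f \<le> 1" using f \<open>real i + 1 \<le> f\<close> by simp_all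
      then have "\<not> (i / f \<le> u \<and> u < (i + 1) / f)" using False by auto
      then show ?thesis using False by blast
    qed
  qed
  then have "{0..<1} \<inter> {u. rint K u = r} = {i / f ..< (i + 1) / f}"
    by (auto simp only: atLeastLessThan_iff set_eq_iff Int_iff mem_Collect_eq)
  then have "measure lborel ({0..<1} \<inter> {u. rint K u = r}) = 1 / f"
    using f by (simp add: divide_right_mono diff_divide_distrib[symmetric])
  then show ?thesis
    unfolding unif_def f_def using rint_sets[of "\<lambda>x. x = r" K]
    by (subst measure_uniform_measure) (auto simp: )
qed

section \<open>Periodic conditions on the random integer\<close>

definition periodic :: "nat \<Rightarrow> (int \<Rightarrow> bool) \<Rightarrow> bool" where
  "periodic L Q \<longleftrightarrow> (\<forall>n. Q (n + int L) = Q n)"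

lemma periodic_mod:
  assumes "periodic L Q"
  shows "Q (n mod int L) = Q n"
proof -
  have *: "Q (n + int L * int k) = Q n" for n k
  proof (induction k)
    case (Suc k)
    have "Q (n + int L * int (Suc k)) = Q ((n + int L * int k) + int L)" by (simp add: algebra_simps)
    then show ?case using assms Suc by (metis periodic_def)
  qed simp
  have **: "Q (n + int L * k) = Q n" for n k
    using *[of n "nat k"] *[of "n + int L * k" "nat (-k)"] by (cases "k \<ge> 0") auto
  show ?thesis using **[of "n mod int L" "n div int L"] by simp
qed

lemma card_periodic:
  assumes "periodic L Q"
  shows "card {n. n < L * m \<and> Q (int n)} = m * card {n. n < L \<and> Q (int n)}"
proof (induction m)
  case (Suc m)
  have eq: "{n. n < L * Suc m \<and> Q (int n)} = {n. n < L * m \<and> Q (int n)} \<union> (\<lambda>n. n + L * m) ` {n. n < L \<and> Q (int n)}"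
  proof -
    have "Q (int (n + L * m)) = Q (int n)" for n
      using periodic_mod[OF assms] by (metis mod_mult_self2 of_nat_add of_nat_mult)
    moreover have "n \<in> (\<lambda>n. n + L * m) ` {n. n < L \<and> Q (int n)}" if "\<not> n < L * m" "n < L * Suc m" "Q (int n)" for n
      using that calculation[of "n - L * m"] by (intro image_eqI[of _ _ "n - L * m"]) auto
    ultimately show ?thesis by auto
  qed
  show ?case unfolding eq
    by (subst card_Un_disjoint) (auto simp: card_image Suc)
qed simp

text \<open>\<open>rint L u\<close> is uniform modulo \<open>fact L\<close>, a range made of
  \<open>fact (L - 1)\<close> full periods.\<close>

lemma prob_periodic:
  assumes "L > 0" "periodic L Q"
  shows "Pr {u. Q (int (rint L u))} = card {n. n < L \<and> Q (int n)} / L"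
proof -
  define R where "R = {n. n < fact L \<and> Q (int n)}"
  have "{u. Q (int (rint L u))} = (\<Union>r\<in>R. {u. rint L u = r})"
    using rint_less by (auto simp: R_def)
  also have "Pr \<dots> = (\<Sum>r\<in>R. Pr {u. rint L u = r})"
    by (rule measure_finite_Union) (auto simp: R_def disjoint_family_on_def)
  also have "\<dots> = card R / fact L"
    using prob_rint by (simp add: R_def)
  also have "fact L = real (L * fact (L - 1))" using assms(1) by (simp add: fact_reduce)
  also have "card R = fact (L - 1) * card {n. n < L \<and> Q (int n)}"
    using card_periodic[OF assms(2), of "fact (L - 1)"] assms(1) by (simp add: R_def fact_reduce)
  finally show ?thesis by simp
qed

text \<open>Rotation permutes the residues modulo \<open>L\<close>. The invariance of Haar measure
  and of the Mirsky measure goes back to this.\<close>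

lemma prob_periodic_shift:
  assumes "L > 0" "periodic L Q"
  shows "Pr {u. Q (int (rint L u) + c)} = Pr {u. Q (int (rint L u))}"
proof -
  have per: "Q (n mod int L) = Q n" for n by (rule periodic_mod[OF assms(2)])
  have c: "Pr {u. Q (int (rint L u) + c)} = card {n. n < L \<and> Q (int n + c)} / L"
  proof (rule prob_periodic)
    show "periodic L (\<lambda>n. Q (n + c))"
      using assms(2) by (simp add: periodic_def add.commute[of _ c] flip: add.assoc)
  qed (rule assms)
  have "bij_betw (\<lambda>n. nat ((int n + c) mod int L)) {n. n < L \<and> Q (int n + c)} {n. n < L \<and> Q (int n)}"
  proof (rule bij_betw_byWitness[where f' = "\<lambda>n. nat ((int n - c) mod int L)"])
    have inv: "nat ((int (nat ((int n + c) mod int L)) - c) mod int L) = n"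
        "nat ((int (nat ((int n - c) mod int L)) + c) mod int L) = n" if "n < L" for n
      using assms(1) that by (simp_all add: mod_diff_left_eq mod_add_left_eq)
    have ran: "nat (x mod int L) < L" for x using assms(1) by (simp add: nat_less_iff)
    have Qm: "Q (int (nat (x mod int L))) = Q x" for x using assms(1) per[of x] by simp
    have Qmc: "Q (int (nat (x mod int L)) + c) = Q (x + c)" for x
      using assms(1) per[of "x mod int L + c"] per[of "x + c"] by (simp add: mod_add_left_eq)
    show "\<forall>n\<in>{n. n < L \<and> Q (int n + c)}. nat ((int (nat ((int n + c) mod int L)) - c) mod int L) = n"
      using inv(1) by blast
    show "\<forall>n\<in>{n. n < L \<and> Q (int n)}. nat ((int (nat ((int n - c) mod int L)) + c) mod int L) = n"
      using inv(2) by blast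
    show "(\<lambda>n. nat ((int n + c) mod int L)) ` {n. n < L \<and> Q (int n + c)} \<subseteq> {n. n < L \<and> Q (int n)}"
      using ran Qm by blast
    show "(\<lambda>n. nat ((int n - c) mod int L)) ` {n. n < L \<and> Q (int n)} \<subseteq> {n. n < L \<and> Q (int n + c)}"
      using ran Qmc[of "int _ - c"] by auto
  qed
  then show ?thesis unfolding c prob_periodic[OF assms] by (simp add: bij_betw_same_card)
qed

lemma periodic_dvd: "a dvd L \<Longrightarrow> periodic L (\<lambda>n. int a dvd n + c)"
proof -
  assume "a dvd L"
  then have "int a dvd (n + c) + int L \<longleftrightarrow> int a dvd n + c" for n
    by (intro dvd_add_left_iff) simp
  then show ?thesis unfolding periodic_def by (metis add.commute add.left_commute)
qed

lemma periodic_not: "periodic L P \<Longrightarrow> periodic L (\<lambda>n. \<not> P n)"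
  and periodic_conj: "periodic L P \<Longrightarrow> periodic L Q \<Longrightarrow> periodic L (\<lambda>n. P n \<and> Q n)"
  and periodic_Ball: "(\<And>a. a \<in> A \<Longrightarrow> periodic L (R a)) \<Longrightarrow> periodic L (\<lambda>n. \<forall>a\<in>A. R a n)"
  unfolding periodic_def by auto

text \<open>The events that \<open>a\<close> divides \<open>\<xi> + c\<close> and that \<open>\<xi> + c\<close> is \<open>A\<close>-free; since \<open>a\<close> divides \<open>fact a\<close>, the
  residue of \<open>\<xi>\<close> modulo \<open>a\<close> is that of \<open>rint a u\<close>.\<close>

definition Dvd :: "nat \<Rightarrow> int \<Rightarrow> real set" where
  "Dvd a c = {u. int a dvd int (rint a u) + c}"

definition Free :: "nat set \<Rightarrow> int \<Rightarrow> real set" where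
  "Free A c = {u. \<forall>a\<in>A. u \<notin> Dvd a c}"

abbreviation all_free :: "nat set \<Rightarrow> int set \<Rightarrow> real set" where
  "all_free B J \<equiv> {u. \<forall>j\<in>J. u \<in> Free B j}"

abbreviation none_free :: "nat set \<Rightarrow> int set \<Rightarrow> real set" where
  "none_free B Z \<equiv> {u. \<forall>q\<in>Z. u \<notin> Free B q}"

section \<open>Measurability, truncation and independence of the events\<close>

lemma Dvd_sets [measurable]: "Dvd a c \<in> sets borel"
  unfolding Dvd_def by (rule rint_sets)

lemma Free_sets [measurable]: "Free A c \<in> sets borel"
proof -
  have "Free A c = (\<Inter>a\<in>A. - Dvd a c) \<inter> UNIV" by (auto simp: Free_def)
  then show ?thesis
    by (cases "A = {}") (auto intro!: sets.countable_INT'' simp: uncountable_infinite)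
qed

text \<open>Lets the events of several moduli be read off one residue modulo a common
  multiple.\<close>

lemma Dvd_iff:
  assumes "a > 0" "a dvd L" "L > 0"
  shows "u \<in> Dvd a c \<longleftrightarrow> int a dvd int (rint L u) + c"
proof -
  have "a \<le> L" using assms dvd_imp_le by blast
  then have "rint L u mod fact a = rint a u" by (rule rint_mod_fact)
  moreover have "a dvd fact a" using assms(1) by (simp add: dvd_fact)
  ultimately have "[rint L u = rint a u] (mod a)" by (metis cong_def mod_mod_cancel)
  then have "[int (rint L u) + c = int (rint a u) + c] (mod int a)"
    by (simp add: cong_add cong_int_iff)
  then show ?thesis unfolding Dvd_def by (simp add: cong_dvd_iff)
qed

lemma Free_eq_periodic:
  assumes "0 \<notin> A" "\<forall>a\<in>A. a dvd L" "L > 0"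
  shows "Free A c = {u. \<forall>a\<in>A. \<not> int a dvd int (rint L u) + c}"
  using assms Dvd_iff[of _ L] unfolding Free_def by (metis neq0_conv)

lemma prob_Free:
  assumes "0 \<notin> A" "\<forall>a\<in>A. a dvd L" "L > 0"
  shows "Pr (Free A 0) = free_count A L / L"
proof -
  have "periodic L (\<lambda>n. \<forall>a\<in>A. \<not> int a dvd n + 0)"
    using assms(2) by (intro periodic_Ball periodic_not periodic_dvd) auto
  from prob_periodic[OF assms(3) this] show ?thesis
    unfolding Free_eq_periodic[OF assms] free_count_def mem_free_set by simp
qed

text \<open>Continuity of measure from above. Exact counts are made for finite truncations, where
  freeness is periodic, and reach infinite sets through this limit.\<close>

lemma Free_tendsto:
  assumes [measurable]: "E \<in> sets borel"
  shows "(\<lambda>K. Pr (E \<inter> Free (A \<inter> {..K}) c)) \<longlonglongrightarrow> Pr (E \<inter> Free A c)"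
proof -
  have "E \<inter> Free A c = (\<Inter>K. E \<inter> Free (A \<inter> {..K}) c)" by (auto simp: Free_def)
  moreover have "decseq (\<lambda>K. E \<inter> Free (A \<inter> {..K}) c)"
    by (rule decseq_SucI) (auto simp: Free_def)
  moreover have "range (\<lambda>K. E \<inter> Free (A \<inter> {..K}) c) \<subseteq> sets unif"
    using assms Free_sets by (auto intro!: sets.Int)
  ultimately show ?thesis
    using unif.finite_Lim_measure_decseq[of "\<lambda>K. E \<inter> Free (A \<inter> {..K}) c"] by simp
qed

lemma Free_tendsto': "(\<lambda>K. Pr (Free (A \<inter> {..K}) c)) \<longlonglongrightarrow> Pr (Free A c)"
  using Free_tendsto[of UNIV] by simp

lemma Free_Un: "Free (A \<union> A') c = Free A c \<inter> Free A' c"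
  by (auto simp: Free_def)

lemma finite_common_multiple:
  assumes "finite A" "0 \<notin> A"
  shows "\<Prod>A > (0::nat)" "\<forall>a\<in>A. a dvd \<Prod>A"
proof -
  show "\<Prod>A > 0" using assms by (intro prod_pos) (metis gr0I)
  show "\<forall>a\<in>A. a dvd \<Prod>A" using assms(1) by (auto intro: dvd_prod_eqI)
qed

text \<open>Finite truncations are positively correlated by \<open>free_count_harris\<close>, and
  the limit keeps the inequality.\<close>

lemma prob_Free_harris:
  assumes "0 \<notin> A" "0 \<notin> A'"
  shows "Pr (Free A 0) * Pr (Free A' 0) \<le> Pr (Free (A \<union> A') 0)"
proof (rule LIMSEQ_le[OF tendsto_mult[OF Free_tendsto' Free_tendsto'] Free_tendsto'])
  have "Pr (Free (A \<inter> {..K}) 0) * Pr (Free (A' \<inter> {..K}) 0) \<le> Pr (Free ((A \<union> A') \<inter> {..K}) 0)" for K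
  proof -
    define L where "L = \<Prod>((A \<union> A') \<inter> {..K})"
    have L: "L > 0" "\<forall>a\<in>(A \<union> A') \<inter> {..K}. a dvd L"
      using finite_common_multiple[of "(A \<union> A') \<inter> {..K}"] assms by (auto simp: L_def)
    have U: "(A \<union> A') \<inter> {..K} = A \<inter> {..K} \<union> A' \<inter> {..K}" by auto
    have "free_count (A \<inter> {..K}) L * free_count (A' \<inter> {..K}) L \<le> L * free_count ((A \<union> A') \<inter> {..K}) L"
      unfolding U by (rule free_count_harris) (use L in auto)
    then have "real (free_count (A \<inter> {..K}) L) * free_count (A' \<inter> {..K}) L \<le> L * free_count ((A \<union> A') \<inter> {..K}) L"
      by (metis of_nat_le_iff of_nat_mult)
    then show ?thesis
      using L assms by (subst (1 2 3) prob_Free[of _ L]) (auto simp: field_simps)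
  qed
  then show "\<exists>N. \<forall>K\<ge>N. Pr (Free (A \<inter> {..K}) 0) * Pr (Free (A' \<inter> {..K}) 0) \<le> Pr (Free ((A \<union> A') \<inter> {..K}) 0)"
    by blast
qed

lemma Dvd_partition:
  assumes "L > 0"
  shows "u \<in> Dvd L (- int r) \<longleftrightarrow> rint L u mod L = r mod L"
  unfolding Dvd_def by (simp add: mod_eq_dvd_iff[symmetric] flip: zmod_int)

text \<open>Some integer \<open>t\<close> is congruent to \<open>r\<close> modulo \<open>L\<close>
  and to \<open>c\<close> modulo the product of \<open>A\<close>; translation by \<open>t\<close>
  relates this event to the one at the origin.\<close>

lemma prob_Dvd_Int_Free_shift:
  assumes "L > 0" "finite A" "0 \<notin> A" "\<forall>a\<in>A. coprime a L"
  shows "Pr (Dvd L r \<inter> Free A c) = Pr (Dvd L 0 \<inter> Free A 0)"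
proof -
  define M where "M = \<Prod>A"
  have M: "M > 0" "\<forall>a\<in>A. a dvd M" using finite_common_multiple[OF assms(2,3)] by (auto simp: M_def)
  have cop: "coprime (int L) (int M)"
    using assms(4) by (simp add: M_def prod_coprime_right coprime_commute)
  obtain t where t: "[t = r] (mod int L)" "[t = c] (mod int M)"
    using binary_chinese_remainder_int[OF cop] by blast
  define Q where "Q n \<longleftrightarrow> int L dvd n + 0 \<and> (\<forall>a\<in>A. \<not> int a dvd n + 0)" for n
  have LM: "L * M > 0" "\<forall>a\<in>A. a dvd L * M" using M assms(1) by auto
  have per: "periodic (L * M) Q"
    unfolding Q_def using M(2) by (intro periodic_conj periodic_Ball periodic_not periodic_dvd) auto
  have *: "Dvd L s \<inter> Free A d = {u. Q (int (rint (L * M) u) + v)}"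
    if "[v = s] (mod int L)" "[v = d] (mod int M)" for s d v
  proof -
    have "u \<in> Dvd L s \<longleftrightarrow> int L dvd int (rint (L * M) u) + v" for u
    proof -
      have "[int (rint (L * M) u) + s = int (rint (L * M) u) + v] (mod int L)"
        using that(1) by (simp add: cong_add cong_sym)
      then show ?thesis
        using Dvd_iff[of L "L * M"] assms(1) LM by (simp add: cong_dvd_iff)
    qed
    moreover have "int a dvd int (rint (L * M) u) + d \<longleftrightarrow> int a dvd int (rint (L * M) u) + v" if "a \<in> A" for u a
    proof -
      have "[v = d] (mod int a)" using M(2) that \<open>[v = d] (mod int M)\<close> by (meson cong_dvd_modulus int_dvd_int_iff)
      then have "[int (rint (L * M) u) + d = int (rint (L * M) u) + v] (mod int a)"
        by (simp add: cong_add cong_sym)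
      then show ?thesis by (simp add: cong_dvd_iff)
    qed
    ultimately show ?thesis unfolding Free_eq_periodic[OF assms(3) LM(2) LM(1)] Q_def by auto
  qed
  show ?thesis
    unfolding *[OF t] *[of 0 0 0, simplified] using prob_periodic_shift[OF LM(1) per] by simp
qed

text \<open>The \<open>L\<close> residue classes are disjoint, cover everything and contribute
  equally to the free event. The freedom in \<open>r\<close> and \<open>c\<close> allows a class and
  a position to be prescribed at once.\<close>

lemma prob_Dvd_Int_Free:
  assumes "L > 0" "0 \<notin> A" "\<forall>a\<in>A. coprime a L"
  shows "Pr (Dvd L r \<inter> Free A c) = Pr (Free A 0) / L"
proof -
  have fin: "Pr (Dvd L r \<inter> Free A' c) = Pr (Free A' 0) / L" if "finite A'" "A' \<subseteq> A" for A'
  proof -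
    have A': "0 \<notin> A'" "\<forall>a\<in>A'. coprime a L" using that assms by auto
    have "Free A' 0 = (\<Union>s<L. Dvd L (- int s) \<inter> Free A' 0)"
      using assms(1) by (auto simp: Dvd_partition intro!: bexI[of _ "rint L _ mod L"])
    also have "Pr \<dots> = (\<Sum>s<L. Pr (Dvd L (- int s) \<inter> Free A' 0))"
      by (rule unif.finite_measure_finite_Union) (auto simp: disjoint_family_on_def Dvd_partition assms)
    also have "\<dots> = L * Pr (Dvd L r \<inter> Free A' c)"
    proof -
      define q where "q = Pr (Dvd L 0 \<inter> Free A' 0)"
      have "Pr (Dvd L s \<inter> Free A' d) = q" for s d
        unfolding q_def by (rule prob_Dvd_Int_Free_shift[OF assms(1) that(1) A'])
      then show ?thesis by simp
    qed
    finally show ?thesis using assms(1) by simp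
  qed
  have "(\<lambda>K. Pr (Dvd L r \<inter> Free (A \<inter> {..K}) c)) \<longlonglongrightarrow> Pr (Free A 0) / L"
    using tendsto_divide[OF Free_tendsto'[of A 0] tendsto_const[of "real L"]] assms(1) fin by simp
  with Free_tendsto[of "Dvd L r" A c] show ?thesis by (intro LIMSEQ_unique) auto
qed

lemma Free_empty [simp]: "Free {} c = UNIV"
  by (simp add: Free_def)

lemma prob_unif_UNIV [simp]: "Pr UNIV = 1"
  using unif.prob_space by simp

lemma prob_Dvd: "L > 0 \<Longrightarrow> Pr (Dvd L r) = 1 / L"
  using prob_Dvd_Int_Free[of L "{}" r 0] by simp

text \<open>Finiteness makes \<open>Free A 0\<close> a union of residue classes modulo the product
  of \<open>A\<close>, each independent of \<open>Free A' 0\<close> by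
  \<open>prob_Dvd_Int_Free\<close>.\<close>

lemma prob_Free_indep:
  assumes "finite A" "0 \<notin> A" "0 \<notin> A'" "\<forall>a\<in>A. \<forall>a'\<in>A'. coprime a a'"
  shows "Pr (Free (A \<union> A') 0) = Pr (Free A 0) * Pr (Free A' 0)"
proof -
  define L where "L = \<Prod>A"
  have L: "L > 0" "\<forall>a\<in>A. a dvd L" using finite_common_multiple[OF assms(1,2)] by (auto simp: L_def)
  have cop: "\<forall>a'\<in>A'. coprime a' L"
    unfolding L_def using assms(4) by (intro ballI prod_coprime_right) (metis coprime_commute)
  define R where "R = {s. s < L \<and> int s \<in> free_set A}"
  have FrA: "u \<in> Free A 0 \<longleftrightarrow> rint L u mod L \<in> R" for u
  proof -
    have "int a dvd int (rint L u) \<longleftrightarrow> int a dvd int (rint L u mod L)" if "a \<in> A" for a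
      using L that by (metis dvd_mod_iff int_dvd_int_iff)
    then show ?thesis
      unfolding Free_eq_periodic[OF assms(2) L(2,1)] R_def mem_free_set using L(1) by auto
  qed
  have *: "Free (A \<union> A') 0 = (\<Union>s\<in>R. Dvd L (- int s) \<inter> Free A' 0)"
    unfolding Free_Un using L(1) by (auto simp: FrA Dvd_partition) (auto simp: R_def)
  have "Pr (Free (A \<union> A') 0) = (\<Sum>s\<in>R. Pr (Dvd L (- int s) \<inter> Free A' 0))"
    unfolding * by (rule unif.finite_measure_finite_Union) (auto simp: R_def disjoint_family_on_def Dvd_partition L)
  also have "\<dots> = card R * (Pr (Free A' 0) / L)"
    using prob_Dvd_Int_Free[OF L(1) assms(3) cop] by simp
  finally show ?thesis
    unfolding prob_Free[OF assms(2) L(2,1)] by (simp add: R_def free_count_def)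
qed

text \<open>Given that \<open>g\<close> divides \<open>\<xi>\<close>, the quotient of
  \<open>\<xi>\<close> by \<open>g\<close> is again Haar distributed, and the event says that this
  quotient is \<open>A\<close>-free.\<close>

lemma prob_Free_scale:
  assumes "g > 0" "0 \<notin> A"
  shows "Pr (Dvd g 0 \<inter> Free ((*) g ` A) 0) = Pr (Free A 0) / g"
proof -
  have fin: "Pr (Dvd g 0 \<inter> Free ((*) g ` A') 0) = Pr (Free A' 0) / g" if "finite A'" "A' \<subseteq> A" for A'
  proof -
    define L where "L = \<Prod>A'"
    have A': "0 \<notin> A'" "0 \<notin> (*) g ` A'" using that assms by auto
    have L: "L > 0" "\<forall>a\<in>A'. a dvd L" using finite_common_multiple[OF that(1) A'(1)] by (auto simp: L_def)
    have gL: "g * L > 0" "\<forall>a\<in>(*) g ` A'. a dvd g * L" using L assms(1) by auto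
    define Q where "Q n \<longleftrightarrow> int g dvd n + 0 \<and> (\<forall>a\<in>(*) g ` A'. \<not> int a dvd n + 0)" for n
    have per: "periodic (g * L) Q"
      unfolding Q_def using gL(2) by (intro periodic_conj periodic_Ball periodic_not periodic_dvd) auto
    have "Dvd g 0 \<inter> Free ((*) g ` A') 0 = {u. Q (int (rint (g * L) u))}"
      unfolding Free_eq_periodic[OF A'(2) gL(2,1)] Q_def using Dvd_iff[of g "g * L"] assms(1) gL by auto
    then have "Pr (Dvd g 0 \<inter> Free ((*) g ` A') 0) = card {n. n < g * L \<and> Q (int n)} / (g * L)"
      using prob_periodic[OF gL(1) per] by simp
    also have "{n. n < g * L \<and> Q (int n)} = (*) g ` {n. n < L \<and> int n \<in> free_set A'}"
      using assms(1) by (auto simp: Q_def mem_free_set image_iff)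
    also have "card \<dots> = free_count A' L"
      unfolding free_count_def using assms(1) by (intro card_image) (auto simp: inj_on_def)
    finally show ?thesis unfolding prob_Free[OF A'(1) L(2,1)] by (simp add: field_simps)
  qed
  have *: "((*) g ` A) \<inter> {..g * K} = (*) g ` (A \<inter> {..K})" for K using assms(1) by auto
  \<comment> \<open>Cutting the multiples of \<open>g\<close> at \<open>g * K\<close> amounts to
    cutting \<open>A\<close> at \<open>K\<close>, so the limit is taken along this
    subsequence.\<close>
  have sub: "strict_mono (\<lambda>K. g * K)" using assms(1) by (auto simp: strict_mono_def)
  have "(\<lambda>K. Pr (Dvd g 0 \<inter> Free ((*) g ` (A \<inter> {..K})) 0)) \<longlonglongrightarrow> Pr (Dvd g 0 \<inter> Free ((*) g ` A) 0)"
    using LIMSEQ_subseq_LIMSEQ[OF Free_tendsto[of "Dvd g 0" "(*) g ` A" 0] sub] by (simp add: o_def *)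
  moreover have "(\<lambda>K. Pr (Dvd g 0 \<inter> Free ((*) g ` (A \<inter> {..K})) 0)) \<longlonglongrightarrow> Pr (Free A 0) / g"
    using tendsto_divide[OF Free_tendsto'[of A 0] tendsto_const[of "real g"]] assms(1) fin by simp
  ultimately show ?thesis by (rule LIMSEQ_unique)
qed

text \<open>Elements up to \<open>K0\<close> divide \<open>fact K\<close>, hence are independent of
  those coprime to it. As the finite part alone already has nearly the probability of
  \<open>Free A 0\<close>, the remaining factor must be close to 1.\<close>

lemma prob_Free_tail:
  assumes "0 \<notin> A" "Pr (Free A 0) > 0" "\<epsilon> > 0"
  shows "\<exists>K0. \<forall>K\<ge>K0. Pr (- Free {a\<in>A. coprime a (fact K)} 0) < \<epsilon>"
proof -
  let ?c = "Pr (Free A 0)"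
  have "(\<lambda>K. Pr (Free (A \<inter> {..K}) 0) * (1 - \<epsilon>)) \<longlonglongrightarrow> ?c * (1 - \<epsilon>)"
    by (intro tendsto_intros Free_tendsto')
  moreover have "?c * (1 - \<epsilon>) < ?c" using assms by simp
  ultimately have "\<forall>\<^sub>F K in sequentially. Pr (Free (A \<inter> {..K}) 0) * (1 - \<epsilon>) < ?c"
    by (rule order_tendstoD(2))
  then obtain K0 where K0: "Pr (Free (A \<inter> {..K0}) 0) * (1 - \<epsilon>) < ?c"
    by (auto simp: eventually_sequentially)
  show ?thesis
  proof (intro exI[of _ K0] allI impI)
    fix K assume "K \<ge> K0"
    define A1 where "A1 = A \<inter> {..K0}"
    define A2 where "A2 = {a\<in>A. coprime a (fact K)}"
    have "coprime a a'" if "a \<in> A1" "a' \<in> A2" for a a'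
    proof -
      have "a dvd fact K"
      proof (rule dvd_fact)
        show "1 \<le> a" using that assms(1) by (cases a) (auto simp: A1_def)
        show "a \<le> K" using that \<open>K \<ge> K0\<close> by (auto simp: A1_def)
      qed
      then show ?thesis using that(2) coprime_divisors[of a' a' a "fact K"] by (auto simp: A2_def coprime_commute)
    qed
    then have "Pr (Free (A1 \<union> A2) 0) = Pr (Free A1 0) * Pr (Free A2 0)"
      using assms(1) by (intro prob_Free_indep) (auto simp: A1_def A2_def)
    moreover have "?c \<le> Pr (Free (A1 \<union> A2) 0)"
      by (rule unif.finite_measure_mono) (auto simp: Free_def A1_def A2_def)
    ultimately have "Pr (Free A1 0) * (1 - \<epsilon>) < Pr (Free A1 0) * Pr (Free A2 0)"
      using K0 by (simp add: A1_def)
    then have "1 - \<epsilon> < Pr (Free A2 0)"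
      by (meson measure_nonneg mult_less_cancel_left_disj not_less)
    moreover have "Pr (- Free A2 0) = 1 - Pr (Free A2 0)"
      using unif.prob_compl[of "Free A2 0"] by (simp add: Compl_eq_Diff_UNIV)
    ultimately show "Pr (- Free {a\<in>A. coprime a (fact K)} 0) < \<epsilon>"
      by (simp add: A2_def)
  qed
qed

section \<open>Logarithmic density\<close>

definition log_sum :: "int set \<Rightarrow> nat \<Rightarrow> real" where
  "log_sum S N = (\<Sum>n=1..N. indicator S (int n) / real n)"

lemma log_sum_Suc: "log_sum S (Suc N) = log_sum S N + indicator S (int (Suc N)) / real (Suc N)"
  by (simp add: log_sum_def)

lemma log_sum_0 [simp]: "log_sum S 0 = 0"
  by (simp add: log_sum_def)

lemma log_sum_mono:
  assumes "\<And>n. 1 \<le> n \<Longrightarrow> n \<le> N \<Longrightarrow> int n \<in> S \<Longrightarrow> int n \<in> T"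
  shows "log_sum S N \<le> log_sum T N"
  unfolding log_sum_def by (intro sum_mono divide_right_mono) (use assms in \<open>auto simp: indicator_def\<close>)

text \<open>Up to \<open>N\<close> only elements of \<open>A\<close> that are at most
  \<open>N\<close> matter. The factor \<open>fact N\<close> in \<open>X\<close> makes every
  \<open>n \<le> N\<close> a divisor, as \<open>free_count_harmonic\<close> requires, and the bound
  has no error term.\<close>

lemma log_sum_free_lower:
  assumes "0 \<notin> A"
  shows "Pr (Free A 0) * harm N \<le> log_sum (free_set A) N"
proof -
  define A0 where "A0 = A \<inter> {..N}"
  define X where "X = fact N * \<Prod>A0"
  have A0: "finite A0" "0 \<notin> A0" using assms by (auto simp: A0_def)
  note P = finite_common_multiple[OF A0]
  have X: "X > 0" "\<forall>n\<in>{1..N}. n dvd X" "\<forall>a\<in>A0. a dvd X"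
    using P by (auto simp: X_def dvd_fact)
  have X2: "X\<^sup>2 > 0" "\<forall>a\<in>A0. a dvd X\<^sup>2" using X by (auto simp: power2_eq_square)
  have "Pr (Free A 0) \<le> Pr (Free A0 0)"
    by (rule unif.finite_measure_mono) (auto simp: Free_def A0_def)
  then have "Pr (Free A 0) * harm N \<le> Pr (Free A0 0) * harm N"
    by (intro mult_right_mono harm_nonneg)
  also have "\<dots> \<le> log_sum (free_set A0) N"
    using free_count_harmonic[OF X] X2(1) unfolding prob_Free[OF A0(2) X2(2,1)] log_sum_def harm_def
    by (simp add: field_simps inverse_eq_divide)
  also have "\<dots> \<le> log_sum (free_set A) N"
  proof (rule log_sum_mono)
    fix n assume n: "1 \<le> n" "n \<le> N" "int n \<in> free_set A0"
    have "\<not> a dvd n" if "a \<in> A" for a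
      using n that dvd_imp_le[of a n] by (cases "a \<le> N") (auto simp: mem_free_set A0_def)
    then show "int n \<in> free_set A" by (simp add: mem_free_set)
  qed
  finally show ?thesis .
qed

lemma card_periodic_bound:
  fixes m :: nat
  assumes "L > 0" "periodic L Q"
  defines "k \<equiv> card {n. n < L \<and> Q (int n)}"
  shows "\<bar>real (card {n. n < m \<and> Q (int n)}) - k / L * m\<bar> \<le> L"
proof -
  define q :: nat where "q = m div L"
  have q: "L * q \<le> m" "m \<le> L * Suc q"
    using assms(1) by (auto simp: q_def) (metis add.commute dividend_less_times_div less_imp_le mult_Suc_right mult.commute)
  have "card {n. n < L * q \<and> Q (int n)} \<le> card {n. n < m \<and> Q (int n)}"
    by (rule card_mono) (use q in auto)
  moreover have "card {n. n < m \<and> Q (int n)} \<le> card {n. n < L * Suc q \<and> Q (int n)}"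
    by (rule card_mono) (use q in auto)
  ultimately have b: "q * k \<le> card {n. n < m \<and> Q (int n)}" "card {n. n < m \<and> Q (int n)} \<le> Suc q * k"
    unfolding card_periodic[OF assms(2)] k_def by auto
  have kL: "k \<le> L" unfolding k_def using card_mono[of "{..<L}" "{n. n < L \<and> Q (int n)}"] by auto
  have r: "real q \<le> m / L" "m / L \<le> real q + 1"
    using q assms(1) by (simp_all add: field_simps flip: of_nat_mult of_nat_add)
  have "q * real k \<le> k / L * m" "k / L * m \<le> (q + 1) * real k"
    using mult_left_mono[OF r(1), of k] mult_left_mono[OF r(2), of k] by (simp_all add: field_simps)
  moreover have "q * real k \<le> card {n. n < m \<and> Q (int n)}" "card {n. n < m \<and> Q (int n)} \<le> (q + 1) * real k"
    using b[THEN of_nat_mono[where 'a = real]] by (simp_all add: algebra_simps)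
  moreover have "(q + 1) * real k = q * real k + k" by (simp add: algebra_simps)
  ultimately show ?thesis using kL by linarith
qed

text \<open>Summation by parts. The centred partial sums \<open>F\<close> are bounded by
  \<open>L + 1\<close>: an error \<open>L\<close> from counting whole periods and 1 from the
  position 0.\<close>

lemma log_sum_periodic:
  assumes "L > 0" "periodic L Q"
  defines "k \<equiv> card {n. n < L \<and> Q (int n)}"
  shows "\<bar>log_sum {n. Q n} N - k / L * harm N\<bar> \<le> real L + 2"
proof -
  define f where "f n = indicator {n. Q n} (int n) - k / L" for n :: nat
  define F where "F m = (\<Sum>n=1..m. f n)" for m
  define C where "C = real L + 1"
  have F: "\<bar>F m\<bar> \<le> C" for m
  proof -
    have "(\<Sum>n=1..m. indicator {n. Q n} (int n)) = real (card ({1..m} \<inter> {n. Q (int n)}))"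
      by (simp add: indicator_def sum.If_cases)
    then have Fm: "F m = real (card ({1..m} \<inter> {n. Q (int n)})) - k / L * m"
      by (simp add: F_def f_def sum_subtractf)
    have "card {n. n < Suc m \<and> Q (int n)} = card ({1..m} \<inter> {n. Q (int n)}) + (if Q 0 then 1 else 0)"
    proof -
      have "{n. n < Suc m \<and> Q (int n)} = ({1..m} \<inter> {n. Q (int n)}) \<union> (if Q 0 then {0} else {})"
        (is "?l = ?r")
      proof -
        have "x \<in> ?l \<longleftrightarrow> x \<in> ?r" for x by (cases "x = 0") auto
        then show ?thesis by blast
      qed
      then show ?thesis by (simp add: card_Un_disjoint)
    qed
    then have "real (card {n. n < Suc m \<and> Q (int n)}) = real (card ({1..m} \<inter> {n. Q (int n)})) + (if Q 0 then 1 else 0)"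
      by simp
    moreover have "\<bar>real (card {n. n < Suc m \<and> Q (int n)}) - k / L * Suc m\<bar> \<le> L"
      unfolding k_def by (rule card_periodic_bound[OF assms(1,2)])
    moreover have "k / L \<le> 1" "0 \<le> k / L"
      unfolding k_def using card_mono[of "{..<L}" "{n. n < L \<and> Q (int n)}"] assms(1) by auto
    moreover have "k / L * Suc m = k / L * m + k / L" by (simp add: algebra_simps add_divide_distrib)
    moreover have "0 \<le> (if Q 0 then 1 else 0 :: real)" "(if Q 0 then 1 else 0 :: real) \<le> 1" by auto
    ultimately show ?thesis unfolding Fm C_def by linarith
  qed
  \<comment> \<open>The boundary term is kept on the left so that the increments telescope with
    \<open>1 / x - 1 / (x + 1)\<close>.\<close>
  have "\<bar>(\<Sum>n=1..N. f n / n) - F N / (real N + 1)\<bar> \<le> C * (1 - 1 / (real N + 1))"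
  proof (induction N)
    case (Suc N)
    define x where "x = real N + 1"
    have x: "x > 0" by (simp add: x_def)
    have FS: "F (Suc N) = F N + f (Suc N)" by (simp add: F_def)
    have "(\<Sum>n=1..Suc N. f n / n) - F (Suc N) / (real (Suc N) + 1)
        = ((\<Sum>n=1..N. f n / n) - F N / x) + F (Suc N) * (1 / x - 1 / (x + 1))"
    proof -
      have "(\<Sum>n=1..Suc N. f n / n) = (\<Sum>n=1..N. f n / n) + f (Suc N) / x" "real (Suc N) + 1 = x + 1"
        by (simp_all add: x_def add.commute)
      then show ?thesis unfolding FS by (simp add: algebra_simps add_divide_distrib)
    qed
    moreover have "\<bar>F (Suc N) * (1 / x - 1 / (x + 1))\<bar> \<le> C * (1 / x - 1 / (x + 1))"
      using F[of "Suc N"] x by (simp add: abs_mult mult_right_mono frac_le)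
    moreover have "\<bar>(\<Sum>n=1..N. f n / n) - F N / x\<bar> \<le> C * (1 - 1 / x)"
      using Suc by (simp add: x_def)
    moreover have "C * (1 - 1 / (real (Suc N) + 1)) = C * (1 - 1 / x) + C * (1 / x - 1 / (x + 1))"
      by (simp add: x_def algebra_simps)
    ultimately show ?case by linarith
  qed (simp add: F_def)
  moreover have "\<bar>F N / (real N + 1)\<bar> \<le> C * (1 / (real N + 1))"
    using F[of N] by (simp add: divide_right_mono)
  moreover have "C * (1 - 1 / (real N + 1)) + C * (1 / (real N + 1)) = C" by (simp add: algebra_simps)
  moreover have "(\<Sum>n=1..N. f n / n) = log_sum {n. Q n} N - k / L * harm N"
    by (simp add: f_def log_sum_def harm_def diff_divide_distrib sum_subtractf sum_distrib_left inverse_eq_divide)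
  ultimately show ?thesis unfolding C_def by linarith
qed

lemma log_sum_free_upper:
  assumes "finite A" "0 \<notin> A"
  shows "\<exists>C. \<forall>N. log_sum (free_set A) N \<le> Pr (Free A 0) * harm N + C"
proof -
  define L where "L = \<Prod>A"
  have L: "L > 0" "\<forall>a\<in>A. a dvd L" using finite_common_multiple[OF assms] by (auto simp: L_def)
  have per: "periodic L (\<lambda>n. \<forall>a\<in>A. \<not> int a dvd n + 0)"
    using L by (intro periodic_Ball periodic_not periodic_dvd) auto
  have eq: "{n. \<forall>a\<in>A. \<not> int a dvd n + 0} = free_set A" by (auto simp: mem_free_set)
  show ?thesis
    using log_sum_periodic[OF L(1) per] unfolding eq prob_Free[OF assms(2) L(2,1)] free_count_def mem_free_set
    by (intro exI[of _ "real L + 2"]) (auto simp: abs_le_iff algebra_simps)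
qed

lemma harm_ln_tendsto: "(\<lambda>N. harm N / ln (real N)) \<longlonglongrightarrow> (1::real)"
proof -
  have ln: "filterlim (\<lambda>N. ln (real N)) at_top sequentially"
    by (rule filterlim_compose[OF ln_at_top filterlim_real_sequentially])
  have "(\<lambda>N. (harm N - ln (real N)) / ln (real N) + 1) \<longlonglongrightarrow> (0 + 1 :: real)"
    by (intro tendsto_add tendsto_const real_tendsto_divide_at_top[OF euler_mascheroni_LIMSEQ ln])
  moreover have "\<forall>\<^sub>F N in sequentially. (harm N - ln (real N)) / ln (real N) + 1 = harm N / ln (real N)"
    using eventually_gt_at_top[of 1] by eventually_elim (simp add: field_simps)
  ultimately show ?thesis by (simp add: tendsto_cong)
qed

text \<open>A form of the Davenport-Erdos theorem. The lower bound holds for \<open>A\<close>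
  itself; from above, finite truncations are periodic and their probabilities decrease to that of
  \<open>A\<close>.\<close>

lemma log_sum_free_tendsto:
  assumes "0 \<notin> A"
  shows "(\<lambda>N. log_sum (free_set A) N / ln (real N)) \<longlonglongrightarrow> Pr (Free A 0)"
proof (rule order_tendstoI)
  fix y assume y: "y < Pr (Free A 0)"
  have "(\<lambda>N. Pr (Free A 0) * (harm N / ln (real N))) \<longlonglongrightarrow> Pr (Free A 0) * 1"
    by (intro tendsto_intros harm_ln_tendsto)
  then have "\<forall>\<^sub>F N in sequentially. y < Pr (Free A 0) * (harm N / ln (real N))"
    using y by (simp add: order_tendsto_iff)
  moreover have "\<forall>\<^sub>F N :: nat in sequentially. 1 < N" by (rule eventually_gt_at_top)
  ultimately show "\<forall>\<^sub>F N in sequentially. y < log_sum (free_set A) N / ln (real N)"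
  proof eventually_elim
    case (elim N)
    have "Pr (Free A 0) * harm N / ln N \<le> log_sum (free_set A) N / ln N"
      using log_sum_free_lower[OF assms] elim(2) by (intro divide_right_mono) auto
    then show ?case using elim(1) by simp
  qed
next
  fix y assume y: "Pr (Free A 0) < y"
  have "\<forall>\<^sub>F K in sequentially. Pr (Free (A \<inter> {..K}) 0) < y"
    by (rule order_tendstoD(2)[OF Free_tendsto' y])
  then obtain K where K: "Pr (Free (A \<inter> {..K}) 0) < y" by (auto simp: eventually_sequentially)
  let ?P = "Pr (Free (A \<inter> {..K}) 0)"
  obtain C where C: "\<And>N. log_sum (free_set (A \<inter> {..K})) N \<le> ?P * harm N + C"
    using log_sum_free_upper[of "A \<inter> {..K}"] assms by auto
  have ln: "filterlim (\<lambda>N. ln (real N)) at_top sequentially"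
    by (rule filterlim_compose[OF ln_at_top filterlim_real_sequentially])
  have "(\<lambda>N. ?P * (harm N / ln (real N)) + C / ln (real N)) \<longlonglongrightarrow> ?P * 1 + 0"
    by (intro tendsto_intros harm_ln_tendsto real_tendsto_divide_at_top[OF tendsto_const ln])
  then have "\<forall>\<^sub>F N in sequentially. ?P * (harm N / ln (real N)) + C / ln (real N) < y"
    using K by (simp add: order_tendsto_iff)
  moreover have "\<forall>\<^sub>F N :: nat in sequentially. 1 < N" by (rule eventually_gt_at_top)
  ultimately show "\<forall>\<^sub>F N in sequentially. log_sum (free_set A) N / ln (real N) < y"
  proof eventually_elim
    case (elim N)
    have "log_sum (free_set A) N \<le> log_sum (free_set (A \<inter> {..K})) N"
      by (rule log_sum_mono) (auto simp: mem_free_set)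
    then have "log_sum (free_set A) N / ln N \<le> (?P * harm N + C) / ln N"
      using C[of N] elim(2) by (intro divide_right_mono) auto
    then show ?case using elim(1) by (simp add: add_divide_distrib)
  qed
qed

lemma log_density_free:
  assumes "0 \<notin> A"
  shows "log_density (free_set A) = Pr (Free A 0)"
proof -
  have "(\<Sum>n | n \<in> {1..N} \<and> int n \<in> S. 1 / real n) = log_sum S N" for N S
    unfolding log_sum_def by (rule sum.mono_neutral_cong_left) (auto simp: indicator_def)
  then show ?thesis
    unfolding log_density_def using log_sum_free_tendsto[OF assms] by (simp add: limI)
qed

section \<open>From positive probability to actual integers\<close>

lemma log_sum_shift_up: "log_sum {n. n + 1 \<in> T} N \<le> log_sum T N + 2"
proof -
  \<comment> \<open>Replacing the weight \<open>1 / (n + 1)\<close> by \<open>1 / n\<close> costs a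
    telescoping amount, recorded as \<open>1 - 1 / (N + 1)\<close>.\<close>
  have "log_sum {n. n + 1 \<in> T} N \<le> log_sum T (Suc N) + 1 - 1 / (real N + 1)"
  proof (induction N)
    case (Suc N)
    have "indicator T (int (Suc (Suc N))) * (1 / (real N + 1) - 1 / (real N + 2)) \<le> 1 * (1 / (real N + 1) - 1 / (real N + 2))"
      by (intro mult_right_mono) (auto simp: indicator_def frac_le)
    moreover have "indicator {n. n + 1 \<in> T} (int (Suc N)) = (indicator T (int (Suc (Suc N))) :: real)"
      by (simp add: indicator_def add.commute)
    ultimately show ?case using Suc unfolding log_sum_Suc[of _ "Suc N"] log_sum_Suc[of "{n. n + 1 \<in> T}"]
      by (simp add: algebra_simps)
  qed (simp add: log_sum_Suc indicator_def)
  moreover have "log_sum T (Suc N) \<le> log_sum T N + 1"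
    by (simp add: log_sum_Suc indicator_def)
  ultimately show ?thesis by (smt (verit) divide_nonneg_nonneg of_nat_0_le_iff)
qed

lemma log_sum_shift_down: "log_sum {n. n - 1 \<in> T} N \<le> log_sum T N + 2"
proof -
  have "log_sum {n. n - 1 \<in> T} (Suc N) \<le> log_sum T N + 1"
  proof (induction N)
    case (Suc N)
    have "indicator T (int (Suc N)) / real (Suc (Suc N)) \<le> (indicator T (int (Suc N)) :: real) / real (Suc N)"
      by (intro divide_left_mono) auto
    moreover have "indicator {n. n - 1 \<in> T} (int (Suc (Suc N))) = (indicator T (int (Suc N)) :: real)"
      by (simp add: indicator_def add.commute)
    ultimately show ?case using Suc unfolding log_sum_Suc[of _ "Suc N"] log_sum_Suc[of T]
      by simp
  qed (simp add: log_sum_Suc indicator_def)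
  moreover have "log_sum {n. n - 1 \<in> T} N \<le> log_sum {n. n - 1 \<in> T} (Suc N)"
    by (simp add: log_sum_Suc indicator_def)
  ultimately show ?thesis by linarith
qed

lemma log_sum_shift: "\<exists>C. \<forall>N. log_sum {n. n + j \<in> T} N \<le> log_sum T N + C"
proof (induction j rule: int_induct[of _ 0])
  case base
  then show ?case by (intro exI[of _ 0]) simp
next
  case (step1 j)
  then obtain C where C: "\<And>N. log_sum {n. n + j \<in> T} N \<le> log_sum T N + C" by blast
  have "log_sum {n. n + (j + 1) \<in> T} N \<le> log_sum T N + (C + 2)" for N
    using log_sum_shift_up[of "{n. n + j \<in> T}" N] C[of N] by (simp add: algebra_simps)
  then show ?case by blast
next
  case (step2 j)
  then obtain C where C: "\<And>N. log_sum {n. n + j \<in> T} N \<le> log_sum T N + C" by blast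
  have "log_sum {n. n + (j - 1) \<in> T} N \<le> log_sum T N + (C + 2)" for N
    using log_sum_shift_down[of "{n. n + j \<in> T}" N] C[of N] by (simp add: algebra_simps)
  then show ?case by blast
qed

lemma log_sum_UN:
  assumes "finite J"
  shows "log_sum (\<Union>j\<in>J. S j) N \<le> (\<Sum>j\<in>J. log_sum (S j) N)"
proof -
  have "log_sum (\<Union>j\<in>J. S j) N \<le> (\<Sum>n=1..N. \<Sum>j\<in>J. indicator (S j) (int n) / real n)"
    unfolding log_sum_def
  proof (intro sum_mono)
    fix n
    have "(indicator (\<Union>j\<in>J. S j) (int n) :: real) \<le> (\<Sum>j\<in>J. indicator (S j) (int n))"
    proof (cases "int n \<in> (\<Union>j\<in>J. S j)")
      case True
      then obtain j where "j \<in> J" "int n \<in> S j" by blast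
      then show ?thesis using member_le_sum[of j J "\<lambda>j. indicator (S j) (int n) :: real"] assms True by simp
    qed (simp add: sum_nonneg)
    then show "(indicator (\<Union>j\<in>J. S j) (int n) :: real) / real n \<le> (\<Sum>j\<in>J. indicator (S j) (int n) / real n)"
      by (simp add: divide_right_mono flip: sum_divide_distrib)
  qed
  then show ?thesis unfolding log_sum_def by (simp add: sum.swap[of _ J])
qed

lemma log_sum_atMost: "log_sum {..t} N \<le> real (nat t)"
proof -
  have "log_sum {..t} N \<le> (\<Sum>n=1..N. indicator {..nat t} n)"
    unfolding log_sum_def by (intro sum_mono) (auto simp: indicator_def nat_le_iff)
  also have "\<dots> = real (card ({1..N} \<inter> {n. n \<le> nat t}))"
    by (simp add: indicator_def sum.If_cases)
  also have "\<dots> \<le> real (card {1..nat t})"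
    by (intro of_nat_mono card_mono) auto
  finally show ?thesis by simp
qed

lemma harm_unbounded: "\<exists>N. x < (harm N :: real)"
proof -
  define N where "N = nat \<lceil>exp x\<rceil>"
  have "exp x \<le> real N" by (simp add: N_def le_nat_iff real_nat_ceiling_ge)
  then have "exp x < real N + 1" by linarith
  then have "x < ln (real N + 1)" by (metis exp_gt_zero ln_exp ln_less_cancel_iff order_less_trans)
  also have "\<dots> \<le> harm N" by (rule ln_le_harm)
  finally show ?thesis by blast
qed

text \<open>Truncating \<open>B\<close> at \<open>M\<close> makes the condition periodic, with
  logarithmic density at least \<open>c\<close>. A solution beyond \<open>t\<close> that fails for
  \<open>B\<close> itself has some \<open>n + j\<close> in \<open>T\<close>, the numbers free for
  the truncation but not for \<open>B\<close>. The error-free bound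
  \<open>log_sum_free_lower\<close> makes \<open>T\<close> so thin that its translates cannot cover
  the solutions.\<close>

lemma positive_prob_imp_infinite:
  assumes B: "0 \<notin> B" and L: "L > 0" and J: "finite J"
    and pos: "Pr (Dvd L (- r) \<inter> all_free B J) > 0"
  shows "\<exists>n>t. int L dvd n - r \<and> (\<forall>j\<in>J. n + j \<in> free_set B)"
proof (rule ccontr)
  assume contra: "\<not> ?thesis"
  define c where "c = Pr (Dvd L (- r) \<inter> all_free B J)"
  define P where "P M = Pr (Free (B \<inter> {..M}) 0)" for M
  \<comment> \<open>\<open>M\<close> is chosen so that the truncation error over all
    \<open>card J\<close> positions stays below \<open>c / 2\<close>.\<close>
  have "(\<lambda>M. card J * (P M - Pr (Free B 0))) \<longlonglongrightarrow> card J * (Pr (Free B 0) - Pr (Free B 0))"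
    unfolding P_def by (intro tendsto_intros Free_tendsto')
  then have "\<forall>\<^sub>F M in sequentially. card J * (P M - Pr (Free B 0)) < c / 2"
    using pos by (intro order_tendstoD(2)) (auto simp: c_def)
  then obtain M where M: "card J * (P M - Pr (Free B 0)) < c / 2"
    by (auto simp: eventually_sequentially)
  define BM where "BM = B \<inter> {..M}"
  have BM: "finite BM" "0 \<notin> BM" using B by (auto simp: BM_def)
  define \<Lambda> where "\<Lambda> = L * \<Prod>BM"
  have \<Lambda>: "\<Lambda> > 0" "L dvd \<Lambda>" "\<forall>b\<in>BM. b dvd \<Lambda>"
    using finite_common_multiple[OF BM] L by (auto simp: \<Lambda>_def)
  define Q where "Q n \<longleftrightarrow> int L dvd n + (- r) \<and> (\<forall>j\<in>J. \<forall>b\<in>BM. \<not> int b dvd n + j)" for n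
  have per: "periodic \<Lambda> Q"
    unfolding Q_def by (intro periodic_conj periodic_Ball periodic_not periodic_dvd) (use \<Lambda> in auto)
  have "Dvd L (- r) \<inter> all_free B J \<subseteq> {u. Q (int (rint \<Lambda> u))}"
  proof
    fix u assume u: "u \<in> Dvd L (- r) \<inter> all_free B J"
    have "u \<in> Free BM j" if "j \<in> J" for j using u that by (auto simp: Free_def BM_def)
    then show "u \<in> {u. Q (int (rint \<Lambda> u))}"
      using u Dvd_iff[OF L \<Lambda>(2,1)] unfolding Q_def Free_eq_periodic[OF BM(2) \<Lambda>(3,1)] by auto
  qed
  then have cQ: "c \<le> card {n. n < \<Lambda> \<and> Q (int n)} / \<Lambda>"
    unfolding c_def prob_periodic[OF \<Lambda>(1) per, symmetric]
    by (intro unif.finite_measure_mono) (auto intro: rint_sets)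
  have lower: "c * harm N - (real \<Lambda> + 2) \<le> log_sum {n. Q n} N" for N
    using log_sum_periodic[OF \<Lambda>(1) per, of N] mult_right_mono[OF cQ harm_nonneg[of N]]
    by (simp add: abs_le_iff)
  define T where "T = free_set BM - free_set B"
  obtain C where C: "\<And>N. log_sum (free_set BM) N \<le> P M * harm N + C"
    using log_sum_free_upper[OF BM] unfolding BM_def P_def by blast
  have T: "log_sum T N \<le> (P M - Pr (Free B 0)) * harm N + C" for N
  proof -
    have "log_sum (free_set BM) N = log_sum T N + log_sum (free_set B) N"
      unfolding log_sum_def sum.distrib[symmetric] T_def
      by (intro sum.cong) (auto simp: indicator_def mem_free_set BM_def)
    then show ?thesis using C[of N] log_sum_free_lower[OF B, of N] by (simp add: algebra_simps)
  qed
  obtain D where D: "\<And>j N. log_sum {n. n + j \<in> T} N \<le> log_sum T N + D j"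
    using choice[of "\<lambda>j C. \<forall>N. log_sum {n. n + j \<in> T} N \<le> log_sum T N + C"] log_sum_shift by blast
  have upper0: "log_sum {n. Q n} N \<le> real (nat t) + (\<Sum>j\<in>J. (P M - Pr (Free B 0)) * harm N + C + D j)" for N
  proof -
    have "{n. Q n} \<subseteq> {..t} \<union> (\<Union>j\<in>J. {n. n + j \<in> T})"
    proof
      fix n assume "n \<in> {n. Q n}"
      then have n: "int L dvd n - r" "\<And>j. j \<in> J \<Longrightarrow> n + j \<in> free_set BM"
        by (auto simp: Q_def mem_free_set)
      show "n \<in> {..t} \<union> (\<Union>j\<in>J. {n. n + j \<in> T})"
      proof (cases "n \<le> t")
        case False
        then obtain j where "j \<in> J" "n + j \<notin> free_set B" using contra n(1) by auto
        then show ?thesis using n(2) by (auto simp: T_def)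
      qed simp
    qed
    then have "log_sum {n. Q n} N \<le> log_sum ({..t} \<union> (\<Union>j\<in>J. {n. n + j \<in> T})) N"
      by (intro log_sum_mono) auto
    also have "\<dots> \<le> log_sum {..t} N + log_sum (\<Union>j\<in>J. {n. n + j \<in> T}) N"
      unfolding log_sum_def sum.distrib[symmetric] by (intro sum_mono) (auto simp: indicator_def)
    also have "\<dots> \<le> real (nat t) + (\<Sum>j\<in>J. log_sum {n. n + j \<in> T} N)"
      by (intro add_mono log_sum_atMost log_sum_UN J)
    also have "(\<Sum>j\<in>J. log_sum {n. n + j \<in> T} N) \<le> (\<Sum>j\<in>J. (P M - Pr (Free B 0)) * harm N + C + D j)"
      by (intro sum_mono order_trans[OF D]) (use T in simp)
    finally show ?thesis by simp
  qed
  have upper: "log_sum {n. Q n} N \<le> card J * (P M - Pr (Free B 0)) * harm N + (real (nat t) + card J * C + sum D J)" for N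
  proof -
    have "(\<Sum>j\<in>J. (P M - Pr (Free B 0)) * harm N + C + D j)
        = card J * ((P M - Pr (Free B 0)) * harm N) + card J * C + sum D J"
      by (simp add: sum.distrib distrib_left)
    then show ?thesis using upper0[of N] by (simp add: mult.assoc)
  qed
  define E where "E = real \<Lambda> + 2 + (real (nat t) + card J * C + sum D J)"
  have "c / 2 * harm N \<le> E" for N
  proof -
    have "c * harm N \<le> card J * (P M - Pr (Free B 0)) * harm N + E"
      using lower[of N] upper[of N] by (simp add: E_def)
    also have "card J * (P M - Pr (Free B 0)) * harm N \<le> c / 2 * harm N"
      using M by (intro mult_right_mono harm_nonneg) simp
    finally show ?thesis by simp
  qed
  then have "harm N \<le> E / (c / 2)" for N
    using pos unfolding c_def[symmetric] by (simp add: field_simps)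
  moreover obtain N where "harm N > E / (c / 2)"
    using harm_unbounded by blast
  ultimately show False by (meson not_less)
qed

section \<open>Patterns of taut sets\<close>

lemma taut_prob: "taut B \<Longrightarrow> b \<in> B \<Longrightarrow> Pr (Free B 0) < Pr (Free (B - {b}) 0)"
  by (auto simp: taut_def log_density_free)

lemma taut_primitive:
  assumes "taut B" "a \<in> B" "b \<in> B" "a dvd b"
  shows "a = b"
proof (rule ccontr)
  assume "a \<noteq> b"
  then have "free_set (B - {b}) = free_set B"
    using assms(2,4) unfolding mem_free_set set_eq_iff by (metis DiffD1 DiffI dvd_trans int_dvd_int_iff singletonD)
  then show False using assms(1,3) by (auto simp: taut_def)
qed

text \<open>For positive \<open>c\<close> and positive elements of \<open>B\<close>, the product
  \<open>c * x\<close> is \<open>B\<close>-free exactly when \<open>x\<close> is free for these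
  quotients.\<close>

definition quot :: "nat set \<Rightarrow> nat \<Rightarrow> nat set" where
  "quot B c = (\<lambda>b. b div gcd b c) ` B"

lemma div_gcd_pos: "(b :: nat) > 0 \<Longrightarrow> b div gcd b c > 0"
  using dvd_div_eq_0_iff[of "gcd b c" b] by auto

lemma div_gcd_dvd: "(b :: nat) div gcd b c dvd b"
  by (metis dvd_div_mult_self dvd_triv_left gcd_dvd1)

lemma zero_notin_quot: "0 \<notin> B \<Longrightarrow> 0 \<notin> quot B c"
  using div_gcd_pos[of _ c] by (auto simp: quot_def) (metis gr0I less_not_refl)

lemma prob_Free_UN_harris:
  assumes "finite G" "\<And>g. g \<in> G \<Longrightarrow> 0 \<notin> A g"
  shows "(\<Prod>g\<in>G. Pr (Free (A g) 0)) \<le> Pr (Free (\<Union>g\<in>G. A g) 0)"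
  using assms
proof (induction rule: finite_induct)
  case (insert g G)
  have "Pr (Free (A g) 0) * (\<Prod>g\<in>G. Pr (Free (A g) 0))
      \<le> Pr (Free (A g) 0) * Pr (Free (\<Union>g\<in>G. A g) 0)"
    using insert by (intro mult_left_mono) auto
  also have "\<dots> \<le> Pr (Free (A g \<union> (\<Union>g\<in>G. A g)) 0)"
    by (rule prob_Free_harris) (use insert.prems in auto)
  finally show ?case using insert.hyps by simp
qed simp

text \<open>A taut set contains no \<open>g * A\<close> with \<open>A \<noteq> {1}\<close> of full logarithmic density of multiples; by
  the correlation inequality such an \<open>A\<close> would appear among the finitely many
  \<open>{b div g | b. b \<in> B \<and> gcd b c = g}\<close>.\<close>

lemma taut_quot_pos:
  assumes taut: "taut B" and c: "c > 0" "int c \<in> free_set B"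
  shows "Pr (Free (quot B c) 0) > 0"
proof (rule ccontr)
  have B: "0 \<notin> B" using taut by (simp add: taut_def)
  \<comment> \<open>The quotients are grouped by their gcd \<open>g\<close>, one of finitely many
    divisors of \<open>c\<close>; a vanishing product of probabilities singles out a null
    group.\<close>
  define A where "A g = (\<lambda>b. b div g) ` {b\<in>B. gcd b c = g}" for g
  define G where "G = {g. g dvd c}"
  have G: "finite G" using c by (simp add: G_def)
  have A0: "0 \<notin> A g" for g
    using B div_gcd_pos[of _ c] by (auto simp: A_def) (metis gr0I less_not_refl)
  have qA: "quot B c = (\<Union>g\<in>G. A g)"
    by (auto simp: quot_def A_def G_def)
  assume "\<not> Pr (Free (quot B c) 0) > 0"
  then have "(\<Prod>g\<in>G. Pr (Free (A g) 0)) \<le> 0"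
    using prob_Free_UN_harris[OF G, of A] A0 unfolding qA by (meson not_less order_trans)
  moreover have "(\<Prod>g\<in>G. Pr (Free (A g) 0)) \<ge> 0" by (intro prod_nonneg) auto
  ultimately have "(\<Prod>g\<in>G. Pr (Free (A g) 0)) = 0" by linarith
  then obtain g where g: "g \<in> G" "Pr (Free (A g) 0) = 0" using G by (auto simp: prod_zero_iff)
  then have "A g \<noteq> {}" by auto
  then obtain b0 where b0: "b0 \<in> B" "gcd b0 c = g" by (auto simp: A_def)
  define a0 where "a0 = b0 div g"
  have gpos: "g > 0" using g(1) c(1) by (auto simp: G_def dvd_pos_nat)
  have b0a: "b0 = g * a0" using b0(2) by (auto simp: a0_def)
  \<comment> \<open>\<open>a0 = 1\<close> would make \<open>b0 = g\<close> a divisor of the free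
    number \<open>c\<close>.\<close>
  have "a0 \<noteq> 1" using b0 b0a c(2) by (auto simp: mem_free_set) (metis gcd_dvd2)
  moreover have "a0 \<noteq> 0" using b0(1) b0a B by (metis mult_0_right)
  ultimately have "a0 > 1" by simp
  have "- Free {a0} 0 = Dvd a0 0" by (auto simp: Free_def)
  then have "Pr (Free {a0} 0) = 1 - 1 / a0"
    using prob_Dvd[of a0 0] unif.prob_compl[of "Free {a0} 0"] \<open>a0 > 1\<close>
    by (simp add: Compl_eq_Diff_UNIV[symmetric])
  \<comment> \<open>Since \<open>a0 > 1\<close>, avoiding \<open>a0\<close> alone has positive
    probability; by correlation the group stays null after \<open>a0\<close> is removed.\<close>
  moreover have "Pr (Free (A g - {a0}) 0) * Pr (Free {a0} 0) \<le> Pr (Free (A g - {a0} \<union> {a0}) 0)"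
    by (rule prob_Free_harris) (use A0 \<open>a0 > 1\<close> in auto)
  moreover have "A g - {a0} \<union> {a0} = A g" using b0 by (auto simp: A_def a0_def)
  ultimately have "Pr (Free (A g - {a0}) 0) * (1 - 1 / a0) \<le> 0" using g(2) by simp
  then have "Pr (Free (A g - {a0}) 0) \<le> 0" using \<open>a0 > 1\<close> by (simp add: mult_le_0_iff)
  then have "Pr (Free (A g - {a0}) 0) = 0" by (simp add: measure_le_0_iff)
  then have null: "Pr (Dvd g 0 \<inter> Free ((*) g ` (A g - {a0})) 0) = 0"
    using prob_Free_scale[OF gpos, of "A g - {a0}"] A0 by simp
  \<comment> \<open>A point freed by dropping \<open>b0\<close> is a multiple of \<open>b0\<close>,
    hence of \<open>g\<close>, and avoids the other \<open>g * a\<close>. Such points form a null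
    set, against tautness.\<close>
  have "Free (B - {b0}) 0 \<subseteq> Free B 0 \<union> (Dvd g 0 \<inter> Free ((*) g ` (A g - {a0})) 0)"
  proof
    fix u assume u: "u \<in> Free (B - {b0}) 0"
    show "u \<in> Free B 0 \<union> (Dvd g 0 \<inter> Free ((*) g ` (A g - {a0})) 0)"
    proof (cases "u \<in> Dvd b0 0")
      case True
      have "g dvd b0" using b0(2) by auto
      then have "u \<in> Dvd g 0"
        using True Dvd_iff[of g b0 u 0] Dvd_iff[of b0 b0 u 0] gpos B b0(1)
        by (metis dvd_refl dvd_trans gr0I int_dvd_int_iff)
      moreover have "u \<notin> Dvd (g * a) 0" if a: "a \<in> A g - {a0}" for a
      proof -
        obtain b where b: "b \<in> B" "gcd b c = g" "a = b div g" using a unfolding A_def by blast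
        then have "b = g * a" by auto
        moreover have "b \<noteq> b0" using b(3) a by (auto simp: a0_def)
        ultimately show ?thesis using u b(1) by (auto simp: Free_def)
      qed
      ultimately show ?thesis by (auto simp: Free_def)
    next
      case False
      then show ?thesis using u by (auto simp: Free_def)
    qed
  qed
  then have "Pr (Free (B - {b0}) 0) \<le> Pr (Free B 0 \<union> (Dvd g 0 \<inter> Free ((*) g ` (A g - {a0})) 0))"
    by (intro unif.finite_measure_mono) auto
  also have "\<dots> \<le> Pr (Free B 0) + Pr (Dvd g 0 \<inter> Free ((*) g ` (A g - {a0})) 0)"
    by (intro measure_Un_le) auto
  finally show False using taut_prob[OF taut b0(1)] null by simp
qed

lemma taut_tail:
  assumes "taut B" "finite I" "\<And>c. c \<in> I \<Longrightarrow> c > 0 \<and> int c \<in> free_set B" "\<epsilon> > 0"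
  shows "\<exists>K\<ge>K1. \<forall>c\<in>I. Pr (- Free {a\<in>quot B c. coprime a (fact K)} 0) < \<epsilon>"
proof -
  have "\<exists>K0. \<forall>K\<ge>K0. Pr (- Free {a\<in>quot B c. coprime a (fact K)} 0) < \<epsilon>" if "c \<in> I" for c
  proof (rule prob_Free_tail[OF _ _ assms(4)])
    show "0 \<notin> quot B c" using assms(1) by (intro zero_notin_quot) (simp add: taut_def)
    show "Pr (Free (quot B c) 0) > 0" using taut_quot_pos[OF assms(1)] assms(3)[OF that] by blast
  qed
  then obtain K0 where K0: "\<And>c K. c \<in> I \<Longrightarrow> K \<ge> K0 c \<Longrightarrow> Pr (- Free {a\<in>quot B c. coprime a (fact K)} 0) < \<epsilon>"
    by metis
  have "K0 c \<le> K1 + sum K0 I" if "c \<in> I" for c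
    using member_le_sum[of c I K0] assms(2) that by simp
  then show ?thesis using K0 by (intro exI[of _ "K1 + sum K0 I"]) auto
qed

text \<open>A union bound inside the class of \<open>r\<close> modulo \<open>L\<close>. By
  \<open>cop\<close>, failure at \<open>j\<close> means divisibility by a quotient coprime to
  \<open>L\<close>. That event is independent of the class and has probability less than
  \<open>1 / (card J + 1)\<close>, so the failures at all positions together do not exhaust the
  class.\<close>

lemma taut_pattern_prob:
  assumes B: "0 \<notin> B" and L: "L > 0" "fact K dvd L" and J: "finite J"
    and tail: "\<And>j. j \<in> J \<Longrightarrow> Pr (- Free {a\<in>quot B (c j). coprime a (fact K)} 0) < 1 / (card J + 1)"
    and cop: "\<And>j b n. j \<in> J \<Longrightarrow> b \<in> B \<Longrightarrow> int L dvd n - r \<Longrightarrow> int b dvd n + j \<Longrightarrow> coprime (b div gcd b (c j)) L"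
  shows "Pr (Dvd L (- r) \<inter> all_free B J) > 0"
proof -
  define T where "T j = {a\<in>quot B (c j). coprime a L}" for j
  define V where "V j = Dvd L (- r) - Free (T j) j" for j
  have V: "Pr (V j) \<le> 1 / (card J + 1) / L" if "j \<in> J" for j
  proof -
    have "0 \<notin> T j" "\<forall>a\<in>T j. coprime a L" using zero_notin_quot[OF B] by (auto simp: T_def)
    then have "Pr (Dvd L (- r) \<inter> Free (T j) j) = Pr (Free (T j) 0) / L"
      using prob_Dvd_Int_Free[OF L(1)] by blast
    then have "Pr (V j) = (1 - Pr (Free (T j) 0)) / L"
      unfolding V_def using prob_Dvd[OF L(1)] by (subst unif.finite_measure_Diff') (auto simp: diff_divide_distrib)
    also have "1 - Pr (Free (T j) 0) = Pr (- Free (T j) 0)"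
      using unif.prob_compl[of "Free (T j) 0"] by (simp add: Compl_eq_Diff_UNIV)
    also have "\<dots> \<le> Pr (- Free {a\<in>quot B (c j). coprime a (fact K)} 0)"
    proof (rule unif.finite_measure_mono)
      have "coprime a (fact K)" if "coprime a L" for a
        by (rule coprime_divisors[OF dvd_refl L(2) that])
      then show "- Free (T j) 0 \<subseteq> - Free {a \<in> quot B (c j). coprime a (fact K)} 0"
        by (auto simp: Free_def T_def)
    qed auto
    also have "\<dots> \<le> 1 / (card J + 1)" using tail[OF that] by simp
    finally show ?thesis by (simp add: divide_right_mono)
  qed
  have "Dvd L (- r) \<subseteq> (Dvd L (- r) \<inter> all_free B J) \<union> (\<Union>j\<in>J. V j)"
  proof
    fix u assume u: "u \<in> Dvd L (- r)"
    show "u \<in> (Dvd L (- r) \<inter> all_free B J) \<union> (\<Union>j\<in>J. V j)"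
    proof (cases "\<forall>j\<in>J. u \<in> Free B j")
      case False
      then obtain j b where jb: "j \<in> J" "b \<in> B" "u \<in> Dvd b j" by (auto simp: Free_def)
      have b: "b > 0" using B jb(2) by (metis gr0I)
      \<comment> \<open>The modulus \<open>L * b\<close> lets one integer represent
        \<open>\<xi>\<close> in both congruences.\<close>
      define n where "n = int (rint (L * b) u)"
      have n: "int L dvd n - r" "int b dvd n + j"
        using u jb(3) Dvd_iff[of L "L * b"] Dvd_iff[of b "L * b"] L(1) b by (auto simp: n_def)
      define a where "a = b div gcd b (c j)"
      have "a \<in> T j" using cop[OF jb(1,2) n] jb(2) by (auto simp: T_def quot_def a_def)
      moreover have "a dvd b"  unfolding a_def by (rule div_gcd_dvd)
      then have "int a dvd n + j" using n(2) by (metis dvd_trans int_dvd_int_iff)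
      then have "u \<in> Dvd a j"
        using Dvd_iff[of a "L * b" u j] L(1) b div_gcd_pos[OF b, of "c j"] \<open>a dvd b\<close>
        by (auto simp: n_def a_def[symmetric])
      ultimately show ?thesis using u jb(1) by (auto simp: V_def Free_def)
    qed (use u in blast)
  qed
  moreover have meas: "Dvd L (- r) \<inter> all_free B J \<in> sets borel"
  proof -
    have "Dvd L (- r) \<inter> all_free B J = Dvd L (- r) - (\<Union>j\<in>J. - Free B j)" by auto
    then show ?thesis using J by (auto intro!: sets.Diff sets.finite_UN)
  qed
  moreover have VU: "(\<Union>j\<in>J. V j) \<in> sets borel"
    using J by (intro sets.finite_UN) (auto simp: V_def)
  ultimately have "Pr (Dvd L (- r)) \<le> Pr (Dvd L (- r) \<inter> all_free B J \<union> (\<Union>j\<in>J. V j))"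
    by (intro unif.finite_measure_mono) auto
  also have "\<dots> \<le> Pr (Dvd L (- r) \<inter> all_free B J) + Pr (\<Union>j\<in>J. V j)"
    by (rule measure_Un_le) (use meas VU in simp_all)
  also have "Pr (\<Union>j\<in>J. V j) \<le> (\<Sum>j\<in>J. Pr (V j))"
    by (intro measure_UNION_le J) (auto simp: V_def)
  also have "\<dots> \<le> (\<Sum>j\<in>J. 1 / (card J + 1) / L)" by (intro sum_mono V)
  also have "\<dots> = card J / (card J + 1) / L" by simp
  also have "\<dots> < 1 / L" using L(1) by (intro divide_strict_right_mono) auto
  finally show ?thesis using prob_Dvd[OF L(1)] by simp
qed

section \<open>Residue classes that admit only coprime quotients\<close>

lemma coprime_div_gcd:
  assumes "b > 0" "int b dvd int c * v" "coprime v (int X)"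
  shows "coprime (b div gcd b c) X"
proof -
  define g where "g = gcd b c"
  define a where "a = b div g"
  have g: "g > 0" using assms(1) by (simp add: g_def)
  have b: "b = g * a" and c: "c = g * (c div g)" by (simp_all add: a_def g_def)
  have cop: "coprime a (c div g)" unfolding a_def g_def using assms(1) by (intro div_gcd_coprime) simp
  have "int g * int a dvd int g * (int (c div g) * v)"
    using assms(2) b c by (metis mult.assoc of_nat_mult)
  then have "int a dvd int (c div g) * v" using g by simp
  then have "int a dvd v" using cop by (simp add: coprime_dvd_mult_right_iff)
  then have "coprime (int a) (int X)" by (rule coprime_divisors[OF _ dvd_refl assms(3)])
  then show ?thesis by (simp add: a_def g_def)
qed

lemma coprime_add_mult_int:
  fixes v x t :: int
  assumes "coprime v x"
  shows "coprime (v + x * t) x"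
proof -
  have "gcd x (t * x + v) = gcd x v" by (rule gcd_add_mult)
  then have "coprime x (t * x + v)" using assms by (simp add: coprime_iff_gcd_eq_1 gcd.commute)
  then show ?thesis by (metis coprime_commute add.commute mult.commute)
qed

text \<open>Add to \<open>r\<close> the multiple of \<open>b\<close> by the product of those primes
  of \<open>X\<close> that do not divide \<open>r\<close>: each prime of \<open>X\<close> then
  divides exactly one of the two summands.\<close>

lemma ex_cong_coprime:
  fixes r b :: int and X :: nat
  assumes "coprime r b" "X > 0"
  shows "\<exists>v. [v = r] (mod b) \<and> coprime v (int X)"
proof -
  define P where "P = {p \<in> prime_factors X. \<not> int p dvd r}"
  define t where "t = (\<Prod>p\<in>P. int p)"
  have fin: "finite P" by (simp add: P_def)
  have "coprime (r + b * t) (int X)"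
  proof (rule ccontr)
    assume "\<not> coprime (r + b * t) (int X)"
    then obtain p where p: "prime p" "p dvd r + b * t" "p dvd int X"
      using prime_divisor_exists[of "gcd (r + b * t) (int X)"] assms(2) by (auto simp: is_unit_gcd)
    define q where "q = nat p"
    have q: "p = int q" "prime q" using p(1) by (auto simp: q_def prime_ge_0_int)
    have qX: "q \<in> prime_factors X" using q p(3) assms(2) by (auto simp: in_prime_factors_iff)
    show False
    proof (cases "int q dvd r")
      case True
      then have "int q dvd b * t" using p(2) q(1) by (metis dvd_add_right_iff)
      moreover have "\<not> int q dvd b"
      proof
        assume "int q dvd b"
        then have "is_unit (int q)" using coprime_common_divisor[OF assms(1) True] by blast
        then show False using q(2) by auto
      qed
      ultimately have "int q dvd t" using q(2) prime_dvd_mult_iff by (metis prime_nat_int_transfer)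
      then obtain p' where p': "p' \<in> P" "int q dvd int p'"
        unfolding t_def using fin q(2) by (auto simp: prime_dvd_prod_iff)
      then have "q = p'" using q(2) by (auto simp: P_def in_prime_factors_iff primes_dvd_imp_eq)
      then show False using p'(1) True by (simp add: P_def)
    next
      case False
      then have "q \<in> P" using qX by (simp add: P_def)
      then have "int q dvd t" unfolding t_def using fin by (intro dvd_prodI) auto
      then show False using p(2) q(1) False by (metis dvd_add_left_iff dvd_mult)
    qed
  qed
  moreover have "[r + b * t = r] (mod b)" by (simp add: cong_def)
  ultimately show ?thesis by blast
qed

text \<open>The block recurs at multiples \<open>n\<close> of the square of \<open>X\<close>. There
  \<open>n + j = j * (1 + X * t)\<close>, because \<open>j\<close> divides one factor
  \<open>X\<close> and the other remains; so a \<open>b\<close> dividing \<open>n + j\<close> has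
  its quotient by \<open>gcd b \<bar>j\<bar>\<close> coprime to \<open>X\<close>. Divisors of the
  entries of \<open>Z\<close> are built into \<open>X\<close> and keep dividing. The coprime factor
  \<open>w\<close> is left to make a further position \<open>p\<close> divisible.\<close>

lemma taut_block:
  assumes taut: "taut B" and B: "B \<noteq> {}"
    and J: "finite J" "J \<subseteq> free_set B" and Z: "finite Z" "Z \<inter> free_set B = {}" and p: "p \<notin> J"
  shows "\<exists>X>0. \<forall>w>0. coprime w X \<longrightarrow> (\<exists>L r. L > 0 \<and> w dvd L \<and> int w dvd r + p \<and>
    (\<forall>q\<in>Z. \<exists>b\<in>B. b dvd L \<and> int b dvd r + q) \<and>
    Pr (Dvd L (- r) \<inter> all_free B J) > 0)"
proof -
  have B0: "0 \<notin> B" using taut by (simp add: taut_def)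
  have J0: "j \<noteq> 0" if "j \<in> J" for j using that J(2) B by (auto simp: mem_free_set)
  define \<epsilon> where "\<epsilon> = 1 / real (card J + 1)"
  \<comment> \<open>\<open>K\<close> is at least every distance from \<open>p\<close> to
    \<open>J\<close>: a prime common to \<open>w\<close> and the quotient at \<open>j\<close>
    divides \<open>p - j\<close>, hence would divide \<open>fact K\<close> and so
    \<open>X\<close>.\<close>
  have "\<exists>K\<ge>(\<Sum>j\<in>J. nat \<bar>p - j\<bar>). \<forall>c\<in>(\<lambda>j. nat \<bar>j\<bar>) ` J. Pr (- Free {a\<in>quot B c. coprime a (fact K)} 0) < \<epsilon>"
  proof (rule taut_tail[OF taut])
    fix c assume "c \<in> (\<lambda>j. nat \<bar>j\<bar>) ` J"
    then obtain j where j: "j \<in> J" "c = nat \<bar>j\<bar>" by blast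
    then show "c > 0 \<and> int c \<in> free_set B" using J0[OF j(1)] J(2) by (auto simp: mem_free_set)
  qed (use J in \<open>auto simp: \<epsilon>_def\<close>)
  then obtain K where K: "(\<Sum>j\<in>J. nat \<bar>p - j\<bar>) \<le> K"
    "\<And>j. j \<in> J \<Longrightarrow> Pr (- Free {a\<in>quot B (nat \<bar>j\<bar>). coprime a (fact K)} 0) < \<epsilon>" by auto
  have Kp: "nat \<bar>p - j\<bar> \<le> K" if "j \<in> J" for j
    using member_le_sum[of j J "\<lambda>j. nat \<bar>p - j\<bar>"] that J(1) K(1) by simp
  obtain wit where wit: "\<And>q. q \<in> Z \<Longrightarrow> wit q \<in> B \<and> int (wit q) dvd q"
  proof -
    have "\<exists>b. b \<in> B \<and> int b dvd q" if "q \<in> Z" for q using Z(2) that by (auto simp: mem_free_set)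
    then show ?thesis using that by metis
  qed
  \<comment> \<open>\<open>fact K\<close> serves the tail bound, the \<open>\<bar>j\<bar>\<close>
    the factorisation of \<open>n + j\<close>, and the witnesses the zeros.\<close>
  define X where "X = fact K * (\<Prod>j\<in>J. nat \<bar>j\<bar>) * (\<Prod>q\<in>Z. wit q)"
  have "X > 0" unfolding X_def using J0 wit B0
    by (intro mult_pos_pos prod_pos) (auto, metis gr0I)
  have KX: "fact K dvd X" by (simp add: X_def)
  have JX: "nat \<bar>j\<bar> dvd X" if "j \<in> J" for j
    using dvd_prodI[OF J(1) that, of "\<lambda>j. nat \<bar>j\<bar>"] by (simp add: X_def)
  have ZX: "wit q dvd X" if "q \<in> Z" for q
    using dvd_prodI[OF Z(1) that, of wit] by (simp add: X_def)
  show ?thesis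
  proof (rule exI[of _ X], rule conjI[OF \<open>X > 0\<close>], intro allI impI)
    fix w :: nat assume w: "w > 0" "coprime w X"
    define L where "L = X\<^sup>2 * w"
    have L: "L > 0" "fact K dvd L" using w(1) \<open>X > 0\<close> KX by (auto simp: L_def power2_eq_square)
    have XL: "X dvd L" "w dvd L" by (auto simp: L_def power2_eq_square)
    have "coprime (int (X\<^sup>2)) (int w)" using w(2) by (simp add: coprime_commute)
    then obtain r where r: "[r = 0] (mod int (X\<^sup>2))" "[r = - p] (mod int w)"
      using binary_chinese_remainder_int by blast
    have rX: "int X * int X dvd r" using r(1) by (simp add: cong_0_iff power2_eq_square)
    have rw: "int w dvd r + p" using r(2) by (simp add: cong_iff_dvd_diff)
    have "Pr (Dvd L (- r) \<inter> all_free B J) > 0"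
    proof (rule taut_pattern_prob[OF B0 L J(1), where c = "\<lambda>j. nat \<bar>j\<bar>"])
      fix j assume "j \<in> J"
      then show "Pr (- Free {a \<in> quot B (nat \<bar>j\<bar>). coprime a (fact K)} 0) < 1 / real (card J + 1)"
        using K(2) by (simp add: \<epsilon>_def)
    next
      fix j b n assume j: "j \<in> J" and b: "b \<in> B" and n: "int L dvd n - r" "int b dvd n + j"
      have bpos: "b > 0" using b B0 by (metis gr0I)
      define a where "a = b div gcd b (nat \<bar>j\<bar>)"
      have "int X * int X dvd n - r" using n(1) by (auto simp: L_def power2_eq_square elim!: dvd_mult_left)
      then have "int X * int X dvd n" using rX by (metis diff_add_cancel dvd_add)
      then obtain s where s: "n = int X * int X * s" by blast
      have "int (nat \<bar>j\<bar>) dvd int X" using JX[OF j] by (simp only: int_dvd_int_iff)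
      then obtain m where m: "int X = j * m" by (auto elim: dvdE)
      have js: "int (nat \<bar>j\<bar>) * sgn j = j" by (simp add: abs_mult_sgn)
      have "n + j = j * (1 + int X * (m * s))" by (simp add: s m algebra_simps)
      also have "\<dots> = int (nat \<bar>j\<bar>) * (sgn j * (1 + int X * (m * s)))"
        unfolding mult.assoc[symmetric] js ..
      finally have bd: "int b dvd int (nat \<bar>j\<bar>) * (sgn j * (1 + int X * (m * s)))" using n(2) by simp
      have "coprime (sgn j * (1 + int X * (m * s))) (int X)"
        using coprime_add_mult_int[of 1 "int X" "m * s"] J0[OF j] by (simp add: sgn_if)
      then have aX: "coprime a X" unfolding a_def by (rule coprime_div_gcd[OF bpos bd])
      have "a dvd b" unfolding a_def by (rule div_gcd_dvd)
      then have aj: "int a dvd n + j" using n(2) by (metis dvd_trans int_dvd_int_iff)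
      have wp: "int w dvd n + p"
      proof -
        have "int w dvd n - r" using n(1) XL(2) by (metis dvd_trans int_dvd_int_iff)
        then show ?thesis using rw dvd_add[of "int w" "n - r" "r + p"] by simp
      qed
      have "coprime a w"
      proof (rule ccontr)
        assume "\<not> coprime a w"
        then obtain l where l: "prime l" "l dvd a" "l dvd w" by (metis coprime_iff_gcd_eq_1 gcd_nat.boundedE prime_factor_nat)
        have "int l dvd (n + p) - (n + j)"
          using l(2,3) aj wp by (intro dvd_diff) (meson dvd_trans int_dvd_int_iff)+
        then have "l dvd nat \<bar>p - j\<bar>" by simp
        moreover have "nat \<bar>p - j\<bar> > 0" using p j by auto
        ultimately have "l \<le> K" using Kp[OF j] dvd_imp_le by (meson le_trans)
        then have "l dvd X" using KX l(1) by (meson dvd_trans prime_dvd_fact_iff)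
        then show False using l w(2) coprime_common_divisor[of w X l] by auto
      qed
      then show "coprime (b div gcd b (nat \<bar>j\<bar>)) L" using aX by (simp add: L_def a_def)
    qed
    moreover have "\<exists>b\<in>B. b dvd L \<and> int b dvd r + q" if "q \<in> Z" for q
    proof (intro bexI conjI)
      show "wit q \<in> B" "wit q dvd L" using wit that ZX XL by (auto intro: dvd_trans)
      have "int (wit q) dvd r" using ZX[OF that] rX by (meson dvd_mult_left dvd_trans int_dvd_int_iff)
      then show "int (wit q) dvd r + q" using wit[OF that] by simp
    qed
    ultimately show "\<exists>L r. L > 0 \<and> w dvd L \<and> int w dvd r + p \<and>
      (\<forall>q\<in>Z. \<exists>b\<in>B. b dvd L \<and> int b dvd r + q) \<and>
      Pr (Dvd L (- r) \<inter> all_free B J) > 0"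
      using L(1) XL(2) rw by blast
  qed
qed

text \<open>\<open>g = gcd r b\<close> is itself \<open>B\<close>-free: an element of
  \<open>B\<close> dividing \<open>g\<close> divides \<open>b\<close>, equals \<open>b\<close> by
  primitivity, and then divides \<open>r\<close>. The class of \<open>r\<close> is reached through
  \<open>g * v\<close> with \<open>v\<close> coprime to \<open>X\<close>, where only quotients
  coprime to \<open>X\<close> can obstruct.\<close>

lemma taut_residue_class:
  assumes taut: "taut B" and b: "b \<in> B" and r: "\<not> int b dvd r"
  shows "\<exists>n>t. [n = r] (mod int b) \<and> n \<in> free_set B"
proof -
  have B0: "0 \<notin> B" using taut by (simp add: taut_def)
  have bpos: "b > 0" using b B0 by (metis gr0I)
  define g where "g = nat (gcd r (int b))"
  have g: "int g = gcd r (int b)" "g > 0" using bpos by (auto simp: g_def)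
  have gb: "g dvd b" using g(1) by (metis gcd_dvd2 int_dvd_int_iff)
  have "int g \<in> free_set B"
    unfolding mem_free_set
  proof (intro ballI notI)
    fix b' assume b': "b' \<in> B" "int b' dvd int g"
    then have "b' = b" using taut_primitive[OF taut b'(1) b] gb by (meson dvd_trans int_dvd_int_iff)
    then show False using b'(2) r g(1) by (metis dvd_trans gcd_dvd1)
  qed
  \<comment> \<open>\<open>1 / 2\<close> is \<open>1 / (card J + 1)\<close> for the single position
    \<open>J = {0}\<close>.\<close>
  then have "\<exists>K\<ge>0. \<forall>c\<in>{g}. Pr (- Free {a\<in>quot B c. coprime a (fact K)} 0) < 1 / 2"
    using g(2) by (intro taut_tail[OF taut]) auto
  then obtain K where K: "Pr (- Free {a\<in>quot B g. coprime a (fact K)} 0) < 1 / 2" by auto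
  define X where "X = fact K * b"
  have X: "X > 0" using bpos by (simp add: X_def)
  have gX: "g dvd X" using gb by (simp add: X_def)
  obtain r' b' where rb: "r = int g * r'" "int b = int g * b'" "coprime r' b'"
    using gcd_coprime_exists[of r "int b"] g by (metis mult.commute of_nat_0_less_iff less_irrefl)
  obtain v where v: "[v = r'] (mod b')" "coprime v (int X)" using ex_cong_coprime[OF rb(3) X] by blast
  define L where "L = g * X"
  define \<rho> where "\<rho> = int g * v"
  have L: "L > 0" "fact K dvd L" using g(2) X by (auto simp: L_def X_def)
  have "Pr (Dvd L (- \<rho>) \<inter> all_free B {0}) > 0"
  proof (rule taut_pattern_prob[OF B0 L, where c = "\<lambda>_. g"])
    fix j b'' n assume j: "j \<in> {0::int}" and b'': "b'' \<in> B" and n: "int L dvd n - \<rho>" "int b'' dvd n + j"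
    obtain s where "n - \<rho> = int L * s" using n(1) by blast
    then have "n + j = int g * (v + int X * s)" using j by (simp add: \<rho>_def L_def algebra_simps)
    moreover have "coprime (v + int X * s) (int X)"
      by (rule coprime_add_mult_int[OF v(2)])
    ultimately have "coprime (b'' div gcd b'' g) X"
      using coprime_div_gcd[of b'' g "v + int X * s" X] n(2) b'' B0 by (metis gr0I)
    moreover from this have "coprime (b'' div gcd b'' g) g" by (rule coprime_divisors[OF dvd_refl gX])
    ultimately show "coprime (b'' div gcd b'' g) L" by (simp add: L_def)
  qed (use K in auto)
  from positive_prob_imp_infinite[OF B0 L(1) _ this, of t] obtain n where
    n: "n > t" "int L dvd n - \<rho>" "n \<in> free_set B" by auto
  have "int b dvd int L" by (simp add: L_def X_def)
  then have "[n = \<rho>] (mod int b)" using n(2) by (meson cong_iff_dvd_diff dvd_trans)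
  also have "[\<rho> = r] (mod int b)"
    unfolding \<rho>_def rb(1,2) using v(1) by (simp add: cong_cmult_leftI)
  finally show ?thesis using n by blast
qed

section \<open>Haar measure\<close>

definition residue_point :: "nat set \<Rightarrow> int \<Rightarrow> nat \<Rightarrow> int" where
  "residue_point B n = (\<lambda>b\<in>B. n mod int b)"

definition cylinder :: "nat set \<Rightarrow> nat set \<Rightarrow> int \<Rightarrow> (nat \<Rightarrow> int) set" where
  "cylinder B F n = {h\<in>H_set B. \<forall>b\<in>F. h b = n mod int b}"

definition cylinders :: "nat set \<Rightarrow> (nat \<Rightarrow> int) set set" where
  "cylinders B = (\<lambda>(F, n). cylinder B F n) ` ({F. finite F \<and> F \<subseteq> B} \<times> UNIV)"

abbreviation residue_space :: "nat set \<Rightarrow> (nat \<Rightarrow> int) set" where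
  "residue_space B \<equiv> topspace (residue_topology B)"

abbreviation agreeing :: "(nat \<Rightarrow> int) set \<Rightarrow> nat set \<Rightarrow> (nat \<Rightarrow> int) \<Rightarrow> (nat \<Rightarrow> int) set" where
  "agreeing S F h \<equiv> {h'\<in>S. \<forall>b\<in>F. h' b = h b}"

abbreviation H_topology :: "nat set \<Rightarrow> (nat \<Rightarrow> int) topology" where
  "H_topology B \<equiv> subtopology (residue_topology B) (H_set B)"

lemma carrier_mod: "b > 0 \<Longrightarrow> carrier (integer_mod_group b) = {0..<int b}"
  by (simp add: carrier_integer_mod_group)

lemma topspace_residue: "0 \<notin> B \<Longrightarrow> residue_space B = (\<Pi>\<^sub>E b\<in>B. {0..<int b})"
  unfolding residue_topology_def by (simp, rule PiE_cong) (metis carrier_mod gr0I)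

lemma residue_point_topspace:
  assumes "0 \<notin> B"
  shows "residue_point B n \<in> residue_space B"
proof -
  have "n mod int b \<in> {0..<int b}" if "b \<in> B" for b
    using assms that by (cases "b = 0") auto
  then show ?thesis unfolding topspace_residue[OF assms] residue_point_def by (simp add: restrict_PiE_iff)
qed

text \<open>The factors are discrete, so a basic neighbourhood may fix finitely many coordinates
  exactly.\<close>

lemma openin_residue_topology:
  assumes "0 \<notin> B"
  shows "openin (residue_topology B) S \<longleftrightarrow> S \<subseteq> residue_space B \<and>
    (\<forall>h\<in>S. \<exists>F. finite F \<and> F \<subseteq> B \<and> agreeing (residue_space B) F h \<subseteq> S)"
    (is "?l \<longleftrightarrow> ?r")
proof
  assume l: ?l
  show ?r
  proof (intro conjI ballI)
    show "S \<subseteq> residue_space B" by (rule openin_subset[OF l])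
    fix h assume "h \<in> S"
    then obtain U where U: "finite {b\<in>B. U b \<noteq> carrier (integer_mod_group b)}" "h \<in> Pi\<^sub>E B U" "Pi\<^sub>E B U \<subseteq> S"
      using l unfolding residue_topology_def openin_product_topology_alt topspace_discrete_topology by meson
    have "{h'\<in>residue_space B. \<forall>b\<in>{b\<in>B. U b \<noteq> carrier (integer_mod_group b)}. h' b = h b} \<subseteq> Pi\<^sub>E B U"
    proof
      fix h' assume "h' \<in> {h'\<in>residue_space B. \<forall>b\<in>{b\<in>B. U b \<noteq> carrier (integer_mod_group b)}. h' b = h b}"
      then have h': "h' \<in> (\<Pi>\<^sub>E b\<in>B. carrier (integer_mod_group b))" "\<And>b. b \<in> B \<Longrightarrow> U b \<noteq> carrier (integer_mod_group b) \<Longrightarrow> h' b = h b"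
        by (auto simp: residue_topology_def)
      have "h' b \<in> U b" if "b \<in> B" for b
        using PiE_mem[OF h'(1) that] PiE_mem[OF U(2) that] h'(2)[OF that] by metis
      then show "h' \<in> Pi\<^sub>E B U" using h'(1) by (simp add: PiE_iff)
    qed
    with U show "\<exists>F. finite F \<and> F \<subseteq> B \<and> agreeing (residue_space B) F h \<subseteq> S"
      by (intro exI[of _ "{b\<in>B. U b \<noteq> carrier (integer_mod_group b)}"]) blast
  qed
next
  assume r: ?r
  show ?l
    unfolding residue_topology_def openin_product_topology_alt
  proof (intro ballI)
    fix h assume h: "h \<in> S"
    then obtain F where F: "finite F" "F \<subseteq> B" "agreeing (residue_space B) F h \<subseteq> S"
      using r by blast
    define U where "U b = (if b \<in> F then {h b} else carrier (integer_mod_group b))" for b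
    have hB: "h \<in> (\<Pi>\<^sub>E b\<in>B. carrier (integer_mod_group b))"
      using r h by (auto simp: residue_topology_def)
    have sub: "U b \<subseteq> carrier (integer_mod_group b)" if "b \<in> B" for b
      using hB that by (auto simp: U_def)
    have "{b\<in>B. U b \<noteq> carrier (integer_mod_group b)} \<subseteq> F" by (auto simp: U_def)
    then have "finite {b\<in>B. U b \<noteq> carrier (integer_mod_group b)}" using F(1) finite_subset by blast
    moreover have "h \<in> Pi\<^sub>E B U" using hB by (auto simp: U_def PiE_iff)
    moreover have "Pi\<^sub>E B U \<subseteq> S"
    proof
      fix h' assume h': "h' \<in> Pi\<^sub>E B U"
      then have "h' \<in> residue_space B" using sub by (auto simp: residue_topology_def PiE_iff)
      moreover have "h' b = h b" if "b \<in> F" for b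
        using h' that F(2) PiE_mem[OF h', of b] by (auto simp: U_def)
      ultimately show "h' \<in> S" using F(3) by blast
    qed
    ultimately show "\<exists>U. finite {i \<in> B. U i \<noteq> topspace (discrete_topology (carrier (integer_mod_group i)))} \<and>
             (\<forall>i\<in>B. openin (discrete_topology (carrier (integer_mod_group i))) (U i)) \<and> h \<in> Pi\<^sub>E B U \<and> Pi\<^sub>E B U \<subseteq> S"
      using sub by (intro exI[of _ U]) auto
  qed
qed

lemma H_set_iff:
  assumes "0 \<notin> B"
  shows "h \<in> H_set B \<longleftrightarrow> h \<in> residue_space B \<and>
    (\<forall>F. finite F \<longrightarrow> F \<subseteq> B \<longrightarrow> (\<exists>n. \<forall>b\<in>F. h b = n mod int b))" (is "?l \<longleftrightarrow> ?r")
proof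
  assume l: ?l
  then have h: "h \<in> residue_space B"
    by (auto simp: H_set_def in_closure_of)
  moreover have "\<exists>n. \<forall>b\<in>F. h b = n mod int b" if "finite F" "F \<subseteq> B" for F
  proof -
    define S where "S = agreeing (residue_space B) F h"
    have "openin (residue_topology B) S"
      unfolding openin_residue_topology[OF assms] using that
      by (auto simp: S_def intro!: exI[of _ F])
    moreover have "h \<in> S" using h by (simp add: S_def)
    ultimately obtain n where "residue_point B n \<in> S"
      using l unfolding H_set_def in_closure_of residue_point_def by auto
    then have "\<forall>b\<in>F. h b = n mod int b" using that(2) by (simp add: S_def residue_point_def subset_iff)
    then show ?thesis by blast
  qed
  ultimately show ?r by blast
next
  assume r: ?r
  show ?l
    unfolding H_set_def in_closure_of residue_point_def[symmetric]
  proof (intro conjI allI impI)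
    show "h \<in> residue_space B" using r by blast
    fix T assume T: "h \<in> T \<and> openin (residue_topology B) T"
    then obtain F where F: "finite F" "F \<subseteq> B" "agreeing (residue_space B) F h \<subseteq> T"
      unfolding openin_residue_topology[OF assms] by blast
    obtain n where n: "\<forall>b\<in>F. h b = n mod int b" using r F by blast
    have "\<forall>b\<in>F. residue_point B n b = h b"
      using n F(2) by (simp add: residue_point_def subset_iff)
    then have "residue_point B n \<in> T"
      using F(3) residue_point_topspace[OF assms, of n] by blast
    then show "\<exists>y. y \<in> range (residue_point B) \<and> y \<in> T" by blast
  qed
qed

lemma openin_H:
  assumes "0 \<notin> B"
  shows "openin (H_topology B) U \<longleftrightarrow> U \<subseteq> H_set B \<and>
    (\<forall>h\<in>U. \<exists>F. finite F \<and> F \<subseteq> B \<and> agreeing (H_set B) F h \<subseteq> U)" (is "?l \<longleftrightarrow> ?r")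
proof
  assume ?l
  then obtain S where S: "openin (residue_topology B) S" "U = S \<inter> H_set B"
    by (auto simp: openin_subtopology)
  show ?r
  proof (intro conjI ballI)
    fix h assume "h \<in> U"
    then obtain F where "finite F" "F \<subseteq> B" "agreeing (residue_space B) F h \<subseteq> S"
      using S unfolding openin_residue_topology[OF assms] by blast
    moreover have "H_set B \<subseteq> residue_space B" using H_set_iff[OF assms] by blast
    ultimately show "\<exists>F. finite F \<and> F \<subseteq> B \<and> agreeing (H_set B) F h \<subseteq> U"
      using S(2) by (intro exI[of _ F]) blast
  qed (use S in blast)
next
  assume r: ?r
  define S where "S = {h'\<in>residue_space B. \<exists>h\<in>U. \<exists>F. finite F \<and> F \<subseteq> B \<and>
    agreeing (H_set B) F h \<subseteq> U \<and> (\<forall>b\<in>F. h' b = h b)}"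
  have "openin (residue_topology B) S"
    unfolding openin_residue_topology[OF assms]
  proof (intro conjI ballI)
    fix g assume "g \<in> S"
    then obtain h F where *: "h \<in> U" "finite F" "F \<subseteq> B" "agreeing (H_set B) F h \<subseteq> U" "\<forall>b\<in>F. g b = h b"
      by (auto simp: S_def)
    then have "agreeing (residue_space B) F g \<subseteq> S" unfolding S_def by auto
    with * show "\<exists>F. finite F \<and> F \<subseteq> B \<and> agreeing (residue_space B) F g \<subseteq> S" by blast
  qed (auto simp: S_def)
  moreover have "U = S \<inter> H_set B"
  proof
    show "U \<subseteq> S \<inter> H_set B"
    proof
      fix h assume h: "h \<in> U"
      then have "h \<in> H_set B" using r by blast
      moreover from this have "h \<in> residue_space B" using H_set_iff[OF assms] by blast
      moreover obtain F where "finite F" "F \<subseteq> B" "agreeing (H_set B) F h \<subseteq> U" using r h by blast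
      ultimately show "h \<in> S \<inter> H_set B" using h unfolding S_def by auto
    qed
  qed (auto simp: S_def)
  ultimately show ?l by (auto simp: openin_subtopology)
qed

lemma H_set_cylinder:
  assumes "0 \<notin> B" "h \<in> H_set B" "finite F" "F \<subseteq> B"
  obtains n where "h \<in> cylinder B F n"
proof -
  obtain n where n: "\<forall>b\<in>F. h b = n mod int b"
    using H_set_iff[OF assms(1), THEN iffD1, OF assms(2), THEN conjunct2] assms(3,4) by metis
  have "h \<in> cylinder B F n" unfolding cylinder_def using assms(2) n by (intro CollectI conjI)
  then show ?thesis by (rule that)
qed

lemma cylinder_eq: "h \<in> cylinder B F n \<Longrightarrow> cylinder B F n = agreeing (H_set B) F h"
  by (simp add: cylinder_def)

lemma cylinder_in_cylinders: "finite F \<Longrightarrow> F \<subseteq> B \<Longrightarrow> cylinder B F n \<in> cylinders B"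
  unfolding cylinders_def by (rule image_eqI[of _ _ "(F, n)"]) simp_all

lemma cylindersE:
  assumes "C \<in> cylinders B"
  obtains F n where "finite F" "F \<subseteq> B" "C = cylinder B F n"
proof -
  obtain p where "p \<in> {F. finite F \<and> F \<subseteq> B} \<times> UNIV" "C = (\<lambda>(F, n). cylinder B F n) p"
    using assms unfolding cylinders_def by (rule imageE)
  then show ?thesis using that[of "fst p" "snd p"] by (simp add: case_prod_unfold mem_Times_iff)
qed

lemma cylinder_openin:
  assumes "0 \<notin> B" "finite F" "F \<subseteq> B"
  shows "openin (H_topology B) (cylinder B F n)"
proof -
  have "\<exists>F. finite F \<and> F \<subseteq> B \<and> agreeing (H_set B) F h \<subseteq> cylinder B F' n"
    if "h \<in> cylinder B F' n" "F' = F" for h F'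
    using assms(2,3) that(2) cylinder_eq[OF that(1)] by (intro exI[of _ F]) simp
  moreover have "cylinder B F n \<subseteq> H_set B" unfolding cylinder_def by (rule Collect_restrict)
  ultimately show ?thesis unfolding openin_H[OF assms(1)] by simp
qed

text \<open>An open set is the union of the cylinders it contains, and there are only countably many
  cylinders because \<open>B\<close> is a set of naturals.\<close>

lemma sigma_sets_cylinders:
  assumes "0 \<notin> B"
  shows "sigma_sets (H_set B) {U. openin (H_topology B) U} = sigma_sets (H_set B) (cylinders B)"
proof (rule sigma_sets_eqI)
  fix U assume "U \<in> {U. openin (H_topology B) U}"
  then have U: "U \<subseteq> H_set B" "\<forall>h\<in>U. \<exists>F. finite F \<and> F \<subseteq> B \<and> agreeing (H_set B) F h \<subseteq> U"
    using openin_H[OF assms, THEN iffD1, of U] by simp_all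
  have "U = \<Union>{C\<in>cylinders B. C \<subseteq> U}"
  proof
    show "U \<subseteq> \<Union>{C\<in>cylinders B. C \<subseteq> U}"
    proof
      fix h assume h: "h \<in> U"
      then obtain F where F: "finite F" "F \<subseteq> B" "agreeing (H_set B) F h \<subseteq> U"
        using bspec[OF U(2) h] by (elim exE conjE)
      have "h \<in> H_set B" using h U(1) by (rule subsetD[rotated])
      then obtain n where n: "h \<in> cylinder B F n" using H_set_cylinder[OF assms _ F(1,2)] by metis
      then have "cylinder B F n \<subseteq> U" unfolding cylinder_eq[OF n] using F(3) by blast
      moreover have "cylinder B F n \<in> cylinders B" by (rule cylinder_in_cylinders[OF F(1,2)])
      ultimately show "h \<in> \<Union>{C\<in>cylinders B. C \<subseteq> U}" using n by blast
    qed
  qed blast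
  moreover have "countable {F. finite F \<and> F \<subseteq> B}"
    by (rule countable_subset[OF _ countable_Collect_finite]) auto
  then have "countable (cylinders B)" unfolding cylinders_def by (intro countable_image countable_SIGMA) simp_all
  then have "countable {C\<in>cylinders B. C \<subseteq> U}" by (rule countable_subset[rotated]) (rule Collect_restrict)
  then have "\<Union>{C\<in>cylinders B. C \<subseteq> U} \<in> sigma_sets (H_set B) (cylinders B)"
    by (rule sigma_sets_UNION) auto
  ultimately show "U \<in> sigma_sets (H_set B) (cylinders B)" by simp
next
  fix C assume "C \<in> cylinders B"
  then obtain F n where "finite F" "F \<subseteq> B" "C = cylinder B F n" by (rule cylindersE)
  then have "openin (H_topology B) C" using cylinder_openin[OF assms] by simp
  then show "C \<in> sigma_sets (H_set B) {U. openin (H_topology B) U}" by (intro sigma_sets.Basic CollectI)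
qed

text \<open>\<open>{}\<close> is added since cylinders can be disjoint. The coordinates over
  \<open>F \<union> G\<close> of a common point come from one integer, which describes the
  intersection.\<close>

lemma Int_stable_cylinders:
  assumes "0 \<notin> B"
  shows "Int_stable (insert {} (cylinders B))"
proof (rule Int_stableI)
  fix C D assume "C \<in> insert {} (cylinders B)" "D \<in> insert {} (cylinders B)"
  moreover have "C \<inter> D \<in> insert {} (cylinders B)" if asm: "C \<in> cylinders B" "D \<in> cylinders B" "C \<inter> D \<noteq> {}"
  proof -
    obtain F n G m where CD: "finite F" "F \<subseteq> B" "C = cylinder B F n" "finite G" "G \<subseteq> B" "D = cylinder B G m"
      using asm(1,2) by (auto elim!: cylindersE)
    obtain h where h: "h \<in> cylinder B F n" "h \<in> cylinder B G m" using asm(3) CD by blast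
    then have "h \<in> H_set B" by (simp add: cylinder_def)
    then obtain k where k: "h \<in> cylinder B (F \<union> G) k"
      using H_set_cylinder[OF assms] CD by (metis finite_UnI Un_least)
    have "C \<inter> D = cylinder B (F \<union> G) k"
      unfolding CD(3,6) cylinder_eq[OF h(1)] cylinder_eq[OF h(2)] cylinder_eq[OF k] by blast
    then show ?thesis using CD cylinder_in_cylinders[of "F \<union> G" B k] by simp
  qed
  ultimately show "C \<inter> D \<in> insert {} (cylinders B)" by blast
qed

text \<open>The finitely many distinct cylinders over \<open>F\<close> partition \<open>H\<close>; if they all have the same mass,
  this mass is the reciprocal of their number.\<close>

lemma cylinder_mass:
  assumes B: "0 \<notin> B" and F: "finite F" "F \<subseteq> B" and m: "prob_space m" "space m = H_set B" "cylinders B \<subseteq> sets m"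
    and inv: "\<And>n. measure m (cylinder B F n) = measure m (cylinder B F 0)"
  shows "measure m (cylinder B F n) = 1 / card (range (cylinder B F))"
proof -
  interpret m: prob_space m by fact
  have F0: "0 \<notin> F" using B F(2) by blast
  define L where "L = \<Prod>F"
  have L: "L > 0" "\<forall>b\<in>F. b dvd L" using finite_common_multiple[OF F(1) F0] by (auto simp: L_def)
  have per: "cylinder B F n = cylinder B F (n mod int L)" for n
  proof -
    have "n mod int L mod int b = n mod int b" if "b \<in> F" for b
      using L(2) that by (simp add: mod_mod_cancel)
    then show ?thesis unfolding cylinder_def by (intro Collect_cong conj_cong refl ball_cong) simp
  qed
  have "range (cylinder B F) \<subseteq> cylinder B F ` {0..<int L}"
  proof (rule image_subsetI)
    fix n show "cylinder B F n \<in> cylinder B F ` {0..<int L}"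
      by (subst per) (intro imageI, use L(1) in simp)
  qed
  then have fin: "finite (range (cylinder B F))" by (rule finite_subset) simp
  have "m.prob (\<Union>(range (cylinder B F))) = (\<Sum>C\<in>range (cylinder B F). m.prob C)"
  proof (rule m.finite_measure_finite_Union[OF fin, where A = "\<lambda>C. C", simplified])
    show "range (cylinder B F) \<subseteq> m.events"  by (intro image_subsetI subsetD[OF m(3)] cylinder_in_cylinders F)
    show "disjoint_family_on (\<lambda>C. C) (range (cylinder B F))"
      unfolding disjoint_family_on_def
    proof (intro ballI impI equals0I)
      fix C D h assume "C \<in> range (cylinder B F)" "D \<in> range (cylinder B F)" "C \<noteq> D" "h \<in> C \<inter> D"
      moreover from this obtain n k where "C = cylinder B F n" "D = cylinder B F k" by blast
      ultimately show False using cylinder_eq[of h B F n] cylinder_eq[of h B F k] by simp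
    qed
  qed
  also have "\<dots> = (\<Sum>C\<in>range (cylinder B F). m.prob (cylinder B F 0))"
  proof (intro sum.cong refl)
    fix C assume "C \<in> range (cylinder B F)"
    then obtain n where "C = cylinder B F n" by blast
    then show "m.prob C = m.prob (cylinder B F 0)" by (simp only: inv[of n])
  qed
  also have "\<Union>(range (cylinder B F)) = space m"
  proof
    show "\<Union>(range (cylinder B F)) \<subseteq> space m" unfolding m(2) cylinder_def by blast
    show "space m \<subseteq> \<Union>(range (cylinder B F))"
    proof
      fix h assume "h \<in> space m"
      then obtain n where "h \<in> cylinder B F n" using H_set_cylinder[OF B _ F] unfolding m(2) by metis
      then show "h \<in> \<Union>(range (cylinder B F))" by blast
    qed
  qed
  finally have "card (range (cylinder B F)) * m.prob (cylinder B F 0) = 1" by (simp add: m.prob_space)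
  then show ?thesis
    unfolding inv[of n] by (cases "card (range (cylinder B F)) = 0") (auto simp: eq_divide_eq mult.commute)
qed

text \<open>Equal masses over each \<open>F\<close> determine all cylinder masses, and cylinders
  generate. This criterion yields both the invariance of \<open>H_prob\<close> and the uniqueness of
  Haar measure.\<close>

lemma cylinder_invariant_unique:
  assumes B: "0 \<notin> B"
    and m: "prob_space m" "space m = H_set B" "sets m = sigma_sets (H_set B) {U. openin (H_topology B) U}"
      "\<And>F n. finite F \<Longrightarrow> F \<subseteq> B \<Longrightarrow> measure m (cylinder B F n) = measure m (cylinder B F 0)"
    and m': "prob_space m'" "space m' = H_set B" "sets m' = sigma_sets (H_set B) {U. openin (H_topology B) U}"
      "\<And>F n. finite F \<Longrightarrow> F \<subseteq> B \<Longrightarrow> measure m' (cylinder B F n) = measure m' (cylinder B F 0)"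
  shows "m = m'"
proof -
  interpret m: prob_space m by fact
  interpret m': prob_space m' by fact
  have H: "H_set B = cylinder B {} 0" by (simp add: cylinder_def)
  have gen: "sigma_sets (H_set B) {U. openin (H_topology B) U} = sigma_sets (H_set B) (insert {} (cylinders B))"
    unfolding sigma_sets_cylinders[OF B]
    by (rule sigma_sets_eqI) (auto intro: sigma_sets.Empty sigma_sets.Basic)
  have cyl: "cylinders B \<subseteq> sets m" "cylinders B \<subseteq> sets m'"
    unfolding m(3) m'(3) sigma_sets_cylinders[OF B] by (simp_all add: subsetI sigma_sets.Basic)
  show ?thesis
  proof (rule measure_eqI_generator_eq[OF Int_stable_cylinders[OF B], where \<Omega> = "H_set B" and A = "\<lambda>_. H_set B"])
    show "insert {} (cylinders B) \<subseteq> Pow (H_set B)" by (auto simp: cylinders_def cylinder_def)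
    show "sets m = sigma_sets (H_set B) (insert {} (cylinders B))"
         "sets m' = sigma_sets (H_set B) (insert {} (cylinders B))" using m m' gen by auto
    show "range (\<lambda>_. H_set B) \<subseteq> insert {} (cylinders B)" using cylinder_in_cylinders[of "{}" B 0] H by simp
    show "emeasure m C = emeasure m' C" if "C \<in> insert {} (cylinders B)" for C
    proof (cases "C = {}")
      case False
      then have "C \<in> cylinders B" using that by simp
      then obtain F n where C: "finite F" "F \<subseteq> B" "C = cylinder B F n" by (rule cylindersE)
      then show ?thesis
        unfolding m.emeasure_eq_measure m'.emeasure_eq_measure C(3)
          cylinder_mass[OF B C(1,2) m(1,2) cyl(1) m(4)[OF C(1,2)]]
          cylinder_mass[OF B C(1,2) m'(1,2) cyl(2) m'(4)[OF C(1,2)]] by simp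
    qed simp
  qed (auto simp: m.emeasure_eq_measure)
qed

section \<open>The image of the random integer in \<open>H\<close>\<close>

definition profinite_point :: "nat set \<Rightarrow> real \<Rightarrow> nat \<Rightarrow> int" where
  "profinite_point B u = (\<lambda>b\<in>B. int (rint b u) mod int b)"

lemma rint_cong:
  assumes "b > 0" "b dvd L" "L > 0"
  shows "int (rint b u) mod int b = int (rint L u) mod int b"
proof -
  have "b \<le> L" using assms dvd_imp_le by blast
  then have "rint L u mod fact b = rint b u" by (rule rint_mod_fact)
  moreover have "b dvd fact b" using assms(1) by (simp add: dvd_fact)
  ultimately have "rint L u mod b = rint b u mod b" by (metis mod_mod_cancel)
  then show ?thesis by (metis zmod_int)
qed

lemma profinite_point_restrict:
  assumes "0 \<notin> B" "finite F" "F \<subseteq> B" "b \<in> F"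
  shows "profinite_point B u b = int (rint (\<Prod>F) u) mod int b"
proof -
  have F: "0 \<notin> F" using assms by blast
  have "b > 0" using F assms(4) by (metis gr0I)
  then show ?thesis
    using rint_cong[of b "\<Prod>F" u] finite_common_multiple[OF assms(2) F] assms(3,4)
    by (auto simp: profinite_point_def)
qed

lemma profinite_point_H:
  assumes "0 \<notin> B"
  shows "profinite_point B u \<in> H_set B"
proof (rule H_set_iff[OF assms, THEN iffD2], intro conjI allI impI)
  have "int (rint b u) mod int b \<in> {0..<int b}" if "b \<in> B" for b
    using assms that by (cases "b = 0") auto
  then show "profinite_point B u \<in> residue_space B"
    unfolding topspace_residue[OF assms] profinite_point_def by (simp add: restrict_PiE_iff)
  fix F assume "finite F" "F \<subseteq> B"
  then show "\<exists>n. \<forall>b\<in>F. profinite_point B u b = n mod int b"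
    using profinite_point_restrict[OF assms] by blast
qed

lemma profinite_point_vimage_cylinder:
  assumes "0 \<notin> B" "finite F" "F \<subseteq> B"
  shows "profinite_point B -` cylinder B F n = {u. \<forall>b\<in>F. int b dvd int (rint (\<Prod>F) u) + (- n)}"
  using profinite_point_H[OF assms(1)] profinite_point_restrict[OF assms]
  by (auto simp: cylinder_def mod_eq_dvd_iff)

definition H_algebra :: "nat set \<Rightarrow> (nat \<Rightarrow> int) measure" where
  "H_algebra B = sigma (H_set B) {U. openin (H_topology B) U}"

lemma space_H_algebra [simp]: "space (H_algebra B) = H_set B"
  and sets_H_algebra: "sets (H_algebra B) = sigma_sets (H_set B) {U. openin (H_topology B) U}"
proof -
  have "{U. openin (H_topology B) U} \<subseteq> Pow (H_set B)"
    using openin_subset topspace_subtopology_subset by fastforce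
  then show "space (H_algebra B) = H_set B"
    "sets (H_algebra B) = sigma_sets (H_set B) {U. openin (H_topology B) U}"
    unfolding H_algebra_def by (simp_all add: space_measure_of sets_measure_of)
qed

lemma measurable_H_algebraI:
  assumes "0 \<notin> B" "f \<in> space M \<rightarrow> H_set B"
    and "\<And>F n. finite F \<Longrightarrow> F \<subseteq> B \<Longrightarrow> f -` cylinder B F n \<inter> space M \<in> sets M"
  shows "f \<in> measurable M (H_algebra B)"
proof (rule measurable_sigma_sets)
  show "sets (H_algebra B) = sigma_sets (H_set B) (cylinders B)"
    unfolding sets_H_algebra by (rule sigma_sets_cylinders[OF assms(1)])
  show "cylinders B \<subseteq> Pow (H_set B)"
    by (auto elim!: cylindersE simp: cylinder_def)
  show "f -` C \<inter> space M \<in> sets M" if "C \<in> cylinders B" for C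
    using that by (rule cylindersE) (simp add: assms(3))
qed (rule assms(2))

lemma cylinder_measurable:
  assumes "0 \<notin> B" "finite F" "F \<subseteq> B"
  shows "cylinder B F n \<in> sets (H_algebra B)"
  unfolding sets_H_algebra by (rule sigma_sets.Basic) (simp add: cylinder_openin assms)

lemma profinite_point_measurable [measurable]:
  assumes "0 \<notin> B"
  shows "profinite_point B \<in> measurable unif (H_algebra B)"
proof (rule measurable_H_algebraI[OF assms])
  fix F n assume F: "finite F" "F \<subseteq> B"
  show "profinite_point B -` cylinder B F n \<inter> space unif \<in> sets unif"
    unfolding profinite_point_vimage_cylinder[OF assms F] by (simp add: rint_sets)
qed (use profinite_point_H[OF assms] in auto)

definition H_prob :: "nat set \<Rightarrow> (nat \<Rightarrow> int) measure" where
  "H_prob B = distr unif (H_algebra B) (profinite_point B)"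

lemma space_H_prob [simp]: "space (H_prob B) = H_set B"
  and sets_H_prob [simp, measurable_cong]: "sets (H_prob B) = sets (H_algebra B)"
  by (simp_all add: H_prob_def)

lemma prob_space_H_prob: "0 \<notin> B \<Longrightarrow> prob_space (H_prob B)"
  unfolding H_prob_def by (intro unif.prob_space_distr profinite_point_measurable)

text \<open>The preimage of the cylinder is a condition of period \<open>\<Prod>F\<close> translated
  by \<open>- n\<close>.\<close>

lemma H_prob_cylinder:
  assumes "0 \<notin> B" "finite F" "F \<subseteq> B"
  shows "measure (H_prob B) (cylinder B F n) = measure (H_prob B) (cylinder B F 0)"
proof -
  have F: "0 \<notin> F" using assms by blast
  define Q where "Q n \<longleftrightarrow> (\<forall>b\<in>F. int b dvd n + 0)" for n
  note L = finite_common_multiple[OF assms(2) F]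
  have per: "periodic (\<Prod>F) Q" unfolding Q_def using L(2) by (intro periodic_Ball periodic_dvd) auto
  have "measure (H_prob B) (cylinder B F n) = Pr {u. Q (int (rint (\<Prod>F) u) + (- n))}" for n
    unfolding H_prob_def
    by (subst measure_distr[OF profinite_point_measurable[OF assms(1)] cylinder_measurable[OF assms]])
      (simp add: profinite_point_vimage_cylinder[OF assms] Q_def)
  then show ?thesis by (simp only: prob_periodic_shift[OF L(1) per])
qed

section \<open>Translations and Haar measure\<close>

abbreviation H_group :: "nat set \<Rightarrow> (nat \<Rightarrow> int) monoid" where
  "H_group B \<equiv> (residue_product B)\<lparr>carrier := H_set B\<rparr>"

abbreviation translation :: "nat set \<Rightarrow> (nat \<Rightarrow> int) \<Rightarrow> (nat \<Rightarrow> int) \<Rightarrow> (nat \<Rightarrow> int)" where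
  "translation B g \<equiv> (\<lambda>h. g \<otimes>\<^bsub>H_group B\<^esub> h)"

lemma H_mult:
  assumes "0 \<notin> B"
  shows "g \<otimes>\<^bsub>H_group B\<^esub> h = (\<lambda>b\<in>B. (g b + h b) mod int b)"
  unfolding residue_product_def product_group_def
  using assms by (auto simp: integer_mod_group_def intro!: restrict_ext)

lemma H_mult_closed:
  assumes "0 \<notin> B" "g \<in> H_set B" "h \<in> H_set B"
  shows "g \<otimes>\<^bsub>H_group B\<^esub> h \<in> H_set B"
  unfolding H_mult[OF assms(1)]
proof (rule H_set_iff[OF assms(1), THEN iffD2], intro conjI allI impI)
  have "(g b + h b) mod int b \<in> {0..<int b}" if "b \<in> B" for b
    using assms that by (cases "b = 0") auto
  then show "(\<lambda>b\<in>B. (g b + h b) mod int b) \<in> residue_space B"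
    unfolding topspace_residue[OF assms(1)] by (simp add: restrict_PiE_iff)
  fix F assume F: "finite F" "F \<subseteq> B"
  obtain n where n: "\<forall>b\<in>F. g b = n mod int b"
    using H_set_iff[OF assms(1), THEN iffD1, OF assms(2), THEN conjunct2] F by metis
  obtain m where m: "\<forall>b\<in>F. h b = m mod int b"
    using H_set_iff[OF assms(1), THEN iffD1, OF assms(3), THEN conjunct2] F by metis
  have "\<forall>b\<in>F. (\<lambda>b\<in>B. (g b + h b) mod int b) b = (n + m) mod int b"
    using n m F(2) by (auto simp: mod_add_eq)
  then show "\<exists>n. \<forall>b\<in>F. (\<lambda>b\<in>B. (g b + h b) mod int b) b = n mod int b" by blast
qed

lemma H_mult_vimage_cylinder:
  assumes "0 \<notin> B" "finite F" "F \<subseteq> B" "g \<in> cylinder B F k"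
  shows "translation B g -` cylinder B F n \<inter> H_set B = cylinder B F (n - k)"
proof -
  have g: "g \<in> H_set B" "\<forall>b\<in>F. g b = k mod int b" using assms(4) by (simp_all add: cylinder_def)
  have "(g \<otimes>\<^bsub>H_group B\<^esub> h) b = n mod int b \<longleftrightarrow> h b = (n - k) mod int b"
    if h: "h \<in> H_set B" and b: "b \<in> F" for h b
  proof -
    have "h \<in> (\<Pi>\<^sub>E b\<in>B. {0..<int b})" using h H_set_iff[OF assms(1)] topspace_residue[OF assms(1)] by metis
    then have "h b \<in> {0..<int b}" using b assms(3) by blast
    then have hb: "h b mod int b = h b" by simp
    have "(g \<otimes>\<^bsub>H_group B\<^esub> h) b = (k + h b) mod int b"
      unfolding H_mult[OF assms(1)] using g(2) b assms(3) by (auto simp: mod_add_left_eq)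
    moreover have "(k + h b) mod int b = n mod int b \<longleftrightarrow> h b mod int b = (n - k) mod int b"
      by (simp add: mod_eq_dvd_iff algebra_simps)
    ultimately show ?thesis using hb by simp
  qed
  then show ?thesis
    using H_mult_closed[OF assms(1) g(1)] unfolding cylinder_def by auto
qed

lemma H_translation_measurable:
  assumes "0 \<notin> B" "g \<in> H_set B"
  shows "translation B g \<in> measurable (H_algebra B) (H_algebra B)"
proof (rule measurable_H_algebraI[OF assms(1)])
  fix F n assume F: "finite F" "F \<subseteq> B"
  obtain k where "g \<in> cylinder B F k" using H_set_cylinder[OF assms F] by metis
  then show "translation B g -` cylinder B F n \<inter> space (H_algebra B) \<in> sets (H_algebra B)"
    by (simp only: space_H_algebra H_mult_vimage_cylinder[OF assms(1) F] cylinder_measurable[OF assms(1) F])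
qed (use H_mult_closed[OF assms] in auto)

text \<open>A translation permutes the cylinders over each \<open>F\<close>, so the image measure
  also gives them equal masses.\<close>

lemma H_prob_invariant:
  assumes "0 \<notin> B" "g \<in> H_set B"
  shows "distr (H_prob B) (H_prob B) (translation B g) = H_prob B"
proof (rule cylinder_invariant_unique[OF assms(1)])
  have meas: "translation B g \<in> measurable (H_prob B) (H_prob B)"
    using H_translation_measurable[OF assms] by (simp cong: measurable_cong_sets)
  interpret prob_space "H_prob B" by (rule prob_space_H_prob[OF assms(1)])
  show "prob_space (distr (H_prob B) (H_prob B) (translation B g))"
    by (rule prob_space_distr[OF meas])
  show "measure (distr (H_prob B) (H_prob B) (translation B g)) (cylinder B F n) =
    measure (distr (H_prob B) (H_prob B) (translation B g)) (cylinder B F 0)"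
    if F: "finite F" "F \<subseteq> B" for F n
  proof -
    obtain k where k: "g \<in> cylinder B F k" using H_set_cylinder[OF assms F] by metis
    have "measure (distr (H_prob B) (H_prob B) (translation B g)) (cylinder B F n) = measure (H_prob B) (cylinder B F 0)" for n
      using H_prob_cylinder[OF assms(1) F, of "n - k"]
      by (subst measure_distr[OF meas])
        (simp_all only: space_H_prob sets_H_prob cylinder_measurable[OF assms(1) F] H_mult_vimage_cylinder[OF assms(1) F k])
    then show ?thesis by simp
  qed
qed (rule prob_space_H_prob[OF assms(1)] space_H_prob | erule (1) H_prob_cylinder[OF assms(1)] | simp add: sets_H_algebra)+

text \<open>A competitor is invariant under the image of each integer \<open>n\<close> in
  \<open>H\<close>, and translation by it pulls \<open>cylinder B F n\<close> back to
  \<open>cylinder B F 0\<close>; so its cylinders over \<open>F\<close> have equal masses.\<close>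

lemma haar_H_eq:
  assumes "0 \<notin> B"
  shows "haar_H B = H_prob B"
  unfolding haar_H_def haar_measure_def
proof (rule the_equality)
  show "space (H_prob B) = carrier (H_group B) \<and>
    sets (H_prob B) = sigma_sets (carrier (H_group B)) {U. openin (H_topology B) U} \<and>
    prob_space (H_prob B) \<and> (\<forall>g\<in>carrier (H_group B). distr (H_prob B) (H_prob B) (translation B g) = H_prob B)"
    using H_prob_invariant[OF assms] by (simp add: prob_space_H_prob[OF assms] sets_H_algebra)
next
  fix m :: "(nat \<Rightarrow> int) measure"
  assume "space m = carrier (H_group B) \<and>
    sets m = sigma_sets (carrier (H_group B)) {U. openin (H_topology B) U} \<and>
    prob_space m \<and> (\<forall>g\<in>carrier (H_group B). distr m m (translation B g) = m)"
  then have m: "space m = H_set B" "sets m = sigma_sets (H_set B) {U. openin (H_topology B) U}" "prob_space m"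
    "\<And>g. g \<in> H_set B \<Longrightarrow> distr m m (translation B g) = m" by auto
  have sm: "sets m = sets (H_algebra B)" using m(2) by (simp add: sets_H_algebra)
  show "m = H_prob B"
  proof (rule cylinder_invariant_unique[OF assms m(3,1,2)])
    fix F n assume F: "finite F" "F \<subseteq> B"
    define g where "g = residue_point B n"
    have g: "g \<in> H_set B"
      unfolding g_def using residue_point_topspace[OF assms, of n]
      by (intro H_set_iff[OF assms, THEN iffD2]) (auto simp: residue_point_def)
    then have gk: "g \<in> cylinder B F n"
      using F by (auto simp: g_def cylinder_def residue_point_def)
    have meas: "translation B g \<in> measurable m m"
      using H_translation_measurable[OF assms g] by (simp add: sm cong: measurable_cong_sets)
    have "measure m (cylinder B F n) = measure (distr m m (translation B g)) (cylinder B F n)"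
      by (simp only: m(4)[OF g])
    also have "\<dots> = measure m (cylinder B F 0)"
      by (subst measure_distr[OF meas])
        (simp_all only: m(1) sm cylinder_measurable[OF assms F] H_mult_vimage_cylinder[OF assms F gk] diff_self)
    finally show "measure m (cylinder B F n) = measure m (cylinder B F 0)" .
  qed (rule prob_space_H_prob[OF assms] space_H_prob | erule (1) H_prob_cylinder[OF assms] | simp add: sets_H_algebra)+
qed

section \<open>The Mirsky measure and its support\<close>

definition random_eta :: "nat set \<Rightarrow> real \<Rightarrow> int \<Rightarrow> nat" where
  "random_eta B u n = (if u \<in> Free B n then 1 else 0)"

lemma random_eta_measurable [measurable]: "random_eta B \<in> borel_measurable unif"
proof (rule measurable_coordinatewise_then_product)
  fix n
  have "random_eta B u n = indicator (Free B n) u" for u by (simp add: random_eta_def)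
  then show "(\<lambda>u. random_eta B u n) \<in> borel_measurable unif" by simp
qed

lemma \<phi>_measurable:
  assumes "0 \<notin> B"
  shows "\<phi> B \<in> borel_measurable (H_prob B)"
proof (rule measurable_coordinatewise_then_product)
  fix n
  define Z where "Z = (\<Union>b\<in>B. cylinder B {b} (- n))"
  have "Z \<in> sets (H_prob B)"
    unfolding Z_def sets_H_prob by (rule sets.countable_UN'') (auto intro: cylinder_measurable[OF assms])
  moreover have "\<phi> B h n = indicator (H_set B - Z) h" if h: "h \<in> H_set B" for h
  proof -
    have "(h b + n) mod int b = 0 \<longleftrightarrow> h \<in> cylinder B {b} (- n)" if b: "b \<in> B" for b
    proof -
      have "h \<in> (\<Pi>\<^sub>E b\<in>B. {0..<int b})" using h H_set_iff[OF assms] topspace_residue[OF assms] by metis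
      then have "h b \<in> {0..<int b}" using b by blast
      then have hb: "h b = h b mod int b" by simp
      have "h \<in> cylinder B {b} (- n) \<longleftrightarrow> h b mod int b = (- n) mod int b"
        unfolding cylinder_def using h hb by simp
      then show ?thesis by (simp add: mod_eq_dvd_iff dvd_eq_mod_eq_0)
    qed
    then show ?thesis using h by (auto simp: \<phi>_def Z_def indicator_def)
  qed
  moreover have "H_set B - Z \<in> sets (H_prob B)"
    using calculation(1) sets.compl_sets[of Z "H_prob B"] by simp
  ultimately show "(\<lambda>h. \<phi> B h n) \<in> borel_measurable (H_prob B)"
    by (subst measurable_cong[where g = "indicator (H_set B - Z)"]) (simp_all only: space_H_prob borel_measurable_indicator)
qed

lemma \<phi>_profinite_point:
  assumes "0 \<notin> B"
  shows "\<phi> B (profinite_point B u) = random_eta B u"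
proof
  fix n
  have "(profinite_point B u b + n) mod int b = 0 \<longleftrightarrow> u \<in> Dvd b n" if "b \<in> B" for b
    using that by (simp add: profinite_point_def Dvd_def mod_add_left_eq dvd_eq_mod_eq_0)
  then show "\<phi> B (profinite_point B u) n = random_eta B u n"
    by (simp add: \<phi>_def random_eta_def Free_def)
qed

lemma mirsky_eq:
  assumes "0 \<notin> B"
  shows "mirsky B = distr unif borel (random_eta B)"
proof -
  have meas: "\<phi> B \<in> borel_measurable (H_algebra B)"
    using \<phi>_measurable[OF assms] by (simp cong: measurable_cong_sets)
  show ?thesis
    unfolding mirsky_def haar_H_eq[OF assms] H_prob_def
    by (subst distr_distr[OF meas profinite_point_measurable[OF assms]])
      (simp add: comp_def \<phi>_profinite_point[OF assms])
qed

lemma prob_space_mirsky: "0 \<notin> B \<Longrightarrow> prob_space (mirsky B)"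
  by (simp add: mirsky_eq unif.prob_space_distr)

lemma sets_mirsky [simp, measurable_cong]: "sets (mirsky B) = sets borel"
  by (simp add: mirsky_def)

lemma space_mirsky [simp]: "space (mirsky B) = UNIV"
  by (simp add: mirsky_def)

lemma emeasure_mirsky:
  assumes "0 \<notin> B" "A \<in> sets borel"
  shows "emeasure (mirsky B) A = ennreal (Pr {u. random_eta B u \<in> A})"
  unfolding mirsky_eq[OF assms(1)] using assms(2)
  by (subst emeasure_distr) (auto simp: unif.emeasure_eq_measure vimage_def)

lemma continuous_shift_by: "continuous_on A (shift_by k)"
  unfolding shift_by_def
  by (intro continuous_on_coordinatewise_then_product)
    (rule continuous_on_subset[OF continuous_on_product_coordinates], simp)

lemma shift_by_measurable [measurable]: "shift_by k \<in> borel_measurable borel"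
  by (rule borel_measurable_continuous_onI[OF continuous_shift_by])

text \<open>\<open>\<phi> B\<close> turns translation by the image of \<open>k\<close> in
  \<open>H\<close> into \<open>shift_by k\<close>.\<close>

lemma distr_mirsky_shift:
  assumes "0 \<notin> B"
  shows "distr (mirsky B) borel (shift_by k) = mirsky B"
proof -
  define g where "g = residue_point B k"
  have g: "g \<in> H_set B"
    unfolding g_def using residue_point_topspace[OF assms, of k]
    by (intro H_set_iff[OF assms, THEN iffD2]) (auto simp: residue_point_def)
  have meas: "translation B g \<in> measurable (H_prob B) (H_prob B)"
    using H_translation_measurable[OF assms g] by (simp cong: measurable_cong_sets)
  have eq: "\<phi> B \<circ> (translation B g) = (\<lambda>h. shift_by k (\<phi> B h))"
  proof (intro ext)
    fix h n
    have "((g \<otimes>\<^bsub>H_group B\<^esub> h) b + n) mod int b = (h b + (n + k)) mod int b" if "b \<in> B" for b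
      unfolding H_mult[OF assms] using that
      by (simp add: g_def residue_point_def mod_add_left_eq mod_add_right_eq algebra_simps)
    then show "(\<phi> B \<circ> (translation B g)) h n = shift_by k (\<phi> B h) n"
      by (simp add: \<phi>_def shift_by_def)
  qed
  have "distr (mirsky B) borel (shift_by k) = distr (H_prob B) borel (\<lambda>h. shift_by k (\<phi> B h))"
    unfolding mirsky_def haar_H_eq[OF assms]
    by (subst distr_distr[OF shift_by_measurable \<phi>_measurable[OF assms]]) (simp add: comp_def)
  also have "\<dots> = distr (distr (H_prob B) (H_prob B) (translation B g)) borel (\<phi> B)"
    by (simp only: distr_distr[OF \<phi>_measurable[OF assms] meas] eq)
  also have "\<dots> = mirsky B"
    unfolding H_prob_invariant[OF assms g] mirsky_def haar_H_eq[OF assms] ..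
  finally show ?thesis .
qed

section \<open>Finite windows and the support\<close>

lemma open_nat: "open (A :: nat set)"
  by (rule discrete_topology_class.open_discrete)

abbreviation window :: "int set \<Rightarrow> (int \<Rightarrow> nat) \<Rightarrow> (int \<Rightarrow> nat) set" where
  "window W x \<equiv> {y. \<forall>j\<in>W. y j = x j}"

lemma open_window:
  fixes x :: "int \<Rightarrow> nat"
  assumes "finite W"
  shows "open (window W x)"
proof -
  have "open {y. \<forall>j\<in>W. y j \<in> {x j}}"
    by (rule product_topology_basis'[OF assms, of "\<lambda>j. {x j}" "\<lambda>j. j"]) (rule open_nat)
  then show ?thesis by simp
qed

lemma open_contains_window:
  fixes x :: "int \<Rightarrow> nat"
  assumes "open U" "x \<in> U"
  obtains W where "finite W" "window W x \<subseteq> U"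
proof -
  have "openin (product_topology (\<lambda>_. euclidean) UNIV) U" using assms(1) by (simp add: open_fun_def)
  from product_topology_open_contains_basis[OF this assms(2)]
  obtain X where X: "x \<in> Pi\<^sub>E UNIV X" "finite {i. X i \<noteq> UNIV}" "Pi\<^sub>E UNIV X \<subseteq> U"
    unfolding topspace_euclidean by blast
  have "{y. \<forall>j\<in>{i. X i \<noteq> UNIV}. y j = x j} \<subseteq> Pi\<^sub>E UNIV X"
  proof
    fix y assume y: "y \<in> {y. \<forall>j\<in>{i. X i \<noteq> UNIV}. y j = x j}"
    have "y j \<in> X j" for j
      using y PiE_mem[OF X(1), of j] by (cases "X j = UNIV") auto
    then show "y \<in> Pi\<^sub>E UNIV X" by (simp add: PiE_UNIV_domain)
  qed
  then show ?thesis using that X(2,3) by blast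
qed

lemma eta_eq: "eta B n = (if n \<in> free_set B then 1 else 0)"
  by (simp add: eta_def indicator_def)

lemma X_eta_iff: "x \<in> X_eta B \<longleftrightarrow> (\<forall>W. finite W \<longrightarrow> (\<exists>r. \<forall>j\<in>W. x j = eta B (j + r)))"
proof
  assume x: "x \<in> X_eta B"
  show "\<forall>W. finite W \<longrightarrow> (\<exists>r. \<forall>j\<in>W. x j = eta B (j + r))"
  proof (intro allI impI)
    fix W :: "int set" assume W: "finite W"
    have "window W x \<inter> range (\<lambda>r. shift_by r (eta B)) \<noteq> {}"
      using x open_Int_closure_eq_empty[OF open_window[OF W, of x]] unfolding X_eta_def by blast
    then obtain r where "shift_by r (eta B) \<in> window W x" by blast
    then show "\<exists>r. \<forall>j\<in>W. x j = eta B (j + r)" by (intro exI[of _ r]) (simp add: shift_by_def)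
  qed
next
  assume r: "\<forall>W. finite W \<longrightarrow> (\<exists>r. \<forall>j\<in>W. x j = eta B (j + r))"
  show "x \<in> X_eta B"
  proof (rule ccontr)
    assume x: "x \<notin> X_eta B"
    have "open (- X_eta B)" unfolding X_eta_def by (rule open_Compl[OF closed_closure])
    then obtain W where W: "finite W" "window W x \<subseteq> - X_eta B"
      by (rule open_contains_window) (use x in simp)
    then obtain k where "\<forall>j\<in>W. x j = eta B (j + k)" using r by blast
    then have "shift_by k (eta B) \<in> - X_eta B" using W(2) by (auto simp: shift_by_def eq_commute)
    moreover have "shift_by k (eta B) \<in> X_eta B"
      unfolding X_eta_def by (rule subsetD[OF closure_subset]) blast
    ultimately show False by simp
  qed
qed

lemma closed_X_eta: "closed (X_eta B)"
  by (simp add: X_eta_def)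

lemma pattern_sets:
  assumes "finite J" "finite Z"
  shows "all_free B J \<inter> none_free B Z \<in> sets borel"
proof -
  have "all_free B J \<inter> none_free B Z = UNIV - ((\<Union>j\<in>J. - Free B j) \<union> (\<Union>q\<in>Z. Free B q))" by auto
  then show ?thesis using assms by (auto intro!: sets.Diff sets.finite_UN sets.Un)
qed

text \<open>A zero at \<open>q\<close> means that some \<open>b \<in> B\<close> divides
  \<open>\<xi> + q\<close>, and there are countably many choices of \<open>b\<close> and of the
  residue \<open>s\<close> modulo \<open>L * b\<close>. A choice of positive probability turns the
  zero into a congruence absorbed by the modulus, until only ones remain.\<close>

lemma positive_pattern_occurs:
  assumes B: "0 \<notin> B" and J: "finite J" and "finite Z" and "L > 0"
    and "Pr (Dvd L (- r) \<inter> all_free B J \<inter> none_free B Z) > 0"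
  shows "\<exists>n>t. int L dvd n - r \<and> (\<forall>j\<in>J. n + j \<in> free_set B) \<and> (\<forall>q\<in>Z. n + q \<notin> free_set B)"
  using assms(3-5)
proof (induction Z arbitrary: L r rule: finite_induct)
  case empty
  then show ?case using positive_prob_imp_infinite[OF B _ J] by simp
next
  case (insert q Z)
  define E where "E = Dvd L (- r) \<inter> all_free B J \<inter> none_free B Z"
  define G where "G = (\<lambda>(b, s). E \<inter> Dvd b q \<inter> Dvd (L * b) (- s))"
  have E: "E \<in> sets borel"
    unfolding E_def Int_assoc by (intro sets.Int Dvd_sets pattern_sets J insert.hyps(1))
  have Gm: "G i \<in> sets unif" for i using E by (auto simp: G_def split: prod.split)
  have "\<exists>i\<in>B \<times> UNIV. Pr (G i) \<noteq> 0"
  proof (rule ccontr)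
    assume "\<not> ?thesis"
    then have null: "Pr (G i) = 0" if "i \<in> B \<times> UNIV" for i using that by blast
    have N: "(\<Union>i\<in>B \<times> UNIV. G i) \<in> null_sets unif"
      by (rule null_sets_UN') (use null Gm in \<open>auto simp: null_sets_def unif.emeasure_eq_measure\<close>)
    have S: "Dvd L (- r) \<inter> all_free B J \<inter> none_free B (insert q Z) \<subseteq> (\<Union>i\<in>B \<times> UNIV. G i)"
    proof
      fix u assume u: "u \<in> Dvd L (- r) \<inter> all_free B J \<inter> none_free B (insert q Z)"
      then have "u \<in> E" unfolding E_def by simp
      have "u \<notin> Free B q" using u by simp
      then obtain b where "b \<in> B" "u \<in> Dvd b q" by (auto simp: Free_def)
      moreover have "u \<in> Dvd (L * b) (- int (rint (L * b) u))" by (simp add: Dvd_def)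
      ultimately show "u \<in> (\<Union>i\<in>B \<times> UNIV. G i)"
        using \<open>u \<in> E\<close> by (intro UN_I[of "(b, int (rint (L * b) u))"]) (simp_all add: G_def)
    qed
    have "Pr (Dvd L (- r) \<inter> all_free B J \<inter> none_free B (insert q Z)) \<le> Pr (\<Union>i\<in>B \<times> UNIV. G i)"
      by (rule unif.finite_measure_mono[OF S null_setsD2[OF N]])
    also have "\<dots> = 0" using null_setsD1[OF N] by (simp only: measure_def enn2real_0)
    finally show False using insert.prems(2) by (rule leD[THEN notE])
  qed
  then obtain b s where bs: "b \<in> B" "Pr (G (b, s)) \<noteq> 0" by auto
  have b: "b > 0" using bs(1) B by (metis gr0I)
  have Lb: "L * b > 0" using b insert.prems(1) by simp
  \<comment> \<open>A sample point shows that \<open>s\<close> agrees with \<open>r\<close> modulo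
    \<open>L\<close> and with \<open>- q\<close> modulo \<open>b\<close>; both congruences pass to
    \<open>n\<close>.\<close>
  have "G (b, s) \<noteq> {}" using bs(2) by auto
  then obtain u where u: "u \<in> E" "u \<in> Dvd b q" "u \<in> Dvd (L * b) (- s)" by (auto simp: G_def)
  define m where "m = int (rint (L * b) u)"
  have "u \<in> Dvd L (- r)" using u(1) unfolding E_def by simp
  then have "int L dvd m - r"
    using Dvd_iff[OF insert.prems(1) _ Lb, of u "- r"] by (simp add: m_def)
  moreover have "int b dvd m + q" using u(2) Dvd_iff[OF b _ Lb, of u q] by (simp add: m_def)
  moreover have "int (L * b) dvd m - s" using u(3) Dvd_iff[OF Lb dvd_refl Lb, of u "- s"] by (simp add: m_def)
  moreover have dL: "int L dvd int (L * b)" "int b dvd int (L * b)" by simp_all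
  ultimately have s: "int L dvd m - r" "int b dvd m + q" "int L dvd m - s" "int b dvd m - s"
    by (metis dvd_trans)+
  have "0 < Pr (G (b, s))" using bs(2) by (simp add: zero_less_measure_iff)
  also have "\<dots> \<le> Pr (Dvd (L * b) (- s) \<inter> all_free B J \<inter> none_free B Z)"
  proof (rule unif.finite_measure_mono)
    show "Dvd (L * b) (- s) \<inter> all_free B J \<inter> none_free B Z \<in> unif.events"
      unfolding Int_assoc sets_unif by (intro sets.Int Dvd_sets pattern_sets J insert.hyps(1))
  qed (auto simp: G_def E_def)
  finally obtain n where n: "n > t" "int (L * b) dvd n - s" "\<forall>j\<in>J. n + j \<in> free_set B" "\<forall>q\<in>Z. n + q \<notin> free_set B"
    using insert.IH[OF Lb] by blast
  have Ln: "int L dvd n - s" "int b dvd n - s" using n(2) dL by (metis dvd_trans)+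
  have "int L dvd (n - s) + ((m - r) - (m - s))" by (intro dvd_add dvd_diff Ln s)
  moreover have "int b dvd (n - s) + ((m + q) - (m - s))" by (intro dvd_add dvd_diff Ln s)
  ultimately have nLb: "int L dvd n - r" "int b dvd n + q" by simp_all
  then have "n + q \<notin> free_set B" using bs(1) unfolding mem_free_set by blast
  then have "\<forall>q\<in>insert q Z. n + q \<notin> free_set B" using n(4) by blast
  with n(1,3) nLb(1) show ?case by (intro exI[of _ n] conjI)
qed

text \<open>The event is covered by countably many finite patterns that force membership in
  \<open>U\<close>; one of them has positive probability and so occurs in
  \<open>eta B\<close>.\<close>

lemma mirsky_open_pos_imp:
  assumes B: "0 \<notin> B" and U: "open U" "emeasure (mirsky B) U \<noteq> 0"
  shows "\<exists>r. shift_by r (eta B) \<in> U"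
proof -
  define I where "I = {(J, Z). finite J \<and> finite Z \<and> {x. (\<forall>j\<in>J. x j = 1) \<and> (\<forall>q\<in>Z. x q = 0)} \<subseteq> U}"
  \<comment> \<open>\<open>Dvd 1 (- 0)\<close> is the whole space, written to fit
    \<open>positive_pattern_occurs\<close>.\<close>
  define P where "P = (\<lambda>(J, Z). Dvd 1 (- 0) \<inter> all_free B J \<inter> none_free B Z)"
  have P: "P i \<in> sets unif" if "i \<in> I" for i
  proof -
    obtain J Z where i: "i = (J, Z)" "finite J" "finite Z" using \<open>i \<in> I\<close> by (auto simp: I_def)
    show ?thesis
      unfolding P_def i(1) prod.case Int_assoc sets_unif by (intro sets.Int Dvd_sets pattern_sets i(2,3))
  qed
  have "countable (Collect finite :: int set set)" by (rule countable_Collect_finite)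
  then have "countable ((Collect finite :: int set set) \<times> (Collect finite :: int set set))" by (intro countable_SIGMA)
  then have cI: "countable I" by (rule countable_subset[rotated]) (auto simp: I_def)
  have sub: "{u. random_eta B u \<in> U} \<subseteq> (\<Union>i\<in>I. P i)"
  proof
    fix u assume "u \<in> {u. random_eta B u \<in> U}"
    then obtain W where W: "finite W" "window W (random_eta B u) \<subseteq> U"
      using open_contains_window[OF U(1)] by blast
    define J where "J = {j\<in>W. u \<in> Free B j}"
    define Z where "Z = {j\<in>W. u \<notin> Free B j}"
    have "{x. (\<forall>j\<in>J. x j = 1) \<and> (\<forall>q\<in>Z. x q = 0)} \<subseteq> window W (random_eta B u)"
      by (auto simp: J_def Z_def random_eta_def)
    then have "(J, Z) \<in> I" using W unfolding I_def by (auto simp: J_def Z_def)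
    moreover have "u \<in> P (J, Z)" by (simp add: P_def J_def Z_def Dvd_def)
    ultimately show "u \<in> (\<Union>i\<in>I. P i)" by blast
  qed
  have "\<exists>i\<in>I. Pr (P i) \<noteq> 0"
  proof (rule ccontr)
    assume "\<not> ?thesis"
    then have "(\<Union>i\<in>I. P i) \<in> null_sets unif"
      by (intro null_sets_UN'[OF cI]) (use P in \<open>auto simp: null_sets_def unif.emeasure_eq_measure\<close>)
    then have "Pr {u. random_eta B u \<in> U} \<le> 0"
      using unif.finite_measure_mono[OF sub] by (auto simp: null_sets_def unif.emeasure_eq_measure)
    then show False using U emeasure_mirsky[OF B] by (simp add: measure_le_0_iff)
  qed
  then obtain J Z where JZ: "(J, Z) \<in> I" "Pr (P (J, Z)) > 0" by (auto simp: zero_less_measure_iff)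
  have "finite J" "finite Z" using JZ(1) by (simp_all add: I_def)
  then obtain n where "\<forall>j\<in>J. n + j \<in> free_set B" "\<forall>q\<in>Z. n + q \<notin> free_set B"
    using positive_pattern_occurs[OF B, of J Z 1 0 0, OF _ _ zero_less_one] JZ(2) unfolding P_def prod.case by blast
  then have "shift_by n (eta B) \<in> U"
    using JZ(1) by (auto simp: I_def shift_by_def eta_eq add.commute)
  then show ?thesis ..
qed

text \<open>For \<open>B'\<close> this is half of the support identity; for \<open>B\<close> it
  yields the inclusion of \<open>X_eta B'\<close> in \<open>X_eta B\<close>.\<close>

lemma supp_mirsky_subset:
  assumes "0 \<notin> B"
  shows "supp (mirsky B) \<subseteq> X_eta B"
proof
  fix x assume x: "x \<in> supp (mirsky B)"
  show "x \<in> X_eta B"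
    unfolding X_eta_iff
  proof (intro allI impI)
    fix W :: "int set" assume W: "finite W"
    have "emeasure (mirsky B) (window W x) > 0"
      using x open_window[OF W, of x] unfolding supp_def by blast
    then have "\<exists>r. shift_by r (eta B) \<in> window W x"
      by (intro mirsky_open_pos_imp[OF assms open_window[OF W]]) simp
    then obtain r where "shift_by r (eta B) \<in> window W x" by blast
    then show "\<exists>r. \<forall>j\<in>W. x j = eta B (j + r)" by (intro exI[of _ r]) (simp add: shift_by_def)
  qed
qed

lemma mirsky_X_eta:
  assumes "0 \<notin> B"
  shows "emeasure (mirsky B) (X_eta B) = 1"
proof -
  interpret prob_space "mirsky B" by (rule prob_space_mirsky[OF assms])
  have "shift_by r (eta B) \<in> X_eta B" for r
    unfolding X_eta_def by (rule subsetD[OF closure_subset]) blast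
  then have "emeasure (mirsky B) (- X_eta B) = 0"
    using mirsky_open_pos_imp[OF assms, of "- X_eta B"] closed_X_eta by blast
  then have "prob (- X_eta B) = 0" by (simp add: measure_def)
  moreover have "prob (- X_eta B) = 1 - prob (X_eta B)"
    using prob_compl[of "X_eta B"] closed_X_eta by (simp add: Compl_eq_Diff_UNIV)
  ultimately show ?thesis by (simp add: emeasure_eq_measure)
qed

text \<open>\<open>taut_block\<close> gives the ones positive probability within a class that
  already forces the zeros; shift invariance moves the block back by \<open>k\<close>.\<close>

lemma taut_X_eta_subset_supp:
  assumes taut: "taut B"
  shows "X_eta B \<subseteq> supp (mirsky B)"
proof
  have B: "0 \<notin> B" using taut by (simp add: taut_def)
  fix x assume x: "x \<in> X_eta B"
  have "emeasure (mirsky B) U > 0" if U: "open U" "x \<in> U" for U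
  proof -
    obtain W where W: "finite W" "window W x \<subseteq> U" by (rule open_contains_window[OF U])
    then obtain k where k: "\<forall>j\<in>W. x j = eta B (j + k)" using x unfolding X_eta_iff by blast
    define J where "J = {j \<in> (\<lambda>j. j + k) ` W. j \<in> free_set B}"
    define Z where "Z = {j \<in> (\<lambda>j. j + k) ` W. j \<notin> free_set B}"
    have fin: "finite J" "finite Z" using W(1) by (simp_all add: J_def Z_def)
    note sets = pattern_sets[OF fin, of B]
    have "Pr (all_free B J \<inter> none_free B Z) > 0"
    proof (cases "B = {}")
      case True
      then have "Z = {}" by (auto simp: Z_def mem_free_set)
      then show ?thesis using True by simp
    next
      case False
      \<comment> \<open>Any position outside \<open>J\<close> serves, as divisibility by
        \<open>w = 1\<close> is automatic.\<close>
      obtain p where p: "p \<notin> J" using ex_new_if_finite[OF infinite_UNIV_int fin(1)] by blast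
      have "J \<subseteq> free_set B" "Z \<inter> free_set B = {}" by (auto simp: J_def Z_def)
      from taut_block[OF taut False fin(1) this(1) fin(2) this(2) p]
      obtain X where "\<forall>w>0. coprime w X \<longrightarrow> (\<exists>L r. L > 0 \<and> w dvd L \<and> int w dvd r + p \<and>
          (\<forall>q\<in>Z. \<exists>b\<in>B. b dvd L \<and> int b dvd r + q) \<and>
          Pr (Dvd L (- r) \<inter> all_free B J) > 0)"
        by (elim exE conjE)
      from this[rule_format, OF zero_less_one coprime_1_left]
      obtain L r where Lr: "L > 0" "\<forall>q\<in>Z. \<exists>b\<in>B. b dvd L \<and> int b dvd r + q"
        "Pr (Dvd L (- r) \<inter> all_free B J) > 0"
        by (elim exE conjE)
      have "Dvd L (- r) \<inter> all_free B J \<subseteq> all_free B J \<inter> none_free B Z"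
      proof
        fix u assume u: "u \<in> Dvd L (- r) \<inter> all_free B J"
        have "u \<notin> Free B q" if q: "q \<in> Z" for q
        proof -
          obtain b where b: "b \<in> B" "b dvd L" "int b dvd r + q" using Lr(2) q by blast
          have "b > 0" using b(1) B by (metis gr0I)
          have "int L dvd int (rint L u) - r" using u Dvd_iff[of L L u "- r"] Lr(1) by simp
          then have "int b dvd int (rint L u) - r" using b(2) by (meson dvd_trans int_dvd_int_iff)
          then have "int b dvd (int (rint L u) - r) + (r + q)" using b(3) by (rule dvd_add)
          then have "u \<in> Dvd b q" using Dvd_iff[OF \<open>b > 0\<close> b(2) Lr(1)] by simp
          then show ?thesis using b(1) by (auto simp: Free_def)
        qed
        then show "u \<in> all_free B J \<inter> none_free B Z" using u by blast
      qed
      from unif.finite_measure_mono[OF this sets[folded sets_unif]] show ?thesis by (rule less_le_trans[OF Lr(3)])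
    qed
    also have "all_free B J \<inter> none_free B Z = {u. random_eta B u \<in> shift_by k -` (window W x)}"
      using k by (auto simp: J_def Z_def shift_by_def random_eta_def eta_eq split: if_splits)
    finally have "0 < emeasure (mirsky B) (shift_by k -` window W x)"
      using open_window[OF W(1), of x] measurable_sets[OF shift_by_measurable, of "window W x" k]
      by (subst emeasure_mirsky[OF B]) (auto simp: ennreal_less_zero_iff)
    also have "\<dots> = emeasure (distr (mirsky B) borel (shift_by k)) (window W x)"
      using open_window[OF W(1), of x] by (subst emeasure_distr) simp_all
    also have "\<dots> \<le> emeasure (mirsky B) U"
      unfolding distr_mirsky_shift[OF B] using W(2) U(1) by (intro emeasure_mono) auto
    finally show ?thesis .
  qed
  then show "x \<in> supp (mirsky B)" by (simp add: supp_def)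
qed

section \<open>Hereditary closures and proximality\<close>

lemma compact_full_shift: "compact full_shift"
proof -
  have eq: "full_shift = (\<Pi>\<^sub>E j\<in>UNIV. {0, 1 :: nat})"
    by (simp add: full_shift_def PiE_UNIV_domain Pi_def)
  have "compactin (product_topology (\<lambda>_ :: int. euclidean) UNIV) (\<Pi>\<^sub>E j\<in>UNIV. {0, 1 :: nat})"
    by (subst compactin_PiE) (auto intro!: finite_imp_compact)
  then show ?thesis unfolding eq euclidean_product_topology by simp
qed

lemma X_eta_full_shift: "X_eta B \<subseteq> full_shift"
proof
  fix x assume x: "x \<in> X_eta B"
  have "x j \<in> {0, 1}" for j
  proof -
    obtain r where "\<forall>j\<in>{j}. x j = eta B (j + r)" using x finite.emptyI unfolding X_eta_iff by blast
    then show ?thesis by (simp add: eta_eq)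
  qed
  then show "x \<in> full_shift" by (simp add: full_shift_def)
qed

lemma hereditary_hull_eq:
  assumes "X \<subseteq> full_shift"
  shows "hereditary hull X = {y \<in> full_shift. \<exists>x\<in>X. y \<le> x}"
proof (rule hull_unique)
  show "X \<subseteq> {y \<in> full_shift. \<exists>x\<in>X. y \<le> x}" using assms by blast
  show "hereditary {y \<in> full_shift. \<exists>x\<in>X. y \<le> x}"
    unfolding hereditary_def by (blast intro: order_trans)
  show "{y \<in> full_shift. \<exists>x\<in>X. y \<le> x} \<subseteq> T" if "X \<subseteq> T" "hereditary T" for T
    using that unfolding hereditary_def by blast
qed

text \<open>Coordinatewise minimum maps the compact set \<open>X \<times> full_shift\<close> onto
  the hull. Closedness makes the hull Borel, so that its mass is meaningful.\<close>

lemma closed_hereditary_hull: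
  assumes "X \<subseteq> full_shift" "closed X"
  shows "closed (hereditary hull X)"
proof -
  define f where "f = (\<lambda>(x, y) (j :: int). min (x j) (y j :: nat))"
  have "compact X" using compact_full_shift assms compact_Int_closed[of full_shift X] by (simp add: Int_absorb1)
  then have "compact (X \<times> full_shift)" using compact_full_shift by (rule compact_Times)
  moreover have "continuous_on (X \<times> full_shift) f"
  proof (rule continuous_on_coordinatewise_then_product)
    fix j
    have 1: "continuous_on (X \<times> full_shift) (\<lambda>p. fst p j)"
      by (rule continuous_on_product_then_coordinatewise[OF continuous_on_fst[OF continuous_on_id]])
    have 2: "continuous_on (X \<times> full_shift) (\<lambda>p. snd p j)"
      by (rule continuous_on_product_then_coordinatewise[OF continuous_on_snd[OF continuous_on_id]])
    have "continuous_on (X \<times> full_shift) (\<lambda>p. min (fst p j) (snd p j))"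
      by (rule continuous_on_min[OF 1 2])
    then show "continuous_on (X \<times> full_shift) (\<lambda>p. f p j)" by (simp add: f_def case_prod_unfold)
  qed
  ultimately have "compact (f ` (X \<times> full_shift))" by (rule compact_continuous_image[rotated])
  moreover have "f ` (X \<times> full_shift) = hereditary hull X"
    unfolding hereditary_hull_eq[OF assms(1)]
  proof (intro equalityI subsetI)
    fix z assume "z \<in> f ` (X \<times> full_shift)"
    then obtain x y where xy: "x \<in> X" "y \<in> full_shift" "z = (\<lambda>j. min (x j) (y j))" by (auto simp: f_def)
    then have "x \<in> full_shift" using assms(1) by blast
    then have "z \<in> full_shift" using xy(2,3) unfolding full_shift_def by (auto simp: min_def)
    moreover have "z \<le> x" using xy(3) by (simp add: le_fun_def)
    ultimately show "z \<in> {y \<in> full_shift. \<exists>x\<in>X. y \<le> x}" using xy(1) by blast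
  next
    fix y assume "y \<in> {y \<in> full_shift. \<exists>x\<in>X. y \<le> x}"
    then obtain x where x: "y \<in> full_shift" "x \<in> X" "y \<le> x" by blast
    then have "f (x, y) = y" by (simp add: f_def fun_eq_iff le_fun_def min.absorb2)
    then show "y \<in> f ` (X \<times> full_shift)" using x(1,2) by (intro image_eqI[of _ _ "(x, y)"]) simp_all
  qed
  ultimately have "compactin (product_topology (\<lambda>_. euclidean) UNIV) (hereditary hull X)"
    unfolding euclidean_product_topology by simp
  moreover have "Hausdorff_space (product_topology (\<lambda>_ :: int. euclidean :: nat topology) UNIV)"
  proof -
    have "Hausdorff_space (euclidean :: nat topology)"
      unfolding Hausdorff_space_def
      by (intro allI impI exI[of _ "{_}"]) (simp add: open_nat disjnt_iff)
    then show ?thesis unfolding Hausdorff_space_product_topology by simp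
  qed
  ultimately have "closedin (product_topology (\<lambda>_. euclidean) UNIV) (hereditary hull X)"
    by (intro compactin_imp_closedin)
  then show ?thesis unfolding euclidean_product_topology by simp
qed

section \<open>Long zero blocks and erasing ones\<close>

lemma shift_by_shift_by: "shift_by a (shift_by b x) = shift_by (a + b) x"
  by (simp add: shift_by_def add.assoc)

lemma shift_by_0 [simp]: "shift_by 0 x = x"
  by (simp add: shift_by_def)

lemma shift_by_X_eta:
  assumes "x \<in> X_eta B"
  shows "shift_by k x \<in> X_eta B"
  unfolding X_eta_iff
proof (intro allI impI)
  fix W :: "int set" assume "finite W"
  then have "finite ((\<lambda>j. j + k) ` W)" by simp
  then obtain r where r: "\<forall>j\<in>(\<lambda>j. j + k) ` W. x j = eta B (j + r)" using assms unfolding X_eta_iff by blast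
  then show "\<exists>r. \<forall>j\<in>W. shift_by k x j = eta B (j + r)"
    by (intro exI[of _ "k + r"]) (simp add: shift_by_def add.assoc)
qed

lemma shift_by_X_eta_iff: "shift_by k x \<in> X_eta B \<longleftrightarrow> x \<in> X_eta B"
  using shift_by_X_eta[of x B k] shift_by_X_eta[of "shift_by k x" B "- k"] by (auto simp: shift_by_shift_by)

lemma eta_X_eta: "eta B \<in> X_eta B"
  unfolding X_eta_iff by (auto intro: exI[of _ 0])

text \<open>Distinct naturals are at distance at least 1, so a disagreement at \<open>j\<close>
  contributes its full weight \<open>(1 / 2) ^ to_nat j\<close> to the metric.\<close>

lemma dist_fun_coordinate:
  fixes x y :: "int \<Rightarrow> nat"
  assumes "dist (\<lambda>i. real (x i)) (\<lambda>i. real (y i)) < (1 / 2) ^ to_nat j"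
  shows "x j = y j"
proof (rule ccontr)
  assume ne: "x j \<noteq> y j"
  define t where "t n = (1 / 2) ^ n * min (dist (real (x (from_nat n))) (real (y (from_nat n)))) 1" for n
  have "summable t"
    unfolding t_def
    by (rule summable_comparison_test'[of "\<lambda>n. (1/2)^n"]) (auto simp: summable_geometric_iff)
  then have "sum t {to_nat j} \<le> suminf t"
    by (rule sum_le_suminf) (auto simp: t_def)
  also have "\<dots> = dist (\<lambda>i. real (x i)) (\<lambda>i. real (y i))" unfolding t_def dist_fun_def ..
  finally have "t (to_nat j) < (1 / 2) ^ to_nat j" using assms by simp
  moreover have "dist (real (x j)) (real (y j)) \<ge> 1" using ne by (auto simp: dist_real_def)
  then have "min (dist (real (x j)) (real (y j))) 1 = 1" by (rule min.absorb2)
  ultimately show False by (simp add: t_def)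
qed

text \<open>Comparing \<open>eta\<close> with its shift by 1 along a proximality sequence gives long intervals on which
  \<open>eta\<close> is constant.\<close>

lemma proximal_zero_block:
  assumes prox: "proximal (X_eta B)" and B: "b \<in> B" "b > 0"
  shows "\<exists>r. \<forall>i\<in>{0..<int m}. i + r \<notin> free_set B"
proof -
  \<comment> \<open>The constant block covers the \<open>m\<close> required positions and is long
    enough to meet a multiple of \<open>b\<close>, which forces its value to be 0.\<close>
  define M where "M = int (m + b)"
  obtain rk :: "nat \<Rightarrow> int" where lim: "(\<lambda>k. dist (shift_by (rk k) (eta B)) (shift_by (rk k) (shift_by 1 (eta B)))) \<longlonglongrightarrow> 0"
    using prox eta_X_eta[of B] shift_by_X_eta[OF eta_X_eta[of B], of 1] unfolding proximal_def by blast
  define d :: real where "d = Min ((\<lambda>i. (1 / 2) ^ to_nat i) ` {0..M})"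
  have "d > 0" unfolding d_def by (subst Min_gr_iff) (auto simp: M_def)
  then have "\<forall>\<^sub>F k in sequentially. dist (shift_by (rk k) (eta B)) (shift_by (rk k) (shift_by 1 (eta B))) < d"
    by (rule order_tendstoD(2)[OF lim])
  then obtain k where k: "dist (shift_by (rk k) (eta B)) (shift_by (rk k) (shift_by 1 (eta B))) < d"
    by (auto simp: eventually_sequentially)
  define r where "r = rk k"
  have step: "eta B (i + r) = eta B (i + 1 + r)" if i: "i \<in> {0..M}" for i
  proof -
    have "d \<le> (1 / 2) ^ to_nat i" unfolding d_def using i by (intro Min_le) auto
    then have "shift_by r (eta B) i = shift_by r (shift_by 1 (eta B)) i"
      using k unfolding r_def by (intro dist_fun_coordinate) simp
    then show ?thesis by (simp add: shift_by_def add_ac)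
  qed
  have const: "eta B (int i + r) = eta B r" if "int i \<le> M" for i
    using that
  proof (induction i)
    case (Suc i)
    then show ?case using step[of "int i"] by (simp add: add_ac)
  qed simp
  define i where "i = nat ((- r) mod int b)"
  have i: "int i = (- r) mod int b" "int i \<le> M" using B(2) pos_mod_bound[of "int b" "- r"]
    by (auto simp: i_def M_def simp del: pos_mod_bound)
  have "int b dvd int i + r" unfolding i(1) by (simp add: dvd_eq_mod_eq_0 mod_add_left_eq)
  then have "eta B (int i + r) = 0" using B(1) by (auto simp: eta_eq mem_free_set)
  then have zero: "eta B r = 0" using const[OF i(2)] by simp
  show ?thesis
  proof (intro exI[of _ r] ballI)
    fix j assume j: "j \<in> {0..<int m}"
    then have "eta B (j + r) = 0" using const[of "nat j"] zero by (simp add: M_def)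
    then show "j + r \<notin> free_set B" by (simp add: eta_eq split: if_splits)
  qed
qed

text \<open>A block of \<open>K\<close> zeros contains a position congruent to 1 modulo
  \<open>K\<close>; whatever divides it is coprime to \<open>K\<close>.\<close>

lemma zero_block_coprime:
  assumes "\<And>m. \<exists>r. \<forall>i\<in>{0..<int m}. i + r \<notin> free_set B" and K: "K > 0"
  shows "\<exists>b\<in>B. coprime b K"
proof -
  obtain r where r: "\<forall>i\<in>{0..<int K}. i + r \<notin> free_set B" using assms(1) by blast
  define i where "i = (1 - r) mod int K"
  have "i \<in> {0..<int K}" using K by (simp add: i_def)
  then have "i + r \<notin> free_set B" using r by blast
  then obtain b where b: "b \<in> B" "int b dvd i + r" unfolding mem_free_set by blast
  have "[i + r = 1] (mod int K)" unfolding i_def cong_def by (simp add: mod_add_left_eq)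
  then have "coprime (i + r) (int K)" using cong_imp_coprime cong_sym by (metis coprime_1_left)
  then have "coprime (int b) (int K)" using b(2) coprime_divisors dvd_refl by blast
  then show ?thesis using b(1) by auto
qed

text \<open>The divisor \<open>w\<close> of \<open>taut_block\<close> is now taken from
  \<open>B\<close>, which makes position \<open>p\<close> a zero while the rest of the block
  persists.\<close>

lemma taut_pattern_occurs:
  assumes taut: "taut B" and B: "B \<noteq> {}" and cop: "\<And>K. K > 0 \<Longrightarrow> \<exists>b\<in>B. coprime b K"
    and J: "finite J" "J \<subseteq> free_set B" and Z: "finite Z" "Z \<inter> free_set B = {}" and p: "p \<notin> J"
  shows "\<exists>n. \<exists>b\<in>B. int b dvd n + p \<and> (\<forall>j\<in>J. n + j \<in> free_set B) \<and> (\<forall>q\<in>Z. n + q \<notin> free_set B)"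
proof -
  have B0: "0 \<notin> B" using taut by (simp add: taut_def)
  from taut_block[OF assms(1,2) J Z p]
  obtain X where X: "X > 0" "\<forall>w>0. coprime w X \<longrightarrow> (\<exists>L r. L > 0 \<and> w dvd L \<and> int w dvd r + p \<and>
      (\<forall>q\<in>Z. \<exists>b\<in>B. b dvd L \<and> int b dvd r + q) \<and>
      Pr (Dvd L (- r) \<inter> all_free B J) > 0)"
    by (elim exE conjE)
  obtain b where b: "b \<in> B" "coprime b X" using cop[OF X(1)] by blast
  have "b > 0" using b(1) B0 by (metis gr0I)
  from X(2)[rule_format, OF this b(2)]
  obtain L r where Lr: "L > 0" "b dvd L" "int b dvd r + p" "\<forall>q\<in>Z. \<exists>b\<in>B. b dvd L \<and> int b dvd r + q"
    "Pr (Dvd L (- r) \<inter> all_free B J) > 0"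
    by (elim exE conjE)
  from positive_prob_imp_infinite[OF B0 Lr(1) J(1) Lr(5), of 0]
  obtain n where n: "int L dvd n - r" "\<forall>j\<in>J. n + j \<in> free_set B" by blast
  have shift: "int c dvd n + q" if "c dvd L" "int c dvd r + q" for c q
  proof -
    have "int c dvd n - r" using n(1) that(1) by (meson dvd_trans int_dvd_int_iff)
    then have "int c dvd (n - r) + (r + q)" using that(2) by (rule dvd_add)
    then show ?thesis by simp
  qed
  have "n + q \<notin> free_set B" if "q \<in> Z" for q
    using Lr(4) that shift unfolding mem_free_set by blast
  then show ?thesis using b(1) shift[OF Lr(2,3)] n(2) by blast
qed

text \<open>Each step creates one more zero and hands those already obtained to
  \<open>taut_pattern_occurs\<close> as \<open>Z\<close>.\<close>

lemma taut_remove_ones: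
  assumes taut: "taut B" and B: "B \<noteq> {}" and cop: "\<And>K. K > 0 \<Longrightarrow> \<exists>b\<in>B. coprime b K"
    and J: "finite J" "J \<subseteq> free_set B" and P: "finite P" "J \<inter> P = {}"
  shows "\<exists>n. (\<forall>j\<in>J. n + j \<in> free_set B) \<and> (\<forall>q\<in>P. n + q \<notin> free_set B)"
  using P
proof (induction P rule: finite_induct)
  case empty
  then show ?case using J(2) by (intro exI[of _ 0]) auto
next
  case (insert p P)
  then obtain n where n: "\<forall>j\<in>J. n + j \<in> free_set B" "\<forall>q\<in>P. n + q \<notin> free_set B" by auto
  have "\<exists>m. \<exists>b\<in>B. int b dvd m + (n + p) \<and> (\<forall>j\<in>(+) n ` J. m + j \<in> free_set B) \<and> (\<forall>q\<in>(+) n ` P. m + q \<notin> free_set B)"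
    by (rule taut_pattern_occurs[OF taut B cop]) (use n J insert in auto)
  then obtain m b where m: "b \<in> B" "int b dvd m + (n + p)" "\<forall>j\<in>J. m + (n + j) \<in> free_set B" "\<forall>q\<in>P. m + (n + q) \<notin> free_set B"
    by auto
  have "m + (n + p) \<notin> free_set B" using m(1,2) unfolding mem_free_set by blast
  then show ?case using m(3,4) by (intro exI[of _ "m + n"]) (simp add: add.assoc)
qed

lemma taut_hereditary:
  assumes taut: "taut B" and B: "B \<noteq> {}" and cop: "\<And>K. K > 0 \<Longrightarrow> \<exists>b\<in>B. coprime b K"
  shows "hereditary (X_eta B)"
  unfolding hereditary_def
proof (intro ballI impI)
  fix x y assume x: "x \<in> X_eta B" and y: "y \<in> full_shift" "y \<le> x"
  show "y \<in> X_eta B"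
    unfolding X_eta_iff
  proof (intro allI impI)
    fix W :: "int set" assume W: "finite W"
    then obtain r where r: "\<forall>j\<in>W. x j = eta B (j + r)" using x unfolding X_eta_iff by blast
    have y01: "y j = 0 \<or> y j = 1" for j using y(1) by (auto simp: full_shift_def)
    define J where "J = (\<lambda>j. j + r) ` {j\<in>W. y j = 1}"
    define P where "P = (\<lambda>j. j + r) ` {j\<in>W. y j = 0}"
    have "j + r \<in> free_set B" if "j \<in> W" "y j = 1" for j
    proof -
      have "1 \<le> x j" using le_funD[OF y(2), of j] that(2) by simp
      then show ?thesis using r that(1) by (auto simp: eta_eq split: if_splits)
    qed
    then have "J \<subseteq> free_set B" unfolding J_def by blast
    then have "\<exists>n. (\<forall>j\<in>J. n + j \<in> free_set B) \<and> (\<forall>q\<in>P. n + q \<notin> free_set B)"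
      by (intro taut_remove_ones[OF taut B cop]) (use W in \<open>auto simp: J_def P_def\<close>)
    then obtain n where n: "\<forall>j\<in>J. n + j \<in> free_set B" "\<forall>q\<in>P. n + q \<notin> free_set B" by blast
    have "y j = eta B (j + (r + n))" if "j \<in> W" for j
    proof (cases "y j = 1")
      case True
      then have "n + (j + r) \<in> free_set B" using n(1) that by (auto simp: J_def)
      then show ?thesis using True by (simp add: eta_eq add_ac)
    next
      case False
      then have "y j = 0" using y01 by blast
      moreover from this have "n + (j + r) \<notin> free_set B" using n(2) that by (auto simp: P_def)
      ultimately show ?thesis by (simp add: eta_eq add_ac)
    qed
    then show "\<exists>r. \<forall>j\<in>W. y j = eta B (j + r)" by blast
  qed
qed

section \<open>Automorphisms\<close>

text \<open>The image of the Mirsky measure under \<open>\<tau>\<close> is invariant on the hereditary closure of \<open>X_eta B\<close>,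
  hence lives on \<open>X_eta B'\<close>.\<close>

lemma companion_image_subset:
  assumes B: "0 \<notin> B" and comp: "taut_companion B B'" and her: "hereditary (X_eta B')"
    and cont: "continuous_on (X_eta B) \<tau>" and im: "\<tau> ` X_eta B \<subseteq> X_eta B"
    and comm: "\<forall>x\<in>X_eta B. \<tau> (shift_by 1 x) = shift_by 1 (\<tau> x)"
  shows "\<tau> ` X_eta B' \<subseteq> X_eta B'"
proof -
  define X where "X = X_eta B"
  define X' where "X' = X_eta B'"
  define \<nu> where "\<nu> = mirsky B"
  \<comment> \<open>The identity outside the closed, shift-invariant set \<open>X\<close> keeps
    \<open>f\<close> Borel and commuting with the shift everywhere.\<close>
  define f where "f x = (if x \<in> X then \<tau> x else x)" for x
  have taut: "taut B'" and \<nu>': "\<nu> = mirsky B'"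
    and inv: "invariant_measures (hereditary hull X) = invariant_measures (hereditary hull X')"
    using comp by (simp_all add: taut_companion_def \<nu>_def X_def X'_def)
  have clX: "closed X" "closed X'" by (simp_all add: X_def X'_def closed_X_eta)
  have sets\<nu>: "sets \<nu> = sets borel" "space \<nu> = UNIV" by (simp_all add: \<nu>_def)
  interpret \<nu>: prob_space \<nu> unfolding \<nu>_def by (rule prob_space_mirsky[OF B])
  have "\<tau> \<in> borel_measurable (restrict_space borel X)"
    using cont unfolding X_def by (rule borel_measurable_continuous_on_restrict)
  then have "(\<lambda>x. if x \<in> X then \<tau> x else eta B) \<in> borel_measurable borel"
    using clX by (subst measurable_restrict_space_iff[symmetric]) auto
  then have "(\<lambda>x. if x \<in> X then (if x \<in> X then \<tau> x else eta B) else x) \<in> borel_measurable borel"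
    by (rule measurable_If_set) (use clX in auto)
  then have "f \<in> borel_measurable borel"
    unfolding f_def by (rule measurable_cong[THEN iffD1, rotated]) simp
  then have f\<nu>: "f \<in> borel_measurable \<nu>" using sets\<nu> by (simp cong: measurable_cong_sets)
  have shift\<nu>: "shift_by 1 \<in> borel_measurable \<nu>"
    using sets\<nu> shift_by_measurable[of 1] by (simp cong: measurable_cong_sets)
  define \<mu> where "\<mu> = distr \<nu> borel f"
  have \<mu>: "sets \<mu> = sets borel" "prob_space \<mu>"
    unfolding \<mu>_def using \<nu>.prob_space_distr[OF f\<nu>] by simp_all
  interpret \<mu>: prob_space \<mu> by fact
  have comm': "shift_by 1 \<circ> f = f \<circ> shift_by 1"
  proof
    fix x show "(shift_by 1 \<circ> f) x = (f \<circ> shift_by 1) x"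
      using comm shift_by_X_eta_iff[of 1 x B] by (simp add: f_def X_def)
  qed
  have "distr \<mu> borel (shift_by 1) = distr \<nu> borel (f \<circ> shift_by 1)"
    unfolding \<mu>_def by (simp add: distr_distr[OF shift_by_measurable f\<nu>] comm')
  also have "\<dots> = distr (distr \<nu> borel (shift_by 1)) borel f"
    by (rule distr_distr[symmetric, OF \<open>f \<in> borel_measurable borel\<close> shift\<nu>])
  also have "\<dots> = \<mu>" unfolding \<mu>_def \<nu>_def distr_mirsky_shift[OF B] ..
  finally have "distr \<mu> borel (shift_by 1) = \<mu>" .
  moreover have "emeasure \<mu> (hereditary hull X) = 1"
  proof -
    have cl: "closed (hereditary hull X)"
      unfolding X_def by (intro closed_hereditary_hull X_eta_full_shift closed_X_eta)
    have "X \<subseteq> f -` (hereditary hull X) \<inter> space \<nu>"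
    proof
      fix x assume x: "x \<in> X"
      then have "f x \<in> X" using im unfolding f_def X_def by auto
      then have "f x \<in> hereditary hull X" by (rule hull_inc)
      then show "x \<in> f -` (hereditary hull X) \<inter> space \<nu>" by (simp add: sets\<nu>)
    qed
    moreover have "f -` (hereditary hull X) \<inter> space \<nu> \<in> sets \<nu>"
      using measurable_sets[OF f\<nu>] cl by simp
    ultimately have "emeasure \<nu> X \<le> emeasure \<nu> (f -` (hereditary hull X) \<inter> space \<nu>)"
      by (rule emeasure_mono)
    also have "\<dots> = emeasure \<mu> (hereditary hull X)"
      unfolding \<mu>_def using cl by (subst emeasure_distr[OF f\<nu>]) auto
    finally show ?thesis
      using mirsky_X_eta[OF B] \<mu>.emeasure_le_1[of "hereditary hull X"] unfolding \<nu>_def X_def by simp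
  qed
  ultimately have "\<mu> \<in> invariant_measures (hereditary hull X)"
    using \<mu> unfolding invariant_measures_def by simp
  \<comment> \<open>Being hereditary, \<open>X'\<close> is its own hereditary closure.\<close>
  then have "\<mu> \<in> invariant_measures X'"
    unfolding inv using her by (simp add: hull_same X'_def)
  then have "emeasure \<mu> X' = 1" unfolding invariant_measures_def by simp
  then have "\<mu>.prob X' = 1" by (simp add: measure_def)
  then have "\<mu>.prob (- X') = 0"
    using \<mu>.prob_compl[of X'] clX(2) by (simp add: \<mu>(1) \<mu>_def Compl_eq_Diff_UNIV)
  then have "emeasure \<mu> (- X') = 0" by (simp add: \<mu>.emeasure_eq_measure)
  then have null: "emeasure \<nu> (f -` (- X') \<inter> space \<nu>) = 0"
    unfolding \<mu>_def using clX(2) by (subst (asm) emeasure_distr[OF f\<nu>]) auto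
  have "emeasure \<nu> X = 1" using mirsky_X_eta[OF B] by (simp add: \<nu>_def X_def)
  then have "\<nu>.prob X = 1" by (simp add: measure_def)
  then have "\<nu>.prob (- X) = 0"
    using \<nu>.prob_compl[of X] clX(1) by (simp add: sets\<nu> Compl_eq_Diff_UNIV)
  then have nullX: "emeasure \<nu> (- X) = 0" by (simp add: \<nu>.emeasure_eq_measure)
  have sub: "X' \<subseteq> supp \<nu>" unfolding \<nu>' X'_def by (rule taut_X_eta_subset_supp[OF taut])
  have "\<tau> x \<in> X'" if x: "x \<in> X'" for x
  \<comment> \<open>If \<open>\<tau>\<close> moved \<open>x\<close> out of \<open>X'\<close>, it
    would do so on a neighbourhood of \<open>x\<close> in \<open>X\<close>. That has positive mass
    because \<open>x\<close> lies in the support, yet almost every point is sent into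
    \<open>X'\<close>.\<close>
  proof (rule ccontr)
    assume "\<tau> x \<notin> X'"
    have xX: "x \<in> X" using x sub supp_mirsky_subset[OF B] unfolding \<nu>_def X_def by blast
    obtain V where V: "open V" "V \<inter> X = \<tau> -` (- X') \<inter> X"
      using cont clX(2) unfolding continuous_on_open_invariant X_def by (metis open_Compl)
    have "x \<in> V" using V(2) xX \<open>\<tau> x \<notin> X'\<close> by blast
    then have "emeasure \<nu> V > 0" using V(1) x sub unfolding supp_def by blast
    moreover have "V \<subseteq> (f -` (- X') \<inter> space \<nu>) \<union> - X"
      using V(2) by (auto simp: f_def sets\<nu>)
    then have "emeasure \<nu> V \<le> emeasure \<nu> ((f -` (- X') \<inter> space \<nu>) \<union> - X)"
      using measurable_sets[OF f\<nu>, of "- X'"] clX by (intro emeasure_mono) (auto simp: sets\<nu>)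
    then have "emeasure \<nu> V \<le> emeasure \<nu> (f -` (- X') \<inter> space \<nu>) + emeasure \<nu> (- X)"
      using measurable_sets[OF f\<nu>, of "- X'"] clX
      by (intro order_trans[OF _ emeasure_subadditive]) (auto simp: sets\<nu>)
    ultimately show False using null nullX by simp
  qed
  then show ?thesis unfolding X'_def by blast
qed

text \<open>Naturals are discrete, so the value at 0 is locally constant. This is the one-point form
  of a sliding block code, with a window depending on \<open>x\<close>.\<close>

lemma continuous_on_window:
  fixes f :: "(int \<Rightarrow> nat) \<Rightarrow> int \<Rightarrow> nat"
  assumes "continuous_on X f" "x \<in> X"
  shows "\<exists>W. finite W \<and> (\<forall>y\<in>X. (\<forall>j\<in>W. y j = x j) \<longrightarrow> f y 0 = f x 0)"
proof -
  have "open {y :: int \<Rightarrow> nat. \<forall>j\<in>{0}. y j = f x j}" by (rule open_window) simp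
  from assms(1)[unfolded continuous_on_open_invariant, rule_format, OF this]
  obtain A where A: "open A" "A \<inter> X = f -` {y. \<forall>j\<in>{0}. y j = f x j} \<inter> X"
    by (elim exE conjE)
  have "x \<in> A" using A(2) assms(2) by auto
  then obtain W where W: "finite W" "window W x \<subseteq> A" by (rule open_contains_window[OF A(1)])
  have "f y 0 = f x 0" if "y \<in> X" "\<forall>j\<in>W. y j = x j" for y
  proof -
    have "y \<in> A \<inter> X" using that W(2) by blast
    then show ?thesis unfolding A(2) by simp
  qed
  with W(1) show ?thesis by (intro exI[of _ W]) simp
qed

lemma shift_commute_int:
  assumes "\<And>x. x \<in> X_eta B \<Longrightarrow> f (shift_by 1 x) = shift_by 1 (f x)" "x \<in> X_eta B"
  shows "f (shift_by k x) = shift_by k (f x)"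
  using assms(2)
proof (induction k arbitrary: x rule: int_induct[of _ 0])
  case (step1 k)
  have "f (shift_by (k + 1) x) = f (shift_by 1 (shift_by k x))" by (simp add: shift_by_shift_by add.commute)
  also have "\<dots> = shift_by 1 (f (shift_by k x))" using assms(1) shift_by_X_eta[OF step1.prems] by blast
  also have "\<dots> = shift_by (k + 1) (f x)" using step1.IH[OF step1.prems] by (simp add: shift_by_shift_by add.commute)
  finally show ?case .
next
  case (step2 k)
  have "shift_by k (f x) = f (shift_by 1 (shift_by (k - 1) x))"
    using step2.IH[OF step2.prems] by (simp add: shift_by_shift_by)
  also have "\<dots> = shift_by 1 (f (shift_by (k - 1) x))" using assms(1) shift_by_X_eta[OF step2.prems] by blast
  finally have "shift_by (- 1) (shift_by k (f x)) = shift_by (- 1) (shift_by 1 (f (shift_by (k - 1) x)))" by simp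
  then show ?case by (simp add: shift_by_shift_by)
qed simp

definition unit_point :: "int \<Rightarrow> nat" where
  "unit_point j = (if j = 0 then 1 else 0)"

text \<open>If \<open>f x\<close> had a 1 where \<open>x\<close> has a 0, then by locality of \<open>f\<close> one could place a copy of a window
  of \<open>x\<close> at a multiple of some \<open>b \<in> B\<close> and isolated ones at all other residues modulo \<open>b\<close>; the image
  of this point would have ones in every residue class.\<close>

lemma taut_endomorphism_le:
  assumes taut: "taut B" and B: "B \<noteq> {}" and cop: "\<And>K. K > 0 \<Longrightarrow> \<exists>b\<in>B. coprime b K"
    and her: "hereditary (X_eta B)" and cont: "continuous_on (X_eta B) f"
    and im: "\<And>x. x \<in> X_eta B \<Longrightarrow> f x \<in> X_eta B"
    and comm: "\<And>x k. x \<in> X_eta B \<Longrightarrow> f (shift_by k x) = shift_by k (f x)"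
    and unit: "unit_point \<in> X_eta B" "f unit_point 0 = 1"
    and x: "x \<in> X_eta B"
  shows "f x \<le> x"
proof (rule ccontr)
  have B0: "0 \<notin> B" using taut by (simp add: taut_def)
  have bin: "y j = 0 \<or> y j = 1" if "y \<in> X_eta B" for y j
    using that X_eta_full_shift[of B] by (auto simp: full_shift_def)
  assume "\<not> f x \<le> x"
  then obtain s where s: "x s < f x s" by (auto simp: le_fun_def not_le)
  define z where "z = shift_by s x"
  have z: "z \<in> X_eta B" "f z 0 = 1" "z 0 = 0"
    using s bin[OF x, of s] bin[OF im[OF x], of s] comm[OF x, of s] shift_by_X_eta[OF x, of s]
    by (auto simp: z_def shift_by_def)
  obtain W1 where W1: "finite W1" "\<forall>y\<in>X_eta B. (\<forall>j\<in>W1. y j = z j) \<longrightarrow> f y 0 = f z 0"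
    using continuous_on_window[OF cont z(1)] by (elim exE conjE)
  obtain W2 where W2: "finite W2" "\<forall>y\<in>X_eta B. (\<forall>j\<in>W2. y j = unit_point j) \<longrightarrow> f y 0 = f unit_point 0"
    using continuous_on_window[OF cont unit(1)] by (elim exE conjE)
  \<comment> \<open>A common radius: copies more than \<open>2 * m\<close> apart do not enter each
    other's windows.\<close>
  define m where "m = Max (insert 0 (abs ` (W1 \<union> W2)))"
  have mW: "\<bar>j\<bar> \<le> m" if "j \<in> W1 \<union> W2" for j
    unfolding m_def using that W1(1) W2(1) by (intro Max_ge) auto
  have m0: "m \<ge> 0" unfolding m_def using W1(1) W2(1) by (intro Max_ge) auto
  obtain r where r: "\<forall>j\<in>{-m..m}. z j = eta B (j + r)" using z(1) unfolding X_eta_iff by blast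
  define D where "D = {j\<in>{-m..m}. z j = 1}"
  have Dfin: "finite D" unfolding D_def by (rule finite_subset[of _ "{-m..m}"]) auto
  have Dfree: "j + r \<in> free_set B" if "j \<in> D" for j
    using that r by (auto simp: D_def eta_eq split: if_splits)
  \<comment> \<open>The zero of \<open>z\<close> at 0 sits at \<open>r\<close>, outside the ones of
    the window, so it can be made a multiple of some \<open>b\<close> without losing those
    ones.\<close>
  have "\<exists>n. \<exists>b\<in>B. int b dvd n + r \<and> (\<forall>j\<in>(\<lambda>j. j + r) ` D. n + j \<in> free_set B) \<and> (\<forall>q\<in>{}. n + q \<notin> free_set B)"
  proof (rule taut_pattern_occurs[OF taut B cop])
    show "finite ((\<lambda>j. j + r) ` D)" using Dfin by simp
    show "r \<notin> (\<lambda>j. j + r) ` D" using z(3) by (auto simp: D_def)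
  qed (use Dfree in auto)
  then obtain n b where nb: "b \<in> B" "int b dvd n + r" "\<forall>j\<in>D. n + (j + r) \<in> free_set B" by auto
  define N where "N = n + r"
  have bpos: "b > 0" using nb(1) B0 by (metis gr0I)
  \<comment> \<open>\<open>v\<close> is the position of copy \<open>c\<close>. Copy 0 is the window
    of \<open>z\<close>, at the multiple \<open>N\<close> of \<open>b\<close>; for
    \<open>0 < c < b\<close> copy \<open>c\<close> is an isolated one in the class of
    \<open>c\<close>. Later indices only continue the recursion.\<close>
  define P where "P c v \<longleftrightarrow> (c = 0 \<longrightarrow> v = N) \<and> (\<not> b dvd c \<longrightarrow> [v = int c] (mod int b) \<and> v \<in> free_set B)" for c v
  define Q where "Q c v v' \<longleftrightarrow> v + 2 * m < v'" for c :: nat and v v' :: int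
  have "\<exists>g. \<forall>c. P c (g c) \<and> Q c (g c) (g (Suc c))"
  proof (rule dependent_nat_choice)
    show "\<exists>v. P 0 v" by (auto simp: P_def)
    fix v c assume "P c v"
    show "\<exists>v'. P (Suc c) v' \<and> Q c v v'"
    proof (cases "b dvd Suc c")
      case True
      then show ?thesis by (intro exI[of _ "v + 2 * m + 1"]) (simp add: P_def Q_def)
    next
      case False
      then have "\<not> int b dvd int (Suc c)" by (simp only: int_dvd_int_iff not_False_eq_True)
      from taut_residue_class[OF taut nb(1) this, of "v + 2 * m"] show ?thesis
        by (auto simp: P_def Q_def)
    qed
  qed
  then obtain g where g: "\<And>c. P c (g c)" "\<And>c. g c + 2 * m < g (Suc c)" unfolding Q_def by blast
  have sep: "g c + 2 * m < g c'" if "c < c'" for c c'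
    using that
  proof (induction c' rule: less_Suc_induct)
    case (1 i) then show ?case by (rule g(2))
  next
    case (2 i j k) then show ?case using m0 by simp
  qed
  have g0: "g 0 = N" using g(1)[of 0] by (simp add: P_def)
  have gmod: "[g c = int c] (mod int b)" if "c < b" for c
  proof (cases "c = 0")
    case True
    then show ?thesis using nb(2) by (simp add: g0 N_def cong_0_iff)
  next
    case False
    then have "\<not> b dvd c" using that by (auto dest: dvd_imp_le)
    then show ?thesis using g(1)[of c] by (simp add: P_def)
  qed
  have gfree: "g c \<in> free_set B" if "0 < c" "c < b" for c
    using that g(1)[of c] by (auto simp: P_def dest: dvd_imp_le)
  define S where "S = (\<lambda>j. N + j) ` D \<union> g ` {0<..<b}"
  define y :: "int \<Rightarrow> nat" where "y = indicator S"
  have Sfree: "S \<subseteq> free_set B"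
    using nb(3) gfree by (auto simp: S_def N_def add_ac)
  have "y \<le> eta B" unfolding le_fun_def y_def eta_def using Sfree by (auto simp: indicator_def)
  moreover have "y \<in> full_shift" by (auto simp: full_shift_def y_def indicator_def)
  ultimately have y: "y \<in> X_eta B" using her eta_X_eta[of B] unfolding hereditary_def by blast
  have one: "f y (g c) = 1" if c: "c < b" for c
  proof -
    have sh: "shift_by (g c) y \<in> X_eta B" by (rule shift_by_X_eta[OF y])
    have "f (shift_by (g c) y) 0 = 1"
    proof (cases "c = 0")
      case True
      have "shift_by (g c) y j = z j" if j: "j \<in> W1" for j
      proof -
        have jm: "- m \<le> j" "j \<le> m" using mW[of j] j by auto
        have "j + N \<noteq> g c'" if "c' \<in> {0<..<b}" for c'
          using sep[of 0 c'] that jm m0 by (auto simp: g0)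
        then have "j + N \<notin> g ` {0<..<b}" by blast
        then have "j + N \<in> S \<longleftrightarrow> j \<in> D" by (auto simp: S_def)
        then show ?thesis using bin[OF z(1), of j] jm
          by (auto simp: True g0 shift_by_def y_def D_def indicator_def)
      qed
      then show ?thesis using W1(2)[rule_format, OF sh] z(2) by simp
    next
      case False
      have "shift_by (g c) y j = unit_point j" if j: "j \<in> W2" for j
      proof -
        have jm: "- m \<le> j" "j \<le> m" using mW[of j] j by auto
        have "j + g c \<notin> (\<lambda>j. N + j) ` D" using sep[of 0 c] jm m0 False by (auto simp: g0 D_def)
        moreover have "c' = c" if "j + g c = g c'" for c'
          using that sep[of c c'] sep[of c' c] jm m0 by (cases c c' rule: linorder_cases) auto
        ultimately have "j + g c \<in> S \<longleftrightarrow> j = 0" using False c by (auto simp: S_def)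
        then show ?thesis by (simp add: shift_by_def y_def unit_point_def indicator_def)
      qed
      then show ?thesis using W2(2)[rule_format, OF sh] unit(2) by simp
    qed
    then show ?thesis using comm[OF y, of "g c"] by (simp add: shift_by_def)
  qed
  have "finite (g ` {..<b})" by simp
  then obtain k where k: "\<forall>j\<in>g ` {..<b}. f y j = eta B (j + k)" using im[OF y] unfolding X_eta_iff by blast
  \<comment> \<open>On these positions \<open>f y\<close> is a translate of \<open>eta B\<close> by
    \<open>k\<close>; the copy in the class of \<open>- k\<close> lands on a multiple of
    \<open>b\<close>.\<close>
  define c where "c = nat ((- k) mod int b)"
  have c: "int c = (- k) mod int b" "c < b" using bpos by (simp_all add: c_def nat_less_iff)
  have "[g c + k = - k + k] (mod int b)"
    using gmod[OF c(2)] unfolding c(1) by (intro cong_add) (simp_all add: cong_def)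
  then have "int b dvd g c + k" by (simp add: cong_0_iff)
  then have "eta B (g c + k) = 0" using nb(1) by (auto simp: eta_eq mem_free_set)
  moreover have "f y (g c) = eta B (g c + k)" using k c(2) by simp
  ultimately show False using one[OF c(2)] by simp
qed

section \<open>Degenerate cases and inverse automorphisms\<close>

lemma prob_Free_eq_mirsky:
  assumes "0 \<notin> B"
  shows "emeasure (mirsky B) {x. x 0 = 1} = ennreal (Pr (Free B 0))"
proof -
  have "open {y :: int \<Rightarrow> nat. \<forall>j\<in>{0}. y j = 1}" using open_window[of "{0}" "\<lambda>_. 1"] by simp
  then have "{x :: int \<Rightarrow> nat. x 0 = 1} \<in> sets borel" by simp
  then show ?thesis by (subst emeasure_mirsky[OF assms]) (simp_all add: random_eta_def)
qed

lemma prob_Free_less_1: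
  assumes "0 \<notin> B" "b \<in> B"
  shows "Pr (Free B 0) < 1"
proof -
  have b: "b > 0" using assms by (metis gr0I)
  have "Pr (Free B 0) \<le> Pr (UNIV - Dvd b 0)"
    using assms(2) by (intro unif.finite_measure_mono) (auto simp: Free_def)
  also have "\<dots> = 1 - 1 / b"
    using unif.prob_compl[of "Dvd b 0"] prob_Dvd[OF b, of 0] by simp
  also have "\<dots> < 1" using b by simp
  finally show ?thesis .
qed

text \<open>Coordinate 0 is almost surely 1 exactly for the empty set, and the two Mirsky measures
  coincide.\<close>

lemma taut_companion_empty_iff:
  assumes "0 \<notin> B" "taut_companion B B'"
  shows "B = {} \<longleftrightarrow> B' = {}"
proof -
  have B': "0 \<notin> B'" using assms(2) by (simp add: taut_companion_def taut_def)
  have "ennreal (Pr (Free B 0)) = ennreal (Pr (Free B' 0))"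
    using assms(2) unfolding prob_Free_eq_mirsky[OF assms(1), symmetric] prob_Free_eq_mirsky[OF B', symmetric]
    by (simp add: taut_companion_def)
  then have "Pr (Free B 0) = Pr (Free B' 0)" by simp
  then show ?thesis using prob_Free_less_1[OF assms(1)] prob_Free_less_1[OF B'] by fastforce
qed

lemma Aut_inverse:
  assumes "\<tau> \<in> Aut X" and sh: "\<And>x. x \<in> X \<Longrightarrow> shift_by 1 x \<in> X"
  shows "\<exists>\<sigma>\<in>Aut X. \<forall>x\<in>X. \<sigma> (\<tau> x) = x \<and> \<tau> (\<sigma> x) = x"
proof -
  obtain \<sigma> where h: "homeomorphism X X \<tau> \<sigma>" and comm: "\<forall>x\<in>X. \<tau> (shift_by 1 x) = shift_by 1 (\<tau> x)"
    using assms(1) unfolding Aut_def by (elim CollectE conjE exE)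
  have inv: "\<sigma> (\<tau> x) = x" "\<tau> (\<sigma> x) = x" "\<sigma> x \<in> X" if "x \<in> X" for x
    using h that by (auto simp: homeomorphism_def)
  have "\<sigma> \<in> Aut X"
    unfolding Aut_def
  proof (intro CollectI conjI exI ballI)
    show "homeomorphism X X \<sigma> \<tau>" using h by (rule homeomorphism_symD)
    fix y assume y: "y \<in> X"
    have "\<sigma> (shift_by 1 y) = \<sigma> (shift_by 1 (\<tau> (\<sigma> y)))" using inv[OF y] by simp
    also have "\<dots> = \<sigma> (\<tau> (shift_by 1 (\<sigma> y)))" using comm inv(3)[OF y] by simp
    also have "\<dots> = shift_by 1 (\<sigma> y)" using sh[OF inv(3)[OF y]] by (rule inv(1))
    finally show "\<sigma> (shift_by 1 y) = shift_by 1 (\<sigma> y)" .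
  qed
  with inv show ?thesis by blast
qed

lemma AutD:
  assumes "\<tau> \<in> Aut (X_eta B)"
  shows "continuous_on (X_eta B) \<tau>" "\<tau> ` X_eta B = X_eta B"
    "\<forall>x\<in>X_eta B. \<tau> (shift_by 1 x) = shift_by 1 (\<tau> x)"
    "\<And>x k. x \<in> X_eta B \<Longrightarrow> \<tau> (shift_by k x) = shift_by k (\<tau> x)"
proof -
  show "continuous_on (X_eta B) \<tau>" "\<tau> ` X_eta B = X_eta B"
    and *: "\<forall>x\<in>X_eta B. \<tau> (shift_by 1 x) = shift_by 1 (\<tau> x)"
    using assms by (auto simp: Aut_def homeomorphism_def)
  show "\<And>x k. x \<in> X_eta B \<Longrightarrow> \<tau> (shift_by k x) = shift_by k (\<tau> x)"
    using shift_commute_int[of B \<tau>] * by blast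
qed

lemma unit_point_X_eta:
  assumes "hereditary (X_eta B)" "1 \<notin> B"
  shows "unit_point \<in> X_eta B"
proof -
  have "1 \<in> free_set B" using assms(2) by (auto simp: mem_free_set)
  then have "unit_point \<le> shift_by 1 (eta B)"
    by (auto simp: le_fun_def unit_point_def shift_by_def eta_eq)
  moreover have "unit_point \<in> full_shift" by (simp add: full_shift_def unit_point_def)
  ultimately show ?thesis
    using assms(1) shift_by_X_eta[OF eta_X_eta[of B]] unfolding hereditary_def by blast
qed

text \<open>A fixed point is constant, and any \<open>b\<close> consecutive entries of
  \<open>eta B\<close> include a zero.\<close>

lemma shift_fixed_eq_zero:
  assumes b: "b \<in> B" "b > 0" and x: "x \<in> X_eta B" and fixed: "\<And>k. shift_by k x = x"
  shows "x = (\<lambda>_. 0)"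
proof -
  have const: "x k = x 0" for k using fun_cong[OF fixed[of k], of 0] by (simp add: shift_by_def)
  obtain r where r: "\<forall>j\<in>{0..<int b}. x j = eta B (j + r)" using x unfolding X_eta_iff by blast
  define j where "j = (- r) mod int b"
  have j: "j \<in> {0..<int b}" using b(2) by (simp add: j_def)
  have "int b dvd j + r" by (simp add: j_def dvd_eq_mod_eq_0 mod_add_left_eq)
  then have "x j = 0" using r j b(1) by (auto simp: eta_eq mem_free_set)
  then show ?thesis using const by (metis ext)
qed

theorem corollary7p1:
  fixes B B' :: "nat set" and \<tau> :: "(int \<Rightarrow> nat) \<Rightarrow> (int \<Rightarrow> nat)"
  assumes "0 \<notin> B" and "primitive B" and "B \<noteq> {1}"
    and "proximal (X_eta B)"
    and "taut_companion B B'"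
    and "\<tau> \<in> Aut (X_eta B)"
  shows "X_eta B' = supp (mirsky B) \<and> supp (mirsky B) = supp (mirsky B') \<and>
    \<tau> ` X_eta B' = X_eta B' \<and>
    (\<exists>k :: int. \<forall>x\<in>X_eta B'. \<tau> x = shift_by k x)"
proof -
  note comp = assms(5)
  have taut: "taut B'" and eta_le: "eta B' \<le> eta B" and mir: "mirsky B = mirsky B'"
    using comp by (simp_all add: taut_companion_def)
  have B'0: "0 \<notin> B'" using taut by (simp add: taut_def)
  have supp: "X_eta B' = supp (mirsky B')"
    using taut_X_eta_subset_supp[OF taut] supp_mirsky_subset[OF B'0] by (rule equalityI)
  have sub: "X_eta B' \<subseteq> X_eta B"
    using supp_mirsky_subset[OF assms(1)] unfolding mir supp by simp
  have sh: "\<And>x. x \<in> X_eta B \<Longrightarrow> shift_by 1 x \<in> X_eta B" by (rule shift_by_X_eta)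
  obtain \<sigma> where \<sigma>: "\<sigma> \<in> Aut (X_eta B)" "\<And>x. x \<in> X_eta B \<Longrightarrow> \<sigma> (\<tau> x) = x" "\<And>x. x \<in> X_eta B \<Longrightarrow> \<tau> (\<sigma> x) = x"
    using Aut_inverse[OF assms(6) sh] by blast
  note T = AutD[OF assms(6)] and S = AutD[OF \<sigma>(1)]
  have main: "\<tau> ` X_eta B' = X_eta B' \<and> (\<exists>k. \<forall>x\<in>X_eta B'. \<tau> x = shift_by k x)"
  proof (cases "B = {}")
    case True
    then have "B' = {}" using taut_companion_empty_iff[OF assms(1) comp] by simp
    \<comment> \<open>Without divisors every integer is free, so the subshift is a single
      point.\<close>
    have one: "x = (\<lambda>_. 1)" if x: "x \<in> X_eta B" for x
    proof
      fix j
      obtain r where "\<forall>i\<in>{j}. x i = eta B (i + r)" using x finite.emptyI finite_insert unfolding X_eta_iff by metis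
      then show "x j = 1" using True by (simp add: eta_eq mem_free_set)
    qed
    have "\<tau> x = shift_by 0 x" if "x \<in> X_eta B'" for x
    proof -
      have "x \<in> X_eta B" "\<tau> x \<in> X_eta B" using that sub T(2) by blast+
      then have "x = (\<lambda>_. 1)" "\<tau> x = (\<lambda>_. 1)" using one by blast+
      then show ?thesis by simp
    qed
    moreover have "\<tau> ` X_eta B' = X_eta B'" using T(2) unfolding True \<open>B' = {}\<close> .
    ultimately show ?thesis by blast
  next
    case False
    then obtain b0 where b0: "b0 \<in> B" by blast
    have "b0 > 0" using b0 assms(1) by (metis gr0I)
    have B': "B' \<noteq> {}" using False taut_companion_empty_iff[OF assms(1) comp] by simp
    then obtain b where b: "b \<in> B'" by blast
    have bpos: "b > 0" using b B'0 by (metis gr0I)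
    have free_sub: "n \<in> free_set B" if "n \<in> free_set B'" for n
      using le_funD[OF eta_le, of n] that by (simp add: eta_eq split: if_splits)
    have zero_block: "\<exists>r. \<forall>i\<in>{0..<int m}. i + r \<notin> free_set B'" for m
      using proximal_zero_block[OF assms(4) b0 \<open>b0 > 0\<close>, of m] free_sub by blast
    have cop: "\<And>K. K > 0 \<Longrightarrow> \<exists>b\<in>B'. coprime b K"
      using zero_block_coprime[OF zero_block] by blast
    have her: "hereditary (X_eta B')" by (rule taut_hereditary[OF taut B' cop])
    have subT: "\<tau> ` X_eta B' \<subseteq> X_eta B'"
      using companion_image_subset[OF assms(1) comp her T(1) _ T(3)] T(2) by simp
    have subS: "\<sigma> ` X_eta B' \<subseteq> X_eta B'"
      using companion_image_subset[OF assms(1) comp her S(1) _ S(3)] S(2) by simp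
    have "x \<in> \<tau> ` X_eta B'" if x: "x \<in> X_eta B'" for x
    proof (rule image_eqI)
      show "x = \<tau> (\<sigma> x)" using \<sigma>(3)[of x] sub x by auto
      show "\<sigma> x \<in> X_eta B'" using subS x by blast
    qed
    then have image: "\<tau> ` X_eta B' = X_eta B'" using subT by blast
    have TX: "\<tau> x \<in> X_eta B'" and SX: "\<sigma> x \<in> X_eta B'" if "x \<in> X_eta B'" for x
      using that subT subS by blast+
    have Tk: "\<tau> (shift_by k x) = shift_by k (\<tau> x)" and Sk: "\<sigma> (shift_by k x) = shift_by k (\<sigma> x)"
      if "x \<in> X_eta B'" for k x
      using T(4) S(4) that sub by blast+
    have zero: "(\<lambda>_. 0) \<in> X_eta B'"
    proof -
      have "(\<lambda>_. 0) \<in> full_shift" "(\<lambda>_. 0) \<le> eta B'" by (auto simp: full_shift_def le_fun_def)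
      then show ?thesis using her eta_X_eta[of B'] unfolding hereditary_def by blast
    qed
    have T0: "\<tau> (\<lambda>_. 0) = (\<lambda>_. 0)"
    proof (rule shift_fixed_eq_zero[OF b bpos TX[OF zero]])
      fix k
      have "shift_by k (\<lambda>_. 0) = (\<lambda>_. 0)" by (simp add: shift_by_def)
      then show "shift_by k (\<tau> (\<lambda>_. 0)) = \<tau> (\<lambda>_. 0)" using Tk[OF zero, of k] by simp
    qed
    have "\<exists>k. \<forall>x\<in>X_eta B'. \<tau> x = shift_by k x"
    proof (cases "1 \<in> B'")
      case True
      \<comment> \<open>The zero density case: \<open>X_eta B'\<close> consists of the zero sequence
        alone.\<close>
      have "x = (\<lambda>_. 0)" if x: "x \<in> X_eta B'" for x
      proof
        fix j
        obtain r where "\<forall>i\<in>{j}. x i = eta B' (i + r)" using x finite.emptyI finite_insert unfolding X_eta_iff by metis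
        moreover have "n \<notin> free_set B'" for n using True unfolding mem_free_set by (metis of_nat_1 one_dvd)
        ultimately show "x j = 0" by (simp add: eta_eq)
      qed
      then have "\<tau> x = shift_by 0 x" if "x \<in> X_eta B'" for x using that T0 by simp
      then show ?thesis by blast
    next
      case False
      have e: "unit_point \<in> X_eta B'" by (rule unit_point_X_eta[OF her False])
      \<comment> \<open>\<open>\<tau>\<close> is injective and already fixes the zero
        sequence.\<close>
      have "\<tau> unit_point \<noteq> (\<lambda>_. 0)"
      proof
        assume "\<tau> unit_point = (\<lambda>_. 0)"
        then have "\<sigma> (\<tau> unit_point) = \<sigma> (\<tau> (\<lambda>_. 0))" using T0 by simp
        then have "unit_point = (\<lambda>_. 0)" using \<sigma>(2) e zero sub by (metis subsetD)
        then show False by (metis unit_point_def zero_neq_one)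
      qed
      then obtain k where k: "\<tau> unit_point k \<noteq> 0" by auto
      \<comment> \<open>The shift by \<open>k\<close> brings a one of
        \<open>\<tau> unit_point\<close> to 0; \<open>g\<close> is the left inverse of
        \<open>f\<close>.\<close>
      define f where "f x = shift_by k (\<tau> x)" for x
      define g where "g x = \<sigma> (shift_by (- k) x)" for x
      have gf: "g (f x) = x" if "x \<in> X_eta B'" for x
        using \<sigma>(2) that sub by (auto simp: f_def g_def shift_by_shift_by)
      have fe: "f unit_point 0 = 1"
      proof -
        have "\<tau> unit_point k \<in> {0, 1}" using TX[OF e] X_eta_full_shift[of B'] unfolding full_shift_def by blast
        then show ?thesis using k by (simp add: f_def shift_by_def)
      qed
      have fle: "f x \<le> x" if "x \<in> X_eta B'" for x
      proof (rule taut_endomorphism_le[where f = f, OF taut B' cop her _ _ _ e fe that])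
        show "continuous_on (X_eta B') f" unfolding f_def
          by (rule continuous_on_compose2[OF continuous_shift_by[of UNIV] continuous_on_subset[OF T(1) sub]]) simp
        show "f y \<in> X_eta B'" if "y \<in> X_eta B'" for y
          unfolding f_def by (rule shift_by_X_eta[OF TX[OF that]])
        show "f (shift_by l y) = shift_by l (f y)" if "y \<in> X_eta B'" for y l
          using Tk[OF that] by (simp add: f_def shift_by_shift_by add.commute)
      qed
      \<comment> \<open>Below \<open>unit_point\<close> and with a one at 0 there is only
        \<open>unit_point\<close>; this gives \<open>g\<close> the normalisation it
        requires.\<close>
      have "f unit_point = unit_point"
      proof
        fix j show "f unit_point j = unit_point j"
          using le_funD[OF fle[OF e], of j] fe by (cases "j = 0") (simp_all add: unit_point_def)
      qed
      then have ge: "g unit_point 0 = 1" using gf[OF e] by (simp add: unit_point_def)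
      have gle: "g x \<le> x" if "x \<in> X_eta B'" for x
      proof (rule taut_endomorphism_le[where f = g, OF taut B' cop her _ _ _ e ge that])
        show "continuous_on (X_eta B') g" unfolding g_def
          by (rule continuous_on_compose2[OF continuous_on_subset[OF S(1) sub] continuous_shift_by])
            (intro image_subsetI shift_by_X_eta)
        show "g y \<in> X_eta B'" if "y \<in> X_eta B'" for y
          unfolding g_def by (rule SX[OF shift_by_X_eta[OF that]])
        show "g (shift_by l y) = shift_by l (g y)" if "y \<in> X_eta B'" for y l
          using Sk[OF shift_by_X_eta[OF that], of l "- k"] by (simp add: g_def shift_by_shift_by add.commute)
      qed
      \<comment> \<open>The two inequalities close up:
        \<open>x = g (f x) \<le> f x \<le> x\<close>.\<close>
      have "\<tau> x = shift_by (- k) x" if x: "x \<in> X_eta B'" for x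
      proof -
        have "f x \<in> X_eta B'" unfolding f_def by (rule shift_by_X_eta[OF TX[OF x]])
        then have "x \<le> f x" using gle[of "f x"] gf[OF x] by simp
        then have "f x = x" using fle[OF x] by (rule antisym[rotated])
        then have "shift_by (- k) (shift_by k (\<tau> x)) = shift_by (- k) x" unfolding f_def by simp
        then show ?thesis by (simp add: shift_by_shift_by)
      qed
      then show ?thesis by blast
    qed
    with image show ?thesis by blast
  qed
  then show ?thesis using supp mir by simp
qed

end
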